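(* Let $n\ge 1$. Let $s_1,s_2,s$ be real numbers and $1\leq p,p_1,p_2<\infty$ be real numbers satisfying (i) $s_i\geq s\geq 0$ for $i=1,2$; (ii) $s\in\mathbb{N}_0$; and one of the following two sets of conditions: (A) $s_i-s\geq n\left(\frac{1}{p_i}-\frac{1}{p}\right)$ for $i=1,2$, and $s_1+s_2-s>n\left(\frac{1}{p_1}+\frac{1}{p_2}-\frac{1}{p}\right)\geq 0$; or (B) $s_i-s> n\left(\frac{1}{p_i}-\frac{1}{p}\right)$ for $i=1,2$, and $s_1+s_2-s\geq n\left(\frac{1}{p_1}+\frac{1}{p_2}-\frac{1}{p}\right)\geq 0$. Then for all $u\in W^{s_1,p_1}(\mathbb{R}^n)$ and $v\in W^{s_2,p_2}(\mathbb{R}^n)$ one has $uv\in W^{s,p}(\mathbb{R}^n)$, and moreover pointwise multiplication of functions is a continuous bilinear map $$W^{s_1,p_1}(\mathbb{R}^n)\times W^{s_2,p_2}(\mathbb{R}^n)\rightarrow W^{s,p}(\mathbb{R}^n).$$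
   Context: Sobolev-Slobodeckij spaces on $\mathbb{R}^n$, for $1\le p<\infty$: for $k\in\mathbb{N}_0$, $W^{k,p}(\mathbb{R}^n)$ is the set of $u\in L^p(\mathbb{R}^n)$ with $\|u\|_{W^{k,p}}:=\sum_{|\nu|\le k}\|\partial^\nu u\|_{L^p}<\infty$ (weak derivatives). For $\theta\in(0,1)$ put $|u|_{W^{\theta,p}}:=\left(\iint_{\mathbb{R}^n\times\mathbb{R}^n}\frac{|u(x)-u(y)|^p}{|x-y|^{n+\theta p}}\,dx\,dy\right)^{1/p}$. For $s=k+\theta$ with $k\in\mathbb{N}_0$, $\theta\in(0,1)$, $W^{s,p}(\mathbb{R}^n)$ is the set of $u\in W^{k,p}(\mathbb{R}^n)$ with $\|u\|_{W^{s,p}}:=\|u\|_{W^{k,p}}+\sum_{|\nu|=k}|\partial^\nu u|_{W^{\theta,p}}<\infty$. *)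

theory Defs
  imports "HOL-Analysis.Analysis"
begin

section \<open>Partial derivatives and test functions\<close>

text \<open>
  A multi-index is a function \<open>\<nu> :: 'n \<Rightarrow> nat\<close>; the dimension is \<open>CARD('n)\<close>.
\<close>

type_synonym 'n multi_index = "'n \<Rightarrow> nat"

definition mi_order :: "'n::finite multi_index \<Rightarrow> nat" where
  "mi_order \<nu> = (\<Sum>i\<in>UNIV. \<nu> i)"

text \<open>
  Only applied to (Frechet) differentiable functions, for which it is the usual partial
  derivative in the \<open>i\<close>-th coordinate.
\<close>

definition partial :: "'n::finite \<Rightarrow> (real^'n \<Rightarrow> real) \<Rightarrow> real^'n \<Rightarrow> real" where
  "partial i f = (\<lambda>x. frechet_derivative f (at x) (axis i 1))"

text \<open>
  The index type carries no order, so an enumeration of the coordinates is chosen. By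
  symmetry of mixed partial derivatives the choice is immaterial for smooth functions.
\<close>

definition coords :: "'n::finite list" where
  "coords = (SOME is. distinct is \<and> set is = UNIV)"

definition mi_partial :: "'n::finite multi_index \<Rightarrow> (real^'n \<Rightarrow> real) \<Rightarrow> real^'n \<Rightarrow> real" where
  "mi_partial \<nu> f = foldr (\<lambda>i. partial i ^^ \<nu> i) coords f"

text \<open>
  All iterated partial derivatives exist and are differentiable, hence continuous.
\<close>

definition smooth :: "(real^'n::finite \<Rightarrow> real) \<Rightarrow> bool" where
  "smooth f \<longleftrightarrow> (\<forall>is x. foldr partial is f differentiable (at x))"

definition test_function :: "(real^'n::finite \<Rightarrow> real) \<Rightarrow> bool" where
  "test_function \<phi> \<longleftrightarrow> smooth \<phi> \<and> compact (closure {x. \<phi> x \<noteq> 0})"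

section \<open>Lebesgue spaces and weak derivatives\<close>

text \<open>
  Functions are everywhere defined representatives, not classes modulo null sets, with
  values in \<open>'b :: {real_normed_field, euclidean_space}\<close>; this covers real-valued and
  complex-valued functions.
\<close>

definition Lp_space ::
    "real \<Rightarrow> (real^'n::finite \<Rightarrow> 'b::{real_normed_field,euclidean_space}) set" where
  "Lp_space p =
     {f. f \<in> borel_measurable lebesgue \<and> integrable lebesgue (\<lambda>x. norm (f x) powr p)}"

definition Lp_norm ::
    "real \<Rightarrow> (real^'n::finite \<Rightarrow> 'b::{real_normed_field,euclidean_space}) \<Rightarrow> real" where
  "Lp_norm p f = (LINT x|lebesgue. norm (f x) powr p) powr (1 / p)"

definition locally_integrable ::
    "(real^'n::finite \<Rightarrow> 'b::{real_normed_field,euclidean_space}) \<Rightarrow> bool" where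
  "locally_integrable f \<longleftrightarrow> (\<forall>K. compact K \<longrightarrow> set_integrable lebesgue K f)"

definition has_weak_deriv ::
    "'n::finite multi_index \<Rightarrow> (real^'n \<Rightarrow> 'b::{real_normed_field,euclidean_space}) \<Rightarrow>
      (real^'n \<Rightarrow> 'b) \<Rightarrow> bool" where
  "has_weak_deriv \<nu> u w \<longleftrightarrow>
     locally_integrable u \<and> locally_integrable w \<and>
     (\<forall>\<phi>. test_function \<phi> \<longrightarrow>
        (LINT x|lebesgue. mi_partial \<nu> \<phi> x *\<^sub>R u x) =
        (- 1) ^ mi_order \<nu> * (LINT x|lebesgue. \<phi> x *\<^sub>R w x))"

text \<open>Weak derivatives are unique up to null sets; one representative is chosen.\<close>

definition weak_deriv ::
    "'n::finite multi_index \<Rightarrow> (real^'n \<Rightarrow> 'b::{real_normed_field,euclidean_space}) \<Rightarrow>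
      (real^'n \<Rightarrow> 'b)" where
  "weak_deriv \<nu> u = (SOME w. has_weak_deriv \<nu> u w)"

section \<open>Sobolev-Slobodeckij spaces\<close>

definition sobolev_int ::
    "nat \<Rightarrow> real \<Rightarrow> (real^'n::finite \<Rightarrow> 'b::{real_normed_field,euclidean_space}) set" where
  "sobolev_int k p =
     {u \<in> Lp_space p. \<forall>\<nu>. mi_order \<nu> \<le> k \<longrightarrow>
        (\<exists>w. has_weak_deriv \<nu> u w) \<and> weak_deriv \<nu> u \<in> Lp_space p}"

definition sobolev_int_norm ::
    "nat \<Rightarrow> real \<Rightarrow> (real^'n::finite \<Rightarrow> 'b::{real_normed_field,euclidean_space}) \<Rightarrow> real" where
  "sobolev_int_norm k p u = (\<Sum>\<nu> | mi_order \<nu> \<le> k. Lp_norm p (weak_deriv \<nu> u))"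

definition slobodeckij_kernel ::
    "real \<Rightarrow> real \<Rightarrow> (real^'n::finite \<Rightarrow> 'b::{real_normed_field,euclidean_space}) \<Rightarrow>
      (real^'n) \<times> (real^'n) \<Rightarrow> real" where
  "slobodeckij_kernel \<theta> p u =
     (\<lambda>(x, y). norm (u x - u y) powr p / norm (x - y) powr (real CARD('n) + \<theta> * p))"

definition slobodeckij_finite ::
    "real \<Rightarrow> real \<Rightarrow> (real^'n::finite \<Rightarrow> 'b::{real_normed_field,euclidean_space}) \<Rightarrow> bool" where
  "slobodeckij_finite \<theta> p u \<longleftrightarrow>
     integrable (lebesgue \<Otimes>\<^sub>M lebesgue) (slobodeckij_kernel \<theta> p u)"

definition slobodeckij_seminorm ::
    "real \<Rightarrow> real \<Rightarrow> (real^'n::finite \<Rightarrow> 'b::{real_normed_field,euclidean_space}) \<Rightarrow> real" where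
  "slobodeckij_seminorm \<theta> p u =
     (LINT z|(lebesgue \<Otimes>\<^sub>M lebesgue). slobodeckij_kernel \<theta> p u z) powr (1 / p)"

text \<open>
  For real \<open>s \<ge> 0\<close>, written as \<open>s = k + \<theta>\<close> with \<open>k = nat \<lfloor>s\<rfloor>\<close> and \<open>\<theta> = frac s\<close>.
\<close>

definition sobolev ::
    "real \<Rightarrow> real \<Rightarrow> (real^'n::finite \<Rightarrow> 'b::{real_normed_field,euclidean_space}) set" where
  "sobolev s p =
     (if s \<in> \<nat> then sobolev_int (nat \<lfloor>s\<rfloor>) p
      else {u \<in> sobolev_int (nat \<lfloor>s\<rfloor>) p.
              \<forall>\<nu>. mi_order \<nu> = nat \<lfloor>s\<rfloor> \<longrightarrow> slobodeckij_finite (frac s) p (weak_deriv \<nu> u)})"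

definition sobolev_norm ::
    "real \<Rightarrow> real \<Rightarrow> (real^'n::finite \<Rightarrow> 'b::{real_normed_field,euclidean_space}) \<Rightarrow> real" where
  "sobolev_norm s p u =
     (if s \<in> \<nat> then sobolev_int_norm (nat \<lfloor>s\<rfloor>) p u
      else sobolev_int_norm (nat \<lfloor>s\<rfloor>) p u +
             (\<Sum>\<nu> | mi_order \<nu> = nat \<lfloor>s\<rfloor>. slobodeckij_seminorm (frac s) p (weak_deriv \<nu> u)))"

section \<open>Continuous bilinear maps between normed function spaces\<close>

text \<open>
  The topology induced on a set \<open>V\<close> of functions by a norm \<open>N\<close>. Since representatives are
  used, \<open>N\<close> vanishes on null functions and the topology identifies exactly the functions
  that agree almost everywhere; continuity for it is continuity on the space of classes.
\<close>

definition norm_topology :: "('a \<Rightarrow> 'b::ab_group_add) set \<Rightarrow> (('a \<Rightarrow> 'b) \<Rightarrow> real) \<Rightarrow>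
    ('a \<Rightarrow> 'b) topology" where
  "norm_topology V N =
     topology (\<lambda>U. U \<subseteq> V \<and>
       (\<forall>u\<in>U. \<exists>\<epsilon>>0. \<forall>v\<in>V. N (\<lambda>x. v x - u x) < \<epsilon> \<longrightarrow> v \<in> U))"

lemma openin_norm_topology:
  "openin (norm_topology V N) U \<longleftrightarrow>
     U \<subseteq> V \<and> (\<forall>u\<in>U. \<exists>\<epsilon>>0. \<forall>v\<in>V. N (\<lambda>x. v x - u x) < \<epsilon> \<longrightarrow> v \<in> U)"
proof -
  let ?P = "\<lambda>U. U \<subseteq> V \<and> (\<forall>u\<in>U. \<exists>\<epsilon>>0. \<forall>v\<in>V. N (\<lambda>x. v x - u x) < \<epsilon> \<longrightarrow> v \<in> U)"
  have "?P (S \<inter> T)" if S: "?P S" and T: "?P T" for S T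
  proof (intro conjI ballI)
    show "S \<inter> T \<subseteq> V" using S by blast
    fix u assume u: "u \<in> S \<inter> T"
    obtain d where d: "d > 0" "\<forall>v\<in>V. N (\<lambda>x. v x - u x) < d \<longrightarrow> v \<in> S" using S u by blast
    obtain e where e: "e > 0" "\<forall>v\<in>V. N (\<lambda>x. v x - u x) < e \<longrightarrow> v \<in> T" using T u by blast
    show "\<exists>\<epsilon>>0. \<forall>v\<in>V. N (\<lambda>x. v x - u x) < \<epsilon> \<longrightarrow> v \<in> S \<inter> T"
      using d e by (intro exI[of _ "min d e"]) auto
  qed
  moreover have "?P (\<Union>\<K>)" if K: "\<forall>K\<in>\<K>. ?P K" for \<K>
  proof (intro conjI ballI)
    show "\<Union>\<K> \<subseteq> V" using K by blast
    fix u assume "u \<in> \<Union>\<K>"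
    then obtain K where "K \<in> \<K>" "u \<in> K" by blast
    moreover from this K
    obtain e where "e > 0" "\<forall>v\<in>V. N (\<lambda>x. v x - u x) < e \<longrightarrow> v \<in> K" by meson
    ultimately show "\<exists>\<epsilon>>0. \<forall>v\<in>V. N (\<lambda>x. v x - u x) < \<epsilon> \<longrightarrow> v \<in> \<Union>\<K>"
      by (intro exI[of _ e]) blast
  qed
  ultimately have "istopology ?P"
    unfolding istopology_def by (intro conjI allI impI) presburger+
  then show ?thesis unfolding norm_topology_def by (simp add: topology_inverse')
qed

definition continuous_bilinear_on ::
    "('a \<Rightarrow> 'b::field) set \<Rightarrow> (('a \<Rightarrow> 'b) \<Rightarrow> real) \<Rightarrow>
     ('a \<Rightarrow> 'b) set \<Rightarrow> (('a \<Rightarrow> 'b) \<Rightarrow> real) \<Rightarrow>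
     ('a \<Rightarrow> 'b) set \<Rightarrow> (('a \<Rightarrow> 'b) \<Rightarrow> real) \<Rightarrow>
     (('a \<Rightarrow> 'b) \<Rightarrow> ('a \<Rightarrow> 'b) \<Rightarrow> ('a \<Rightarrow> 'b)) \<Rightarrow> bool" where
  "continuous_bilinear_on V1 N1 V2 N2 V N B \<longleftrightarrow>
     (\<forall>u\<in>V1. \<forall>v\<in>V2. B u v \<in> V) \<and>
     (\<forall>u\<in>V1. \<forall>u'\<in>V1. \<forall>v\<in>V2. \<forall>a b.
        B (\<lambda>x. a * u x + b * u' x) v = (\<lambda>x. a * B u v x + b * B u' v x)) \<and>
     (\<forall>u\<in>V1. \<forall>v\<in>V2. \<forall>v'\<in>V2. \<forall>a b.
        B u (\<lambda>x. a * v x + b * v' x) = (\<lambda>x. a * B u v x + b * B u v' x)) \<and>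
     continuous_map (prod_topology (norm_topology V1 N1) (norm_topology V2 N2))
       (norm_topology V N) (\<lambda>(u, v). B u v)"

end

theory Submission
  imports Defs
begin

text \<open>
  A weak derivative of \<open>u v\<close> of order at most \<open>s\<close> is a sum of products of a derivative of \<open>u\<close> and
  a derivative of \<open>v\<close> with orders \<open>a + b \<le> s\<close>. By Sobolev's embedding each factor lies in all
  Lebesgue spaces with reciprocal exponent between \<open>1 / p\<^sub>i - (s\<^sub>i - a) / n\<close> and \<open>1 / p\<^sub>i\<close>, and the
  hypotheses say that two such numbers with sum \<open>1 / p\<close> exist; Hoelder's inequality then bounds the
  product (\<open>derivative_exponents\<close>, \<open>sobolev_product_bound\<close>). Some of the inequalities may
  be equalities, so the critical embedding is needed, for fractional orders and for \<open>p\<^sub>i = 1\<close> as well;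
  the borderline embedding into the bounded functions never occurs.

  \<^bold>\<open>Embeddings.\<close> Functions of first order and functions of fractional order \<open>\<theta>\<close> have a common
  property: the set of pairs at distance less than \<open>r\<close> between which \<open>f = norm u\<close> climbs from below \<open>a\<close>
  to above \<open>b\<close> is small, in terms of \<open>r\<close> and of an energy \<open>D a b\<close> whose sum over
  consecutive ranges of levels is bounded (\<open>climbing_bound\<close>). Taking a ball with twice the measure of \<open>{f > a}\<close> turns this into
  \<open>(b - a)\<^sup>p |{f > b}| \<le> C |{f > a}|\<^sup>\<kappa> D a b\<close> with \<open>\<kappa> = \<theta> p / n\<close> (\<open>level_decay\<close>). For
  \<open>\<kappa> > 1\<close> De Giorgi's iteration shows that \<open>f\<close> is bounded. For finite exponents \<open>q\<close>, summation over dyadic levels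
  and Chebyshev's inequality for the \<open>q\<close>-th power of \<open>f\<close> itself give \<open>N \<le> A + B N\<^sup>\<lambda>\<close> with
  \<open>\<lambda> < 1\<close> for the integral \<open>N\<close> of \<open>f\<^sup>q\<close>, up to and including the critical exponent. Embeddings
  of higher order follow by descending from the top derivatives, one order at a time
  (\<open>sobolev_embedding_ladder\<close>).

  \<^bold>\<open>Weak derivatives.\<close> Products and increments are studied on lines: for locally integrable functions,
  \<open>G\<close> is the weak derivative of \<open>g\<close> in direction \<open>h\<close> if and only if for every \<open>t\<close> the increment \<open>g (x + t h) - g x\<close> is the integral of \<open>G\<close>
  over the segment, for almost every \<open>x\<close> (\<open>weak_dir_line_increment\<close>, \<open>line_increment_weak_dir\<close>).
  Thus the product rule reduces to integration by parts on an interval and holds as soon as the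
  products in it are locally integrable, and the energy of a first-order function on a range of
  levels is found by looking at the last and first passage through these levels on a segment.

  Continuity of the multiplication is then the usual argument for a bounded bilinear map, which
  rests on Minkowski's inequality for the norms.
\<close>

section \<open>Calculus of test functions\<close>

lemma partial_eqI:
  assumes "(f has_derivative f') (at x)"
  shows "partial i f x = f' (axis i 1)"
  using frechet_derivative_at[OF assms] by (simp add: partial_def)

text \<open>
  Smoothness speaks of all iterated partial derivatives at once; a class of differentiable functions
  that is stable under partial derivatives proves it without computing any of them.
\<close>

lemma smooth_coinduct:
  assumes "S f"
    and "\<And>f x. S f \<Longrightarrow> f differentiable (at x)"
    and "\<And>f i. S f \<Longrightarrow> S (partial i f)"
  shows "smooth f"
proof -
  have "S (foldr partial is f)" for "is"
    by (induction "is") (use assms in auto)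
  then show ?thesis
    using assms(2) by (auto simp: smooth_def)
qed

lemma smooth_differentiable: "smooth f \<Longrightarrow> f differentiable (at x)"
  unfolding smooth_def by (metis foldr_Nil id_apply)

lemma smooth_partial: "smooth f \<Longrightarrow> smooth (partial i f)"
  unfolding smooth_def
proof (intro allI)
  fix "is" x assume *: "\<forall>is x. foldr partial is f differentiable at x"
  have "foldr partial (is @ [i]) f differentiable at x" using * by blast
  then show "foldr partial is (partial i f) differentiable at x" by simp
qed

lemma smooth_foldr_partial: "smooth f \<Longrightarrow> smooth (foldr partial is f)"
  by (induction "is") (auto intro: smooth_partial)

lemma smooth_has_derivative:
  assumes "smooth f"
  shows "(f has_derivative (\<lambda>h. \<Sum>i\<in>UNIV. h $ i * partial i f x)) (at x)"
proof -
  define D where "D = frechet_derivative f (at x)"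
  have D: "(f has_derivative D) (at x)"
    using smooth_differentiable[OF assms] frechet_derivative_works D_def by blast
  have lin: "linear D" by (rule has_derivative_linear[OF D])
  have "D h = (\<Sum>i\<in>UNIV. h $ i * partial i f x)" for h
  proof -
    have "D h = D (\<Sum>i\<in>UNIV. h $ i *\<^sub>R axis i 1)"
      by (metis basis_expansion scalar_mult_eq_scaleR)
    also have "\<dots> = (\<Sum>i\<in>UNIV. h $ i * D (axis i 1))"
      by (simp add: linear_sum[OF lin] linear_cmul[OF lin])
    finally show ?thesis by (simp add: partial_def D_def)
  qed
  then show ?thesis using D by (metis (no_types, lifting) ext)
qed

lemma smooth_continuous: "smooth f \<Longrightarrow> continuous_on UNIV f"
  by (meson continuous_at_imp_continuous_on differentiable_imp_continuous_within smooth_differentiable)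

lemma sum_axis: "(\<Sum>i\<in>UNIV. axis j (c::real) $ i * g i) = c * g j"
proof -
  have "(\<Sum>i\<in>UNIV. axis j c $ i * g i) = (\<Sum>i\<in>UNIV. if i = j then c * g i else 0)"
    by (rule sum.cong) (auto simp: axis_def)
  then show ?thesis by simp
qed

lemma smooth_translate:
  assumes "smooth f"
  shows "smooth (\<lambda>x. f (x + c))" and "partial i (\<lambda>x. f (x + c)) = (\<lambda>x. partial i f (x + c))"
proof -
  have der: "((\<lambda>x. f (x + c)) has_derivative (\<lambda>h. \<Sum>i\<in>UNIV. h $ i * partial i f (x + c))) (at x)"
    if "smooth f" for f :: "real^'a \<Rightarrow> real" and x
  proof -
    have "((\<lambda>x. x + c) has_derivative (\<lambda>h. h)) (at x)"
      by (auto intro!: derivative_eq_intros)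
    from has_derivative_compose[OF this smooth_has_derivative[OF that]] show ?thesis .
  qed
  have part: "partial i (\<lambda>x. f (x + c)) = (\<lambda>x. partial i f (x + c))" if "smooth f" for f i
  proof
    fix x
    show "partial i (\<lambda>x. f (x + c)) x = partial i f (x + c)"
      by (subst partial_eqI[OF der[OF that]]) (simp add: sum_axis)
  qed
  show "partial i (\<lambda>x. f (x + c)) = (\<lambda>x. partial i f (x + c))" by (rule part[OF assms])
  show "smooth (\<lambda>x. f (x + c))"
  proof (rule smooth_coinduct[where S = "\<lambda>h. \<exists>f. smooth f \<and> h = (\<lambda>x. f (x + c))"])
    show "\<exists>fa. smooth fa \<and> (\<lambda>x. f (x + c)) = (\<lambda>x. fa (x + c))" using assms by blast
    show "\<And>f x. \<exists>fa. smooth fa \<and> f = (\<lambda>x. fa (x + c)) \<Longrightarrow> f differentiable at x"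
      using der unfolding differentiable_def by blast
    show "\<And>f i. \<exists>fa. smooth fa \<and> f = (\<lambda>x. fa (x + c)) \<Longrightarrow>
           \<exists>fa. smooth fa \<and> partial i f = (\<lambda>x. fa (x + c))"
      using part smooth_partial by blast
  qed
qed

lemma smooth_line_derivative:
  assumes "smooth f"
  shows "((\<lambda>t. f (x + t *\<^sub>R axis i 1)) has_real_derivative partial i f (x + t *\<^sub>R axis i 1)) (at t)"
proof -
  have "((\<lambda>t. x + t *\<^sub>R axis i 1) has_derivative (\<lambda>h. h *\<^sub>R axis i 1)) (at t)"
    by (auto intro!: derivative_eq_intros)
  from has_derivative_compose[OF this smooth_has_derivative[OF assms]]
  show ?thesis
    by (simp add: has_field_derivative_def sum_axis mult.assoc mult.commute mult_commute_abs flip: sum_distrib_left)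
qed

text \<open>
  The mean value theorem, applied in direction \<open>i\<close> to the increment in direction \<open>j\<close>, and then in
  direction \<open>j\<close>.
\<close>

lemma second_difference:
  fixes f :: "real^'n::finite \<Rightarrow> real"
  assumes f: "smooth f" and d: "d > (0::real)"
  obtains \<xi> \<eta> where "0 < \<xi>" "\<xi> < d" "0 < \<eta>" "\<eta> < d"
    "f (x + d *\<^sub>R axis i 1 + d *\<^sub>R axis j 1) - f (x + d *\<^sub>R axis i 1) - f (x + d *\<^sub>R axis j 1) + f x
     = d * d * partial j (partial i f) (x + \<xi> *\<^sub>R axis i 1 + \<eta> *\<^sub>R axis j 1)"
proof -
  define e :: "'n \<Rightarrow> real^'n" where "e = (\<lambda>k. axis k 1)"
  define h where "h = (\<lambda>t. f ((x + d *\<^sub>R e j) + t *\<^sub>R e i) - f (x + t *\<^sub>R e i))"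
  have "\<And>t. (h has_real_derivative (partial i f ((x + d *\<^sub>R e j) + t *\<^sub>R e i) - partial i f (x + t *\<^sub>R e i))) (at t)"
    unfolding h_def e_def by (intro DERIV_diff smooth_line_derivative f)
  from MVT2[OF d this] obtain \<xi> where xi: "0 < \<xi>" "\<xi> < d"
    "h d - h 0 = (d - 0) * (partial i f ((x + d *\<^sub>R e j) + \<xi> *\<^sub>R e i) - partial i f (x + \<xi> *\<^sub>R e i))" by metis
  have "\<And>t. ((\<lambda>t. partial i f ((x + \<xi> *\<^sub>R e i) + t *\<^sub>R e j)) has_real_derivative
          partial j (partial i f) ((x + \<xi> *\<^sub>R e i) + t *\<^sub>R e j)) (at t)"
    unfolding e_def by (intro smooth_line_derivative smooth_partial f)
  from MVT2[OF d this] obtain \<eta> where eta: "0 < \<eta>" "\<eta> < d"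
    "partial i f ((x + \<xi> *\<^sub>R e i) + d *\<^sub>R e j) - partial i f ((x + \<xi> *\<^sub>R e i) + 0 *\<^sub>R e j)
      = (d - 0) * partial j (partial i f) ((x + \<xi> *\<^sub>R e i) + \<eta> *\<^sub>R e j)" by metis
  have "h d - h 0 = d * d * partial j (partial i f) (x + \<xi> *\<^sub>R e i + \<eta> *\<^sub>R e j)"
    using xi(3) eta(3) by (simp add: add.assoc add.commute add.left_commute)
  moreover have "h d - h 0 = f (x + d *\<^sub>R e i + d *\<^sub>R e j) - f (x + d *\<^sub>R e i) - f (x + d *\<^sub>R e j) + f x"
    by (simp add: h_def algebra_simps)
  ultimately show ?thesis using that[OF xi(1,2) eta(1,2)] by (simp add: e_def)
qed

text \<open>
  Over a small square the second difference is the area times either mixed derivative at some point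
  of the square, and both mixed derivatives are continuous.
\<close>

lemma partial_commute:
  assumes f: "smooth f"
  shows "partial i (partial j f) = partial j (partial i f)"
proof
  fix x
  define A where "A = partial i (partial j f)"
  define B where "B = partial j (partial i f)"
  have cA: "isCont A x" and cB: "isCont B x"
    using f smooth_partial differentiable_imp_continuous_within smooth_differentiable
    unfolding A_def B_def by blast+
  have "dist (A x) (B x) < \<epsilon>" if eps: "\<epsilon> > 0" for \<epsilon>
  proof -
    obtain r where r: "r > 0" "\<And>y. dist y x < r \<Longrightarrow> dist (A y) (A x) < \<epsilon>/2"
      using cA[unfolded continuous_at_eps_delta, rule_format, OF half_gt_zero[OF eps]] by blast
    obtain r' where r': "r' > 0" "\<And>y. dist y x < r' \<Longrightarrow> dist (B y) (B x) < \<epsilon>/2"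
      using cB[unfolded continuous_at_eps_delta, rule_format, OF half_gt_zero[OF eps]] by blast
    define d where "d = min r r' / 2"
    have d: "d > 0" using r r' by (simp add: d_def)
    have close: "dist (x + \<xi> *\<^sub>R axis k 1 + \<eta> *\<^sub>R axis l 1) x < min r r'"
      if "0 < \<xi>" "\<xi> < d" "0 < \<eta>" "\<eta> < d" for \<xi> \<eta> k l
    proof -
      have "dist (x + \<xi> *\<^sub>R axis k 1 + \<eta> *\<^sub>R axis l 1) x = norm (\<xi> *\<^sub>R axis k (1::real) + \<eta> *\<^sub>R axis l 1)"
        by (simp add: dist_norm algebra_simps)
      also have "\<dots> \<le> norm (\<xi> *\<^sub>R axis k (1::real)) + norm (\<eta> *\<^sub>R axis l (1::real))"
        by (rule norm_triangle_ineq)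
      also have "\<dots> = \<xi> + \<eta>" using that by (simp)
      also have "\<dots> < min r r'" using that by (simp add: d_def)
      finally show ?thesis .
    qed
    obtain a b where ab: "0 < a" "a < d" "0 < b" "b < d"
      "f (x + d *\<^sub>R axis i 1 + d *\<^sub>R axis j 1) - f (x + d *\<^sub>R axis i 1) - f (x + d *\<^sub>R axis j 1) + f x
     = d * d * B (x + a *\<^sub>R axis i 1 + b *\<^sub>R axis j 1)"
      unfolding B_def by (rule second_difference[OF f d])
    obtain a' b' where ab': "0 < a'" "a' < d" "0 < b'" "b' < d"
      "f (x + d *\<^sub>R axis j 1 + d *\<^sub>R axis i 1) - f (x + d *\<^sub>R axis j 1) - f (x + d *\<^sub>R axis i 1) + f x
     = d * d * A (x + a' *\<^sub>R axis j 1 + b' *\<^sub>R axis i 1)"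
      unfolding A_def by (rule second_difference[OF f d])
    have "d * d * A (x + a' *\<^sub>R axis j 1 + b' *\<^sub>R axis i 1) = d * d * B (x + a *\<^sub>R axis i 1 + b *\<^sub>R axis j 1)"
      unfolding ab(5)[symmetric] ab'(5)[symmetric] by (simp add: algebra_simps)
    then have "A (x + a' *\<^sub>R axis j 1 + b' *\<^sub>R axis i 1) = B (x + a *\<^sub>R axis i 1 + b *\<^sub>R axis j 1)"
      using d by simp
    moreover have "dist (A (x + a' *\<^sub>R axis j 1 + b' *\<^sub>R axis i 1)) (A x) < \<epsilon>/2"
      using r(2) close[OF ab'(1-4)] by simp
    moreover have "dist (B (x + a *\<^sub>R axis i 1 + b *\<^sub>R axis j 1)) (B x) < \<epsilon>/2"
      using r'(2) close[OF ab(1-4)] by simp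
    ultimately show ?thesis
      by (metis dist_commute dist_triangle_half_l)
  qed
  then have "A x = B x" by (metis dist_eq_0_iff less_irrefl zero_less_dist_iff)
  then show "partial i (partial j f) x = partial j (partial i f) x" by (simp add: A_def B_def)
qed

lemma foldr_partial_Cons_commute:
  assumes "smooth f"
  shows "foldr partial (xs @ x # ys) f = partial x (foldr partial (xs @ ys) f)"
  by (induction xs) (use assms in \<open>auto simp: partial_commute smooth_foldr_partial\<close>)

text \<open>
  The derivative of a smooth function for a multi-index depends only on how often each coordinate
  occurs. This frees what follows from the chosen enumeration of the coordinates.
\<close>

lemma foldr_partial_mset:
  assumes "smooth f" "mset xs = mset ys"
  shows "foldr partial xs f = foldr partial ys f"
  using assms(2)
proof (induction xs arbitrary: ys)
  case (Cons x xs)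
  then have "x \<in> set ys" by (metis list.set_intros(1) set_mset_mset)
  then obtain us vs where ys: "ys = us @ x # vs" by (meson split_list)
  with Cons.prems have "mset xs = mset (us @ vs)" by simp
  with Cons.IH have "foldr partial xs f = foldr partial (us @ vs) f" by blast
  then show ?case
    using foldr_partial_Cons_commute[OF assms(1), of us x vs] ys by simp
qed simp

lemma foldr_funpow_conv:
  "foldr (\<lambda>i. partial i ^^ \<nu> i) xs f = foldr partial (concat (map (\<lambda>i. replicate (\<nu> i) i) xs)) f"
proof (induction xs)
  case (Cons x xs)
  have "(partial x ^^ m) g = foldr partial (replicate m x) g" for m g
    by (induction m) auto
  with Cons show ?case by simp
qed simp

lemma coords: "distinct (coords :: 'n::finite list)" "set (coords :: 'n list) = UNIV"
proof -
  have "\<exists>xs. distinct xs \<and> set xs = (UNIV :: 'n set)"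
    using finite_distinct_list[of "UNIV :: 'n set"] by auto
  from someI_ex[OF this] show "distinct (coords :: 'n::finite list)" "set (coords :: 'n list) = UNIV"
    by (auto simp: coords_def)
qed

lemma count_replicates:
  assumes "distinct xs"
  shows "count (mset (concat (map (\<lambda>i. replicate (\<nu> i) i) xs))) j = (if j \<in> set xs then \<nu> j else 0)"
  using assms by (induction xs) (auto)

lemma mi_partial_eq_foldr:
  fixes f :: "real^'n \<Rightarrow> real"
  assumes "smooth f" "\<And>j. count (mset xs) j = \<nu> j"
  shows "mi_partial \<nu> f = foldr partial xs f"
  unfolding mi_partial_def foldr_funpow_conv
proof (rule foldr_partial_mset[OF assms(1)])
  show "mset (concat (map (\<lambda>i. replicate (\<nu> i) i) coords)) = mset xs"
    by (rule multiset_eqI, subst count_replicates) (auto simp: coords assms)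
qed

lemma mi_partial_conv:
  fixes \<nu> :: "'n::finite multi_index"
  obtains xs where "\<And>f. smooth f \<Longrightarrow> mi_partial \<nu> f = foldr partial xs f" "\<And>j. count (mset xs) j = \<nu> j"
proof -
  define xs where "xs = concat (map (\<lambda>i. replicate (\<nu> i) i) coords)"
  have c: "\<And>j. count (mset xs) j = \<nu> j"
    unfolding xs_def by (subst count_replicates) (auto simp: coords)
  show ?thesis by (rule that[of xs]) (use c mi_partial_eq_foldr in auto)
qed

lemma mi_partial_upd:
  fixes f :: "real^'n \<Rightarrow> real"
  assumes "smooth f"
  shows "mi_partial (\<nu>(i := Suc (\<nu> i))) f = partial i (mi_partial \<nu> f)"
    and "mi_partial (\<nu>(i := Suc (\<nu> i))) f = mi_partial \<nu> (partial i f)"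
proof -
  obtain xs where xs: "\<And>f::real^'n \<Rightarrow> real. smooth f \<Longrightarrow> mi_partial \<nu> f = foldr partial xs f"
      "\<And>j. count (mset xs) j = \<nu> j" using mi_partial_conv[of \<nu>] by blast
  have 1: "mi_partial (\<nu>(i := Suc (\<nu> i))) f = foldr partial (i # xs) f"
    by (rule mi_partial_eq_foldr[OF assms]) (auto simp: xs(2))
  have 2: "mi_partial (\<nu>(i := Suc (\<nu> i))) f = foldr partial (xs @ [i]) f"
    by (rule mi_partial_eq_foldr[OF assms]) (auto simp: xs(2))
  show "mi_partial (\<nu>(i := Suc (\<nu> i))) f = partial i (mi_partial \<nu> f)"
    using 1 xs(1)[OF assms] by simp
  show "mi_partial (\<nu>(i := Suc (\<nu> i))) f = mi_partial \<nu> (partial i f)"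
    using 2 xs(1)[OF smooth_partial[OF assms]] by simp
qed

lemma mi_partial_zero: "smooth f \<Longrightarrow> mi_partial (\<lambda>_. 0) f = f"
  using mi_partial_eq_foldr[of f "[]" "\<lambda>_. 0"] by simp

abbreviation unit_index :: "'n \<Rightarrow> 'n::finite multi_index" where
  "unit_index i \<equiv> (\<lambda>_. 0)(i := Suc 0)"

lemma mi_partial_unit: "smooth f \<Longrightarrow> mi_partial (unit_index i) f = partial i f"
  using mi_partial_upd(1)[of f "\<lambda>_. 0" i] mi_partial_zero[of f] by simp

lemma mi_order_zero: "mi_order (\<lambda>_. 0) = 0"
  by (simp add: mi_order_def)

lemma mi_order_eq_0: "mi_order \<nu> = 0 \<Longrightarrow> \<nu> = (\<lambda>_. 0)"
  by (auto simp: mi_order_def)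

lemma mi_order_upd: "mi_order (\<nu>(i := Suc (\<nu> i))) = Suc (mi_order \<nu>)"
  unfolding mi_order_def by (subst (1 2) sum.remove[of _ i]) (auto intro!: sum.cong)

lemma mi_order_unit: "mi_order (unit_index i) = Suc 0"
  using mi_order_upd[of "\<lambda>_. 0" i] by (simp add: mi_order_zero)

lemma mi_order_Suc_obtain:
  assumes "mi_order \<nu> = Suc m"
  obtains \<mu> i where "\<nu> = \<mu>(i := Suc (\<mu> i))" "mi_order \<mu> = m"
proof -
  have "\<exists>i. \<nu> i > 0" using assms by (auto simp: mi_order_def intro: ccontr)
  then obtain i where i: "\<nu> i > 0" ..
  define \<mu> where "\<mu> = \<nu>(i := \<nu> i - 1)"
  have *: "\<nu> = \<mu>(i := Suc (\<mu> i))" using i by (auto simp: \<mu>_def)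
  moreover have "mi_order \<mu> = m" using assms * mi_order_upd[of \<mu> i] by simp
  ultimately show ?thesis by (rule that)
qed

lemma finite_mi_order_le: "finite {\<nu> :: 'n::finite multi_index. mi_order \<nu> \<le> k}"
proof (rule finite_subset)
  show "{\<nu> :: 'n multi_index. mi_order \<nu> \<le> k} \<subseteq> PiE UNIV (\<lambda>_. {..k})"
  proof (auto simp: mi_order_def)
    fix \<nu> :: "'n \<Rightarrow> nat" and i assume "sum \<nu> UNIV \<le> k"
    moreover have "\<nu> i \<le> sum \<nu> UNIV" by (rule member_le_sum) auto
    ultimately show "\<nu> i \<le> k" by simp
  qed
qed (auto intro: finite_PiE)

lemma test_smooth: "test_function \<phi> \<Longrightarrow> smooth \<phi>"
  by (simp add: test_function_def)

lemma test_continuous: "test_function \<phi> \<Longrightarrow> continuous_on UNIV \<phi>"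
  by (simp add: test_function_def smooth_continuous)

lemma test_measurable: "test_function \<phi> \<Longrightarrow> \<phi> \<in> borel_measurable borel"
  by (simp add: borel_measurable_continuous_onI test_continuous)

lemma test_partial:
  assumes "test_function \<phi>"
  shows "test_function (partial i \<phi>)"
proof -
  let ?K = "closure {x. \<phi> x \<noteq> 0}"
  have K: "compact ?K" and s: "smooth \<phi>" using assms by (auto simp: test_function_def)
  have "{x. partial i \<phi> x \<noteq> 0} \<subseteq> ?K"
  proof (rule ccontr)
    assume "\<not> ?thesis"
    then obtain x where x: "partial i \<phi> x \<noteq> 0" "x \<notin> ?K" by blast
    have "((\<lambda>_. 0) has_derivative (\<lambda>_. 0)) (at x)" by simp
    moreover have "open (- ?K)" "x \<in> - ?K" using x by auto
    moreover have "\<And>y. y \<in> - ?K \<Longrightarrow> 0 = \<phi> y" using closure_subset[of "{x. \<phi> x \<noteq> 0}"] by auto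
    ultimately have "(\<phi> has_derivative (\<lambda>_. 0)) (at x)"
      by (rule has_derivative_transform_within_open)
    from partial_eqI[OF this] x show False by simp
  qed
  then have "closure {x. partial i \<phi> x \<noteq> 0} \<subseteq> ?K"
    by (simp add: closure_minimal)
  with K have "compact (closure {x. partial i \<phi> x \<noteq> 0})"
    by (metis closed_closure compact_Int_closed inf.absorb_iff2)
  then show ?thesis using smooth_partial[OF s] by (simp add: test_function_def)
qed

lemma test_foldr_partial: "test_function \<phi> \<Longrightarrow> test_function (foldr partial is \<phi>)"
  by (induction "is") (auto intro: test_partial)

lemma test_mi_partial:
  fixes \<phi> :: "real^'n \<Rightarrow> real"
  assumes \<phi>: "test_function \<phi>"
  shows "test_function (mi_partial \<nu> \<phi>)"
proof -
  obtain xs where "\<And>f::real^'n \<Rightarrow> real. smooth f \<Longrightarrow> mi_partial \<nu> f = foldr partial xs f"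
      "\<And>j. count (mset xs) j = \<nu> j" using mi_partial_conv[of \<nu>] by blast
  then show ?thesis using \<phi> by (simp add: test_foldr_partial test_smooth)
qed

lemma test_translate:
  assumes "test_function \<phi>"
  shows "test_function (\<lambda>x. \<phi> (x + c))"
proof -
  have "{x. \<phi> (x + c) \<noteq> 0} = (\<lambda>x. - c + x) ` {x. \<phi> x \<noteq> 0}"
    by (auto simp: image_iff) (metis add.commute add_uminus_conv_diff diff_add_cancel)
  then have "closure {x. \<phi> (x + c) \<noteq> 0} = (\<lambda>x. - c + x) ` closure {x. \<phi> x \<noteq> 0}"
    by (simp only: closure_translation)
  moreover have "compact ((\<lambda>x. - c + x) ` closure {x. \<phi> x \<noteq> 0})"
    by (rule compact_translation) (use assms in \<open>simp only: test_function_def\<close>)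
  ultimately show ?thesis
    using assms smooth_translate(1)[of \<phi> c] unfolding test_function_def by metis
qed

lemma test_bounded:
  fixes \<phi> :: "real^'n \<Rightarrow> real"
  assumes "test_function \<phi>"
  obtains B R where "B > 0" "R > 0" "\<And>x. \<bar>\<phi> x\<bar> \<le> B" "\<And>x. R < norm x \<Longrightarrow> \<phi> x = 0"
proof -
  let ?K = "closure {x. \<phi> x \<noteq> 0}"
  have K: "compact ?K" using assms by (simp only: test_function_def)
  have c: "continuous_on ?K \<phi>"
    by (rule continuous_on_subset[OF test_continuous[OF assms]]) simp
  have "bounded ?K" by (rule compact_imp_bounded[OF K])
  then obtain R where R: "\<And>x. x \<in> ?K \<Longrightarrow> norm x \<le> R" unfolding bounded_iff by blast
  have "bounded (\<phi> ` ?K)" by (rule compact_imp_bounded[OF compact_continuous_image[OF c K]])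
  then obtain B where B: "\<And>x. x \<in> ?K \<Longrightarrow> \<bar>\<phi> x\<bar> \<le> B"
    unfolding bounded_iff by (metis image_eqI real_norm_def)
  have z: "\<phi> x = 0" if "x \<notin> ?K" for x using that closure_subset[of "{x. \<phi> x \<noteq> 0}"] by auto
  show ?thesis
  proof (rule that[of "max B 1" "max R 1"])
    show "\<bar>\<phi> x\<bar> \<le> max B 1" for x
    proof (cases "x \<in> ?K")
      case True
      from B[OF this] show ?thesis by linarith
    next
      case False
      from z[OF this] show ?thesis by simp
    qed
    show "\<phi> x = 0" if "max R 1 < norm x" for x
    proof (rule z)
      show "x \<notin> ?K" using R[of x] \<open>max R 1 < norm x\<close> by linarith
    qed
  qed auto
qed

text \<open>
  These functions are closed under differentiation up to linear combinations, so the smoothness of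
  \<open>exp (- 1 / t)\<close>, extended by zero, needs no formula for its higher derivatives.
\<close>

definition flat :: "nat \<Rightarrow> real \<Rightarrow> real" where
  "flat k t = (if t > 0 then (1 / t) ^ k * exp (- (1 / t)) else 0)"

lemma flat_over_tendsto: "((\<lambda>t. flat k t / t) \<longlongrightarrow> 0) (at 0)"
proof (rule filterlim_split_at)
  have "((\<lambda>x::real. x ^ Suc k / exp x) \<longlongrightarrow> 0) at_top" by (rule tendsto_power_div_exp_0)
  then have "((\<lambda>t::real. (inverse t) ^ Suc k / exp (inverse t)) \<longlongrightarrow> 0) (at_right 0)"
    using filterlim_inverse_at_top_right by (rule filterlim_compose)
  then show "((\<lambda>t. flat k t / t) \<longlongrightarrow> 0) (at_right 0)"
    by (rule Lim_transform_eventually)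
       (auto simp: eventually_at_right_field flat_def exp_minus field_simps intro!: exI[of _ 1])
  show "((\<lambda>t. flat k t / t) \<longlongrightarrow> 0) (at_left 0)"
    by (rule Lim_transform_eventually[OF tendsto_const])
       (auto simp: eventually_at_left_field flat_def intro!: exI[of _ "-1"])
qed

lemma flat_derivative:
  "(flat k has_real_derivative flat (k + 2) t - real k * flat (k + 1) t) (at t)"
proof -
  consider "t > 0" | "t < 0" | "t = 0" by linarith
  then show ?thesis
  proof cases
    case 1
    have "((\<lambda>t. (1 / t) ^ k * exp (- (1 / t))) has_real_derivative
        (real k * (1 / t) ^ (k - 1) * (- 1 / t\<^sup>2) * exp (- (1 / t)) + (1 / t) ^ k * (exp (- (1 / t)) * (1 / t\<^sup>2)))) (at t)"
      using 1 by (auto intro!: derivative_eq_intros simp: power2_eq_square)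
    moreover have "real k * (1 / t) ^ (k - 1) * (- 1 / t\<^sup>2) * exp (- (1 / t)) + (1 / t) ^ k * (exp (- (1 / t)) * (1 / t\<^sup>2))
       = flat (k + 2) t - real k * flat (k + 1) t"
    proof (cases k)
      case 0 then show ?thesis using 1 by (simp add: flat_def power2_eq_square)
    next
      case (Suc m) then show ?thesis using 1 by (simp add: flat_def power2_eq_square field_simps)
    qed
    ultimately have *: "((\<lambda>t. (1 / t) ^ k * exp (- (1 / t))) has_real_derivative flat (k + 2) t - real k * flat (k + 1) t) (at t)"
      by simp
    show ?thesis
      by (rule has_field_derivative_transform_within_open[OF *, of "{0<..}"]) (use 1 in \<open>auto simp: flat_def\<close>)
  next
    case 2
    have *: "((\<lambda>t. 0) has_real_derivative flat (k + 2) t - real k * flat (k + 1) t) (at t)"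
      using 2 by (simp add: flat_def)
    show ?thesis
      by (rule has_field_derivative_transform_within_open[OF *, of "{..<0}"]) (use 2 in \<open>auto simp: flat_def\<close>)
  next
    case 3
    then show ?thesis
      using flat_over_tendsto[of k] by (simp add: has_field_derivative_iff flat_def)
  qed
qed

text \<open>
  The products of cut-offs in the single coordinates lie in this algebra, and it is stable under
  partial derivatives.
\<close>

inductive flat_alg :: "(real^'n::finite \<Rightarrow> real) \<Rightarrow> bool" where
  const: "flat_alg (\<lambda>_. c)"
| gen: "flat_alg (\<lambda>x. flat k (c * x $ i + d))"
| add: "flat_alg f \<Longrightarrow> flat_alg g \<Longrightarrow> flat_alg (\<lambda>x. f x + g x)"
| mult: "flat_alg f \<Longrightarrow> flat_alg g \<Longrightarrow> flat_alg (\<lambda>x. f x * g x)"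

lemma flat_alg_derivative:
  fixes f :: "real^'n::finite \<Rightarrow> real"
  assumes "flat_alg f"
  shows "\<exists>f'. (\<forall>x. (f has_derivative f' x) (at x)) \<and> (\<forall>h. flat_alg (\<lambda>x. f' x h))"
  using assms
proof induction
  case (const c)
  show ?case by (intro exI[of _ "\<lambda>_ _. 0"]) (auto intro: flat_alg.const)
next
  case (gen k c i d)
  let ?g = "\<lambda>x :: real^'n. flat (k + 2) (c * x $ i + d) + (- real k) * flat (k + 1) (c * x $ i + d)"
  show ?case
  proof (intro exI[of _ "\<lambda>x h. ?g x * (c * h $ i)"] conjI allI)
    fix x :: "real^'n"
    have 1: "((\<lambda>x. c * x $ i + d) has_derivative (\<lambda>h. c * h $ i)) (at x)"
      by (auto intro!: derivative_eq_intros bounded_linear.has_derivative[OF bounded_linear_vec_nth])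
    have 2: "(flat k has_derivative (*) (?g x)) (at (c * x $ i + d))"
      using flat_derivative[of k "c * x $ i + d"] by (simp add: has_field_derivative_def)
    show "((\<lambda>x. flat k (c * x $ i + d)) has_derivative (\<lambda>h. ?g x * (c * h $ i))) (at x)"
      using has_derivative_compose[OF 1 2] .
  next
    fix h :: "real^'n"
    show "flat_alg (\<lambda>x. ?g x * (c * h $ i))" by (intro flat_alg.intros)
  qed
next
  case (add f g)
  then obtain f' g' where "\<forall>x. (f has_derivative f' x) (at x)" "\<forall>h. flat_alg (\<lambda>x. f' x h)"
     "\<forall>x. (g has_derivative g' x) (at x)" "\<forall>h. flat_alg (\<lambda>x. g' x h)" by blast
  then show ?case
    by (intro exI[of _ "\<lambda>x h. f' x h + g' x h"]) (auto intro: has_derivative_add flat_alg.add)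
next
  case (mult f g)
  then obtain f' g' where "\<forall>x. (f has_derivative f' x) (at x)" "\<forall>h. flat_alg (\<lambda>x. f' x h)"
     "\<forall>x. (g has_derivative g' x) (at x)" "\<forall>h. flat_alg (\<lambda>x. g' x h)" by blast
  note fg = this
  show ?case
  proof (intro exI[of _ "\<lambda>x h. f x * g' x h + f' x h * g x"] conjI allI)
    show "((\<lambda>x. f x * g x) has_derivative (\<lambda>h. f x * g' x h + f' x h * g x)) (at x)" for x
      using fg by (intro has_derivative_mult) auto
    show "flat_alg (\<lambda>x. f x * g' x h + f' x h * g x)" for h
      by (rule flat_alg.add; rule flat_alg.mult) (use fg mult in auto)
  qed
qed

lemma flat_alg_smooth:
  assumes "flat_alg f"
  shows "smooth f"
proof (rule smooth_coinduct[where S = flat_alg])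
  fix f :: "real^'n \<Rightarrow> real" assume "flat_alg f"
  then obtain f' where f': "\<forall>x. (f has_derivative f' x) (at x)" "\<forall>h. flat_alg (\<lambda>x. f' x h)"
    using flat_alg_derivative by blast
  show "f differentiable at x" for x using f' by (auto simp: differentiable_def)
  have "partial i f = (\<lambda>x. f' x (axis i 1))" for i using f'(1) partial_eqI by blast
  then show "flat_alg (partial i f)" for i using f'(2) by simp
qed fact

lemma flat_alg_prod:
  assumes "finite S" "\<And>i. i \<in> S \<Longrightarrow> flat_alg (f i)"
  shows "flat_alg (\<lambda>x. \<Prod>i\<in>S. f i x)"
  using assms by (induction rule: finite_induct) (auto intro: flat_alg.intros)

text \<open>
  Each factor \<open>exp (- 1 / (m c))\<close> with \<open>c > 0\<close> tends to one as \<open>m\<close> grows, so these test functions approximate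
  the indicator of a box pointwise.
\<close>

definition box_bump :: "real^'n \<Rightarrow> real^'n \<Rightarrow> nat \<Rightarrow> real^'n::finite \<Rightarrow> real" where
  "box_bump a b m x = (\<Prod>i\<in>UNIV. flat 0 (real (Suc m) * (x $ i - a $ i)) * flat 0 (real (Suc m) * (b $ i - x $ i)))"

lemma flat_0_bounds: "0 \<le> flat 0 t" "flat 0 t \<le> 1"
  by (auto simp: flat_def)

lemma box_bump_bounds: "0 \<le> box_bump a b m x" "box_bump a b m x \<le> 1"
  unfolding box_bump_def
  by (auto intro!: prod_nonneg prod_le_1 mult_nonneg_nonneg mult_le_one flat_0_bounds)

lemma box_bump_outside: "x \<notin> box a b \<Longrightarrow> box_bump a b m x = 0"
  by (force simp: box_bump_def mem_box_cart flat_def zero_less_mult_iff)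

lemma test_box_bump: "test_function (box_bump a b m)"
proof -
  have eq: "box_bump a b m = (\<lambda>x. \<Prod>i\<in>UNIV. flat 0 (real (Suc m) * x $ i + (- real (Suc m) * a $ i))
      * flat 0 ((- real (Suc m)) * x $ i + real (Suc m) * b $ i))"
    by (rule ext) (simp add: box_bump_def algebra_simps)
  have "smooth (box_bump a b m)"
    unfolding eq by (intro flat_alg_smooth flat_alg_prod flat_alg.mult flat_alg.gen) auto
  moreover have "closure {x. box_bump a b m x \<noteq> 0} \<subseteq> cbox a b"
    by (rule closure_minimal) (use box_bump_outside box_subset_cbox in \<open>auto, blast\<close>)
  then have "compact (closure {x. box_bump a b m x \<noteq> 0})"
    by (metis closed_closure compact_Int_closed compact_cbox inf.absorb_iff2)
  ultimately show ?thesis by (simp add: test_function_def)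
qed

lemma box_bump_tendsto: "(\<lambda>m. box_bump a b m x) \<longlonglongrightarrow> indicator (box a b) x"
proof (cases "x \<in> box a b")
  case True
  have *: "(\<lambda>m. flat 0 (real (Suc m) * c)) \<longlonglongrightarrow> 1" if "c > 0" for c :: real
  proof -
    have "(\<lambda>m. exp (- ((1/c) * inverse (real (Suc m))))) \<longlonglongrightarrow> exp (- ((1/c) * 0))"
      by (intro tendsto_intros LIMSEQ_inverse_real_of_nat)
    moreover have "flat 0 (real (Suc m) * c) = exp (- ((1/c) * inverse (real (Suc m))))" for m
      using that by (simp add: flat_def divide_inverse mult.commute)
    ultimately show ?thesis by simp
  qed
  have "(\<lambda>m. box_bump a b m x) \<longlonglongrightarrow> (\<Prod>i\<in>(UNIV::'a set). 1 * 1)"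
    unfolding box_bump_def by (intro tendsto_prod tendsto_mult *) (use True in \<open>auto simp: mem_box_cart\<close>)
  then show ?thesis using True by simp
qed (simp add: box_bump_outside)

section \<open>Locally integrable functions and Borel representatives\<close>

text \<open>
  The counterpart of \<open>locally_integrable\<close> for Borel functions. Fubini's theorem is applied on product
  spaces of \<open>lborel\<close>, where functions that are only Lebesgue measurable need not be measurable after
  the substitutions that occur.
\<close>

definition loc_int :: "(real^'n::finite \<Rightarrow> 'b::euclidean_space) \<Rightarrow> bool" where
  "loc_int g \<longleftrightarrow> g \<in> borel_measurable borel \<and>
     (\<forall>R. integrable lborel (\<lambda>x. indicator (cball 0 R) x *\<^sub>R g x))"

lemma loc_int_measurable: "loc_int g \<Longrightarrow> g \<in> borel_measurable borel"
  by (simp add: loc_int_def)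

lemma loc_int_integrable: "loc_int g \<Longrightarrow> integrable lborel (\<lambda>x. indicator (cball 0 R) x *\<^sub>R g x)"
  by (simp add: loc_int_def)

lemma loc_int_finite:
  assumes "loc_int g"
  shows "(\<integral>\<^sup>+x. indicator (cball 0 R) x * ennreal (norm (g x)) \<partial>lborel) < \<infinity>"
proof -
  have "(\<integral>\<^sup>+x. ennreal (norm (indicator (cball 0 R) x *\<^sub>R g x)) \<partial>lborel) < \<infinity>"
    using loc_int_integrable[OF assms, of R] by (simp only: integrable_iff_bounded)
  moreover have "ennreal (norm (indicator (cball 0 R) x *\<^sub>R g x)) = indicator (cball 0 R) x * ennreal (norm (g x))" for x
    by (auto simp: indicator_def)
  ultimately show ?thesis by simp
qed

lemma loc_intI:
  fixes g :: "real^'n::finite \<Rightarrow> 'b::euclidean_space"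
  assumes "g \<in> borel_measurable borel"
    and "\<And>R. (\<integral>\<^sup>+x. indicator (cball 0 R) x * ennreal (norm (g x)) \<partial>lborel) < \<infinity>"
  shows "loc_int g"
  unfolding loc_int_def
proof (intro conjI allI integrableI_bounded)
  fix R
  have "ennreal (norm (indicator (cball 0 R) x *\<^sub>R g x)) = indicator (cball 0 R) x * ennreal (norm (g x))" for x
    by (auto simp: indicator_def)
  then show "(\<integral>\<^sup>+x. ennreal (norm (indicator (cball 0 R) x *\<^sub>R g x)) \<partial>lborel) < \<infinity>"
    using assms(2)[of R] by simp
  have [measurable]: "g \<in> borel_measurable borel" "cball (0::real^'n) R \<in> sets borel"
    using assms(1) by auto
  show "(\<lambda>x. indicator (cball 0 R) x *\<^sub>R g x) \<in> borel_measurable lborel"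
    by measurable
qed (use assms in auto)

lemma loc_int_add: "loc_int f \<Longrightarrow> loc_int g \<Longrightarrow> loc_int (\<lambda>x. f x + g x)"
  by (auto simp: loc_int_def scaleR_add_right)

lemma loc_int_diff: "loc_int f \<Longrightarrow> loc_int g \<Longrightarrow> loc_int (\<lambda>x. f x - g x)"
  by (auto simp: loc_int_def scaleR_diff_right)

lemma loc_int_scaleR: "loc_int f \<Longrightarrow> loc_int (\<lambda>x. c *\<^sub>R f x)"
  by (auto simp: loc_int_def scaleR_left_commute simp del: scaleR_scaleR)

lemma loc_int_sum: "finite S \<Longrightarrow> (\<And>i. i \<in> S \<Longrightarrow> loc_int (f i)) \<Longrightarrow> loc_int (\<lambda>x. \<Sum>i\<in>S. f i x)"
proof (induction rule: finite_induct)
  case empty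
  show ?case by (simp add: loc_int_def)
next
  case (insert i S)
  then show ?case by (simp add: loc_int_add)
qed

lemma integrable_bounded_times:
  fixes \<phi> :: "real^'n::finite \<Rightarrow> real"
  assumes g: "loc_int g" and \<phi>[measurable]: "\<phi> \<in> borel_measurable borel"
    and B: "\<And>x. \<bar>\<phi> x\<bar> \<le> B" and R: "\<And>x. R < norm x \<Longrightarrow> \<phi> x = 0"
  shows "integrable lborel (\<lambda>x. \<phi> x *\<^sub>R g x)"
proof (rule Bochner_Integration.integrable_bound)
  show "integrable lborel (\<lambda>x. B *\<^sub>R (indicator (cball 0 R) x *\<^sub>R g x))"
    using loc_int_integrable[OF g] by (rule integrable_scaleR_right)
  have [measurable]: "g \<in> borel_measurable borel" using g by (rule loc_int_measurable)
  show "(\<lambda>x. \<phi> x *\<^sub>R g x) \<in> borel_measurable lborel" by measurable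
  have "norm (\<phi> x *\<^sub>R g x) \<le> norm (B *\<^sub>R (indicator (cball 0 R) x *\<^sub>R g x))" for x
  proof (cases "R < norm x")
    case False
    have "\<bar>\<phi> x\<bar> * norm (g x) \<le> \<bar>B\<bar> * norm (g x)"
      using B[of x] by (intro mult_right_mono) auto
    then show ?thesis using False by (simp add: indicator_def)
  qed (simp add: R)
  then show "AE x in lborel. norm (\<phi> x *\<^sub>R g x) \<le> norm (B *\<^sub>R (indicator (cball 0 R) x *\<^sub>R g x))" by simp
qed

lemma integrable_test_times:
  assumes "loc_int g" "test_function \<phi>"
  shows "integrable lborel (\<lambda>x. \<phi> x *\<^sub>R g x)"
  using integrable_bounded_times[OF assms(1) test_measurable[OF assms(2)]] test_bounded[OF assms(2)]
  by metis

lemma borel_representative: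
  fixes f :: "real^'n::finite \<Rightarrow> 'b::euclidean_space"
  assumes f: "f \<in> borel_measurable lebesgue"
  obtains g where "g \<in> borel_measurable borel" "AE x in lborel. f x = g x"
proof -
  have "\<exists>g\<in>borel_measurable lborel. AE x in lborel. f x \<bullet> b = g x" for b
    by (rule completion_ex_borel_measurable_real) (use f in measurable)
  then obtain g where g: "\<And>b. g b \<in> borel_measurable lborel" "\<And>b. AE x in lborel. f x \<bullet> b = g b x"
    by metis
  define h where "h = (\<lambda>x. \<Sum>b\<in>Basis. g b x *\<^sub>R (b::'b))"
  have "AE x in lborel. \<forall>b\<in>Basis. f x \<bullet> b = g b x"
    using g(2) by (intro AE_finite_allI) auto
  then have "AE x in lborel. f x = h x"
  proof eventually_elim
    case (elim x)
    have "f x = (\<Sum>b\<in>Basis. (f x \<bullet> b) *\<^sub>R b)" by (simp add: euclidean_representation)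
    also have "\<dots> = h x" unfolding h_def using elim by (intro sum.cong) auto
    finally show ?case .
  qed
  moreover have "h \<in> borel_measurable borel"
    using g(1) unfolding h_def by measurable
  ultimately show ?thesis by (intro that)
qed

lemma measurable_lebesgue_AE:
  fixes f g :: "real^'n::finite \<Rightarrow> 'b::euclidean_space"
  assumes "f \<in> borel_measurable lebesgue" "AE x in lborel. f x = g x"
  shows "g \<in> borel_measurable lebesgue"
  using borel_measurable_AE[OF assms(1)] assms(2) AE_completion by blast

lemma measurable_borel_lebesgue: "f \<in> borel_measurable borel \<Longrightarrow> f \<in> borel_measurable lebesgue"
  by (simp add: measurable_completion)

lemma lebesgue_integral_AE:
  fixes f g :: "real^'n::finite \<Rightarrow> 'b::euclidean_space"
  assumes "g \<in> borel_measurable borel" "AE x in lborel. f x = g x"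
  shows "integral\<^sup>L lebesgue f = integral\<^sup>L lborel g" "integrable lebesgue f \<longleftrightarrow> integrable lborel g"
proof -
  have ae: "AE x in lebesgue. f x = g x" using assms(2) by (rule AE_completion)
  have g: "g \<in> borel_measurable lebesgue" by (rule measurable_borel_lebesgue[OF assms(1)])
  have f: "f \<in> borel_measurable lebesgue"
    by (rule measurable_lebesgue_AE[OF g]) (use assms(2) in auto)
  show "integral\<^sup>L lebesgue f = integral\<^sup>L lborel g"
    using integral_cong_AE[OF f g ae] integral_completion[of g lborel] assms(1) by simp
  show "integrable lebesgue f \<longleftrightarrow> integrable lborel g"
    using integrable_cong_AE[OF f g ae] integrable_completion[of g lborel] assms(1) by simp
qed

lemma locally_integrable_iff:
  fixes f :: "real^'n::finite \<Rightarrow> 'b::{real_normed_field,euclidean_space}"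
  assumes g: "g \<in> borel_measurable borel" and ae: "AE x in lborel. f x = g x"
  shows "locally_integrable f \<longleftrightarrow> loc_int g"
proof -
  have eq: "set_integrable lebesgue K f \<longleftrightarrow> integrable lborel (\<lambda>x. indicator K x *\<^sub>R g x)" if "compact K" for K
    unfolding set_integrable_def
  proof (rule lebesgue_integral_AE(2))
    have [measurable]: "K \<in> sets borel" using that by (rule borel_compact)
    show "(\<lambda>x. indicator K x *\<^sub>R g x) \<in> borel_measurable borel" using g by measurable
    show "AE x in lborel. indicator K x *\<^sub>R f x = indicator K x *\<^sub>R g x" using ae by eventually_elim simp
  qed
  show ?thesis
  proof
    assume "locally_integrable f"
    then show "loc_int g" using eq[OF compact_cball] g by (auto simp: locally_integrable_def loc_int_def)
  next
    assume l: "loc_int g"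
    show "locally_integrable f" unfolding locally_integrable_def
    proof (intro allI impI)
      fix K :: "(real^'n) set" assume K: "compact K"
      then obtain R where R: "\<And>x. x \<in> K \<Longrightarrow> norm x \<le> R" using compact_imp_bounded bounded_iff by metis
      have [measurable]: "K \<in> sets borel" using K by (rule borel_compact)
      have "integrable lborel (\<lambda>x. indicator K x *\<^sub>R g x)"
        by (rule integrable_bounded_times[OF l, where B = 1 and R = R])
           (use R in \<open>auto simp: indicator_def dest: leD\<close>)
      then show "set_integrable lebesgue K f" using eq[OF K] by simp
    qed
  qed
qed

lemma locally_integrable_measurable:
  fixes f :: "real^'n::finite \<Rightarrow> 'b::{real_normed_field,euclidean_space}"
  assumes "locally_integrable f"
  shows "f \<in> borel_measurable lebesgue"
proof (rule borel_measurable_LIMSEQ_metric)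
  show "(\<lambda>x. indicator (cball 0 (real k)) x *\<^sub>R f x) \<in> borel_measurable lebesgue" for k
    using assms compact_cball unfolding locally_integrable_def set_integrable_def
    by (blast intro: borel_measurable_integrable)
  fix x :: "real^'n"
  obtain k0 :: nat where "norm x \<le> real k0" using real_arch_simple by blast
  then have "\<forall>\<^sub>F k in sequentially. indicator (cball 0 (real k)) x *\<^sub>R f x = f x"
    by (intro eventually_sequentiallyI[of k0]) (auto simp: indicator_def)
  then show "(\<lambda>k. indicator (cball 0 (real k)) x *\<^sub>R f x) \<longlonglongrightarrow> f x"
    by (rule tendsto_eventually)
qed

lemma locally_integrable_representative:
  fixes f :: "real^'n::finite \<Rightarrow> 'b::{real_normed_field,euclidean_space}"
  assumes "locally_integrable f"
  obtains g where "loc_int g" "AE x in lborel. f x = g x"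
proof -
  obtain g where g: "g \<in> borel_measurable borel" "AE x in lborel. f x = g x"
    using borel_representative[OF locally_integrable_measurable[OF assms]] by blast
  with assms locally_integrable_iff that show ?thesis by blast
qed

section \<open>The fundamental lemma of the calculus of variations\<close>

lemma integral_box_zero:
  fixes g :: "real^'n::finite \<Rightarrow> real"
  assumes g: "loc_int g"
    and zero: "\<And>\<phi>. test_function \<phi> \<Longrightarrow> (LINT x|lborel. \<phi> x *\<^sub>R g x) = 0"
  shows "(LINT x|lborel. indicator (box a b) x *\<^sub>R g x) = 0"
proof -
  have gm[measurable]: "g \<in> borel_measurable borel" by (rule loc_int_measurable[OF g])
  have tm[measurable]: "box_bump a b m \<in> borel_measurable borel" for m by (rule test_measurable[OF test_box_bump])
  have "(\<lambda>m. LINT x|lborel. box_bump a b m x *\<^sub>R g x) \<longlonglongrightarrow> (LINT x|lborel. indicator (box a b) x *\<^sub>R g x)"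
  proof (rule integral_dominated_convergence)
    obtain R where R: "\<And>x. x \<in> box a b \<Longrightarrow> norm x \<le> R" using bounded_box bounded_iff by metis
    show "integrable lborel (\<lambda>x. norm (indicator (box a b) x *\<^sub>R g x))"
      by (rule integrable_norm, rule integrable_bounded_times[OF g, where B = 1 and R = R])
         (use R in \<open>auto simp: indicator_def dest: leD\<close>)
    show "AE x in lborel. (\<lambda>m. box_bump a b m x *\<^sub>R g x) \<longlonglongrightarrow> indicator (box a b) x *\<^sub>R g x"
      by (intro AE_I2 tendsto_intros box_bump_tendsto)
    have "\<bar>box_bump a b m x * g x\<bar> \<le> \<bar>indicator (box a b) x * g x\<bar>" for m x
    proof (cases "x \<in> box a b")
      case True
      then show ?thesis using box_bump_bounds[of a b m x] by (simp add: abs_mult mult_left_le_one_le)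
    qed (simp add: box_bump_outside)
    then show "AE x in lborel. norm (box_bump a b m x *\<^sub>R g x) \<le> norm (indicator (box a b) x *\<^sub>R g x)" for m
      by simp
  qed measurable
  then show ?thesis using zero[OF test_box_bump] by (simp add: LIMSEQ_const_iff)
qed

text \<open>
  The Borel sets on which the integral vanishes form a Dynkin system, and boxes form a generator
  that is stable under intersection.
\<close>

lemma integral_Int_box_zero:
  fixes g :: "real^'n::finite \<Rightarrow> real"
  assumes g: "loc_int g"
    and zero: "\<And>a b. (LINT x|lborel. indicator (box a b) x *\<^sub>R g x) = 0"
    and A: "A \<in> sets borel"
  shows "(LINT x|lborel. indicator (A \<inter> box a b) x *\<^sub>R g x) = 0"
proof -
  have gm[measurable]: "g \<in> borel_measurable borel" by (rule loc_int_measurable[OF g])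
  obtain R where R: "\<And>x. x \<in> box a b \<Longrightarrow> norm x \<le> R" using bounded_box bounded_iff by metis
  have int: "integrable lborel (\<lambda>x. indicator (A \<inter> box a b) x *\<^sub>R g x)" if [measurable]: "A \<in> sets borel" for A
    by (rule integrable_bounded_times[OF g, where B = 1 and R = R])
       (use R in \<open>auto simp: indicator_def dest: leD\<close>)
  have "Int_stable (range (\<lambda>(a, b). box a b :: (real^'n) set))"
    by (auto simp: Int_stable_def box_Int_box)
  moreover have "(range (\<lambda>(a, b). box a b :: (real^'n) set)) \<subseteq> Pow UNIV" by auto
  moreover have "A \<in> sigma_sets UNIV (range (\<lambda>(a, b). box a b))"
    using A unfolding borel_eq_box by simp
  ultimately show ?thesis
  proof (induction rule: sigma_sets_induct_disjoint)
    case (basic A) then show ?case using zero by (auto simp: box_Int_box)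
  next
    case empty then show ?case by simp
  next
    case (compl A)
    then have [measurable]: "A \<in> sets borel" by (simp add: borel_eq_box)
    have "(LINT x|lborel. indicator ((UNIV - A) \<inter> box a b) x *\<^sub>R g x)
       = (LINT x|lborel. indicator (UNIV \<inter> box a b) x *\<^sub>R g x - indicator (A \<inter> box a b) x *\<^sub>R g x)"
      by (intro Bochner_Integration.integral_cong) (auto simp: indicator_def)
    also have "\<dots> = 0"
      using int[of UNIV] int[of A] zero compl by (subst Bochner_Integration.integral_diff) auto
    finally show ?case .
  next
    case (union F)
    then have [measurable]: "\<And>i. F i \<in> sets borel" by (simp add: borel_eq_box subset_eq)
    have "(\<lambda>k. LINT x|lborel. (\<Sum>i<k. indicator (F i \<inter> box a b) x *\<^sub>R g x))
       \<longlonglongrightarrow> (LINT x|lborel. indicator (\<Union>(F ` UNIV) \<inter> box a b) x *\<^sub>R g x)"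
    proof (rule integral_dominated_convergence)
      show "integrable lborel (\<lambda>x. norm (indicator (UNIV \<inter> box a b) x *\<^sub>R g x))"
        by (rule integrable_norm, rule int) auto
      have *: "(\<Sum>i<k. indicator (F i \<inter> box a b) x :: real) = indicator ((\<Union>i<k. F i) \<inter> box a b) x" for k x
      proof -
        have "disjoint_family_on (\<lambda>i. F i \<inter> box a b) {..<k}"
          using union(1) by (auto simp: disjoint_family_on_def)
        then have "(\<Sum>i<k. indicator (F i \<inter> box a b) x :: real) = indicator (\<Union>i<k. F i \<inter> box a b) x"
          by (intro indicator_UN_disjoint[symmetric]) auto
        moreover have "(\<Union>i<k. F i \<inter> box a b) = (\<Union>i<k. F i) \<inter> box a b" by auto
        ultimately show ?thesis by simp
      qed
      have **: "(\<Sum>i<k. indicator (F i \<inter> box a b) x *\<^sub>R g x) = indicator ((\<Union>i<k. F i) \<inter> box a b) x *\<^sub>R g x" for k x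
        unfolding * [symmetric] by (simp add: sum_distrib_right)
      show "AE x in lborel. (\<lambda>k. \<Sum>i<k. indicator (F i \<inter> box a b) x *\<^sub>R g x)
          \<longlonglongrightarrow> indicator (\<Union>(F ` UNIV) \<inter> box a b) x *\<^sub>R g x"
      proof (intro AE_I2)
        fix x
        have "\<exists>k0. \<forall>k\<ge>k0. indicator ((\<Union>i<k. F i) \<inter> box a b) x *\<^sub>R g x = indicator (\<Union>(F ` UNIV) \<inter> box a b) x *\<^sub>R g x"
        proof (cases "\<exists>i. x \<in> F i")
          case True
          then obtain i where "x \<in> F i" ..
          then show ?thesis by (intro exI[of _ "Suc i"]) (auto simp: indicator_def)
        qed (auto simp: indicator_def)
        then show "(\<lambda>k. \<Sum>i<k. indicator (F i \<inter> box a b) x *\<^sub>R g x)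
          \<longlonglongrightarrow> indicator (\<Union>(F ` UNIV) \<inter> box a b) x *\<^sub>R g x"
          unfolding ** by (intro tendsto_eventually) (auto simp: eventually_sequentially)
      qed
      show "AE x in lborel. norm (\<Sum>i<k. indicator (F i \<inter> box a b) x *\<^sub>R g x)
             \<le> norm (indicator (UNIV \<inter> box a b) x *\<^sub>R g x)" for k
        unfolding ** by (intro AE_I2) (auto simp: indicator_def)
    qed measurable
    moreover have "(LINT x|lborel. (\<Sum>i<k. indicator (F i \<inter> box a b) x *\<^sub>R g x)) = 0" for k
      using union int by (subst Bochner_Integration.integral_sum) auto
    ultimately show ?case by (simp add: LIMSEQ_const_iff)
  qed
qed

lemma AE_nonpos_if_test_integrals_zero:
  fixes g :: "real^'n::finite \<Rightarrow> real"
  assumes g: "loc_int g"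
    and zero: "\<And>\<phi>. test_function \<phi> \<Longrightarrow> (LINT x|lborel. \<phi> x *\<^sub>R g x) = 0"
  shows "AE x in lborel. g x \<le> 0"
proof -
  have gm[measurable]: "g \<in> borel_measurable borel" by (rule loc_int_measurable[OF g])
  have "AE x in lborel. x \<in> box a b \<longrightarrow> g x \<le> 0" for a b
  proof -
    obtain R where R: "\<And>x. x \<in> box a b \<Longrightarrow> norm x \<le> R" using bounded_box bounded_iff by metis
    let ?h = "\<lambda>x. indicator ({x. 0 < g x} \<inter> box a b) x *\<^sub>R g x"
    have int: "integrable lborel ?h"
      by (rule integrable_bounded_times[OF g, where B = 1 and R = R])
         (use R in \<open>auto simp: indicator_def dest: leD\<close>)
    have "(LINT x|lborel. ?h x) = 0"
      by (intro integral_Int_box_zero[OF g integral_box_zero[OF g zero]]) auto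
    then have "AE x in lborel. ?h x = 0"
      using integral_nonneg_eq_0_iff_AE[OF int] by (auto simp: indicator_def)
    then show ?thesis by eventually_elim (auto simp: indicator_def split: if_splits)
  qed
  then have "AE x in lborel. \<forall>k::nat. x \<in> box (\<chi> i. - real k) (\<chi> i. real k) \<longrightarrow> g x \<le> 0"
    by (subst AE_all_countable) blast
  then show ?thesis
  proof eventually_elim
    case (elim x)
    obtain k :: nat where k: "norm x < real k" using reals_Archimedean2 by blast
    then have "x \<in> box (\<chi> i. - real k) (\<chi> i. real k)"
      by (simp add: mem_box_cart) (meson abs_less_iff component_le_norm_cart le_less_trans minus_less_iff)
    with elim show ?case by blast
  qed
qed

text \<open>
  Test functions approximate indicators of boxes, so the integral of \<open>g\<close> over every bounded Borel set
  vanishes, in particular over bounded parts of the sets where a component of \<open>g\<close> is positive.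
\<close>

lemma fundamental_lemma:
  fixes g :: "real^'n::finite \<Rightarrow> 'b::euclidean_space"
  assumes g: "loc_int g"
    and zero: "\<And>\<phi>. test_function \<phi> \<Longrightarrow> (LINT x|lborel. \<phi> x *\<^sub>R g x) = 0"
  shows "AE x in lborel. g x = 0"
proof -
  have gm[measurable]: "g \<in> borel_measurable borel" by (rule loc_int_measurable[OF g])
  have "AE x in lborel. g x \<bullet> c \<le> 0" for c
  proof (rule AE_nonpos_if_test_integrals_zero)
    have "indicator (cball 0 R) x *\<^sub>R (g x \<bullet> c) = (indicator (cball 0 R) x *\<^sub>R g x) \<bullet> c" for R x
      by simp
    then show "loc_int (\<lambda>x. g x \<bullet> c)"
      unfolding loc_int_def using loc_int_integrable[OF g] by (auto simp del: inner_scaleR_left)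
    show "(LINT x|lborel. \<phi> x *\<^sub>R (g x \<bullet> c)) = 0" if t: "test_function \<phi>" for \<phi>
      using zero[OF t] integral_inner_left[OF integrable_test_times[OF g t], of c] by simp
  qed
  from this have "AE x in lborel. \<forall>b\<in>Basis. g x \<bullet> b \<le> 0 \<and> g x \<bullet> (- b) \<le> 0"
    by (intro AE_finite_allI AE_conjI finite_Basis)
  then show ?thesis
  proof eventually_elim
    case (elim x)
    have "g x \<bullet> b = 0 \<bullet> b" if "b \<in> Basis" for b
    proof -
      have "g x \<bullet> b \<le> 0" "g x \<bullet> (- b) \<le> 0" using elim that by blast+
      then show ?thesis by (simp only: inner_minus_right inner_zero_left)
    qed
    then show ?case by (rule euclidean_eqI)
  qed
qed

section \<open>Elementary properties of weak derivatives\<close>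

lemma has_weak_deriv_borel_iff:
  fixes u w :: "real^'n::finite \<Rightarrow> 'b::{real_normed_field,euclidean_space}"
  assumes u: "u' \<in> borel_measurable borel" "AE x in lborel. u x = u' x"
    and w: "w' \<in> borel_measurable borel" "AE x in lborel. w x = w' x"
  shows "has_weak_deriv \<nu> u w \<longleftrightarrow> loc_int u' \<and> loc_int w' \<and>
     (\<forall>\<phi>. test_function \<phi> \<longrightarrow>
        (LINT x|lborel. mi_partial \<nu> \<phi> x *\<^sub>R u' x) = (- 1) ^ mi_order \<nu> * (LINT x|lborel. \<phi> x *\<^sub>R w' x))"
proof -
  have *: "(LINT x|lebesgue. \<phi> x *\<^sub>R f x) = (LINT x|lborel. \<phi> x *\<^sub>R f' x)"
    if "test_function \<phi>" "f' \<in> borel_measurable borel" "AE x in lborel. f x = f' x"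
    for \<phi> and f f' :: "real^'n \<Rightarrow> 'b"
  proof (rule lebesgue_integral_AE)
    show "(\<lambda>x. \<phi> x *\<^sub>R f' x) \<in> borel_measurable borel"
      using that(2) test_measurable[OF that(1)] by measurable
    show "AE x in lborel. \<phi> x *\<^sub>R f x = \<phi> x *\<^sub>R f' x" using that(3) by eventually_elim simp
  qed
  show ?thesis
    unfolding has_weak_deriv_def locally_integrable_iff[OF u] locally_integrable_iff[OF w]
    using *[OF _ u] *[OF _ w] test_mi_partial[where 'n = 'n] by (simp cong: conj_cong)
qed

lemma has_weak_deriv_borel_obtain:
  fixes u w :: "real^'n::finite \<Rightarrow> 'b::{real_normed_field,euclidean_space}"
  assumes "has_weak_deriv \<nu> u w"
  obtains u' w' where "loc_int u'" "loc_int w'" "AE x in lborel. u x = u' x" "AE x in lborel. w x = w' x"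
    "\<And>\<phi>. test_function \<phi> \<Longrightarrow>
        (LINT x|lborel. mi_partial \<nu> \<phi> x *\<^sub>R u' x) = (- 1) ^ mi_order \<nu> * (LINT x|lborel. \<phi> x *\<^sub>R w' x)"
proof -
  have "locally_integrable u" "locally_integrable w" using assms by (auto simp: has_weak_deriv_def)
  note l = this
  obtain u' where u: "loc_int u'" "AE x in lborel. u x = u' x"
    by (rule locally_integrable_representative[OF l(1)])
  obtain w' where w: "loc_int w'" "AE x in lborel. w x = w' x"
    by (rule locally_integrable_representative[OF l(2)])
  note * = u w
  from has_weak_deriv_borel_iff[OF loc_int_measurable[OF *(1)] *(2) loc_int_measurable[OF *(3)] *(4), of \<nu>] assms * that
  show ?thesis by blast
qed

lemma has_weak_deriv_cong:
  fixes u w :: "real^'n::finite \<Rightarrow> 'b::{real_normed_field,euclidean_space}"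
  assumes "has_weak_deriv \<nu> u w" "AE x in lborel. u x = u1 x" "AE x in lborel. w x = w1 x"
  shows "has_weak_deriv \<nu> u1 w1"
proof -
  obtain u' w' where *: "loc_int u'" "loc_int w'" "AE x in lborel. u x = u' x" "AE x in lborel. w x = w' x"
    "\<And>\<phi>. test_function \<phi> \<Longrightarrow>
        (LINT x|lborel. mi_partial \<nu> \<phi> x *\<^sub>R u' x) = (- 1) ^ mi_order \<nu> * (LINT x|lborel. \<phi> x *\<^sub>R w' x)"
    using has_weak_deriv_borel_obtain[OF assms(1)] by blast
  have "AE x in lborel. u1 x = u' x" "AE x in lborel. w1 x = w' x"
    using assms(2,3) *(3,4) by auto
  from has_weak_deriv_borel_iff[OF loc_int_measurable[OF *(1)] this(1) loc_int_measurable[OF *(2)] this(2), of \<nu>] *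
  show ?thesis by blast
qed

lemma has_weak_deriv_unique:
  fixes u w :: "real^'n::finite \<Rightarrow> 'b::{real_normed_field,euclidean_space}"
  assumes "has_weak_deriv \<nu> u w" "has_weak_deriv \<nu> u z"
  shows "AE x in lborel. w x = z x"
proof -
  obtain u' w' where *: "loc_int u'" "loc_int w'" "AE x in lborel. u x = u' x" "AE x in lborel. w x = w' x"
    "\<And>\<phi>. test_function \<phi> \<Longrightarrow>
        (LINT x|lborel. mi_partial \<nu> \<phi> x *\<^sub>R u' x) = (- 1) ^ mi_order \<nu> * (LINT x|lborel. \<phi> x *\<^sub>R w' x)"
    using has_weak_deriv_borel_obtain[OF assms(1)] by blast
  obtain z' where z: "loc_int z'" "AE x in lborel. z x = z' x"
    using assms(2) locally_integrable_representative unfolding has_weak_deriv_def by metis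
  have **: "(LINT x|lborel. mi_partial \<nu> \<phi> x *\<^sub>R u' x) = (- 1) ^ mi_order \<nu> * (LINT x|lborel. \<phi> x *\<^sub>R z' x)"
    if "test_function \<phi>" for \<phi>
    using has_weak_deriv_borel_iff[OF loc_int_measurable[OF *(1)] *(3) loc_int_measurable[OF z(1)] z(2), of \<nu>] assms(2) that
    by blast
  have "AE x in lborel. w' x - z' x = 0"
  proof (rule fundamental_lemma[OF loc_int_diff[OF *(2) z(1)]])
    fix \<phi> :: "real^'n \<Rightarrow> real" assume t: "test_function \<phi>"
    have "(LINT x|lborel. \<phi> x *\<^sub>R w' x) = (LINT x|lborel. \<phi> x *\<^sub>R z' x)"
      using *(5)[OF t] **[OF t] by simp
    then show "(LINT x|lborel. \<phi> x *\<^sub>R (w' x - z' x)) = 0"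
      using integrable_test_times[OF *(2) t] integrable_test_times[OF z(1) t]
      by (simp add: scaleR_diff_right)
  qed
  with *(4) z(2) show ?thesis by eventually_elim simp
qed

lemma has_weak_deriv_weak_deriv: "has_weak_deriv \<nu> u w \<Longrightarrow> has_weak_deriv \<nu> u (weak_deriv \<nu> u)"
  unfolding weak_deriv_def by (rule someI[of "has_weak_deriv \<nu> u"])

lemma weak_deriv_AE:
  fixes u w :: "real^'n::finite \<Rightarrow> 'b::{real_normed_field,euclidean_space}"
  assumes "has_weak_deriv \<nu> u w"
  shows "AE x in lborel. weak_deriv \<nu> u x = w x"
  using has_weak_deriv_unique[OF has_weak_deriv_weak_deriv[OF assms] assms] .

lemma has_weak_deriv_lincomb:
  fixes u w :: "real^'n::finite \<Rightarrow> 'b::{real_normed_field,euclidean_space}"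
  assumes "has_weak_deriv \<nu> u w" "has_weak_deriv \<nu> u2 w2"
  shows "has_weak_deriv \<nu> (\<lambda>x. u x + c *\<^sub>R u2 x) (\<lambda>x. w x + c *\<^sub>R w2 x)"
proof -
  obtain u' w' where *: "loc_int u'" "loc_int w'" "AE x in lborel. u x = u' x" "AE x in lborel. w x = w' x"
    "\<And>\<phi>. test_function \<phi> \<Longrightarrow>
        (LINT x|lborel. mi_partial \<nu> \<phi> x *\<^sub>R u' x) = (- 1) ^ mi_order \<nu> * (LINT x|lborel. \<phi> x *\<^sub>R w' x)"
    using has_weak_deriv_borel_obtain[OF assms(1)] by blast
  obtain u2' w2' where **: "loc_int u2'" "loc_int w2'" "AE x in lborel. u2 x = u2' x" "AE x in lborel. w2 x = w2' x"
    "\<And>\<phi>. test_function \<phi> \<Longrightarrow>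
        (LINT x|lborel. mi_partial \<nu> \<phi> x *\<^sub>R u2' x) = (- 1) ^ mi_order \<nu> * (LINT x|lborel. \<phi> x *\<^sub>R w2' x)"
    using has_weak_deriv_borel_obtain[OF assms(2)] by blast
  have l: "loc_int (\<lambda>x. u' x + c *\<^sub>R u2' x)" "loc_int (\<lambda>x. w' x + c *\<^sub>R w2' x)"
    by (intro loc_int_add loc_int_scaleR * **)+
  have ae: "AE x in lborel. u x + c *\<^sub>R u2 x = u' x + c *\<^sub>R u2' x" "AE x in lborel. w x + c *\<^sub>R w2 x = w' x + c *\<^sub>R w2' x"
    using *(3,4) **(3,4) by (eventually_elim, simp)+
  have split: "(LINT x|lborel. \<phi> x *\<^sub>R (f x + c *\<^sub>R h x)) = (LINT x|lborel. \<phi> x *\<^sub>R f x) + c *\<^sub>R (LINT x|lborel. \<phi> x *\<^sub>R h x)"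
    if "test_function \<phi>" "loc_int f" "loc_int h" for \<phi> and f h :: "real^'n \<Rightarrow> 'b"
  proof -
    have "(LINT x|lborel. \<phi> x *\<^sub>R (f x + c *\<^sub>R h x)) = (LINT x|lborel. \<phi> x *\<^sub>R f x + c *\<^sub>R (\<phi> x *\<^sub>R h x))"
      by (intro Bochner_Integration.integral_cong) (auto simp: scaleR_add_right)
    also have "\<dots> = (LINT x|lborel. \<phi> x *\<^sub>R f x) + (LINT x|lborel. c *\<^sub>R (\<phi> x *\<^sub>R h x))"
      using that by (intro Bochner_Integration.integral_add integrable_scaleR_right integrable_test_times)
    also have "(LINT x|lborel. c *\<^sub>R (\<phi> x *\<^sub>R h x)) = c *\<^sub>R (LINT x|lborel. \<phi> x *\<^sub>R h x)"
      by (rule integral_scaleR_right)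
    finally show ?thesis .
  qed
  show ?thesis
    unfolding has_weak_deriv_borel_iff[OF loc_int_measurable[OF l(1)] ae(1) loc_int_measurable[OF l(2)] ae(2)]
    using l * ** by (auto simp: split test_mi_partial ring_distribs simp del: scaleR_scaleR scaleR_add_right)
qed

lemma has_weak_deriv_add:
  fixes u w :: "real^'n::finite \<Rightarrow> 'b::{real_normed_field,euclidean_space}"
  assumes "has_weak_deriv \<nu> u w" "has_weak_deriv \<nu> u2 w2"
  shows "has_weak_deriv \<nu> (\<lambda>x. u x + u2 x) (\<lambda>x. w x + w2 x)"
  using has_weak_deriv_lincomb[OF assms, of 1] by simp

lemma has_weak_deriv_order_zero:
  assumes "locally_integrable u"
  shows "has_weak_deriv (\<lambda>_. 0) u u"
  using assms by (auto simp: has_weak_deriv_def mi_order_zero mi_partial_zero test_smooth)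

text \<open>
  Tests the derivative of order \<open>\<nu>\<close> with \<open>partial i \<phi>\<close>.
\<close>

lemma has_weak_deriv_of_weak_deriv:
  fixes u w :: "real^'n::finite \<Rightarrow> 'b::{real_normed_field,euclidean_space}"
  assumes w: "has_weak_deriv \<nu> u w" and z: "has_weak_deriv (\<nu>(i := Suc (\<nu> i))) u z"
  shows "has_weak_deriv (unit_index i) w z"
  unfolding has_weak_deriv_def
proof (intro conjI allI impI)
  fix \<phi> :: "real^'n \<Rightarrow> real" assume t: "test_function \<phi>"
  have 1: "(LINT x|lebesgue. mi_partial \<nu> (partial i \<phi>) x *\<^sub>R u x) = (- 1) ^ mi_order \<nu> * (LINT x|lebesgue. partial i \<phi> x *\<^sub>R w x)"
    using w test_partial[OF t] by (simp add: has_weak_deriv_def)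
  have 2: "(LINT x|lebesgue. mi_partial \<nu> (partial i \<phi>) x *\<^sub>R u x) = (- 1) ^ Suc (mi_order \<nu>) * (LINT x|lebesgue. \<phi> x *\<^sub>R z x)"
    using z t unfolding has_weak_deriv_def mi_order_upd mi_partial_upd(2)[OF test_smooth[OF t], symmetric] by blast
  have "(- 1) ^ mi_order \<nu> * (LINT x|lebesgue. partial i \<phi> x *\<^sub>R w x) = (- 1) ^ mi_order \<nu> * (- (LINT x|lebesgue. \<phi> x *\<^sub>R z x))"
    using 1 2 by simp
  then have "(LINT x|lebesgue. partial i \<phi> x *\<^sub>R w x) = - (LINT x|lebesgue. \<phi> x *\<^sub>R z x)"
    by (subst (asm) mult_left_cancel) auto
  then show "(LINT x|lebesgue. mi_partial (unit_index i) \<phi> x *\<^sub>R w x) = (- 1) ^ mi_order (unit_index i) * (LINT x|lebesgue. \<phi> x *\<^sub>R z x)"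
    using mi_partial_unit[OF test_smooth[OF t], of i] by (simp add: mi_order_unit)
qed (use assms in \<open>auto simp: has_weak_deriv_def\<close>)

text \<open>
  Tests the first-order derivative with a derivative of \<open>\<phi>\<close>, which is again a test function.
\<close>

lemma has_weak_deriv_compose:
  fixes f g h :: "real^'n::finite \<Rightarrow> 'b::{real_normed_field,euclidean_space}"
  assumes g: "has_weak_deriv (unit_index i) f g" and h: "has_weak_deriv \<mu> g h"
  shows "has_weak_deriv (\<mu>(i := Suc (\<mu> i))) f h"
  unfolding has_weak_deriv_def
proof (intro conjI allI impI)
  fix \<phi> :: "real^'n \<Rightarrow> real" assume t: "test_function \<phi>"
  have 1: "(LINT x|lebesgue. mi_partial (unit_index i) (mi_partial \<mu> \<phi>) x *\<^sub>R f x) = - (LINT x|lebesgue. mi_partial \<mu> \<phi> x *\<^sub>R g x)"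
    using g test_mi_partial[OF t, of \<mu>] by (simp add: has_weak_deriv_def mi_order_unit)
  have 2: "(LINT x|lebesgue. mi_partial \<mu> \<phi> x *\<^sub>R g x) = (- 1) ^ (mi_order \<mu>) * (LINT x|lebesgue. \<phi> x *\<^sub>R h x)"
    using h t unfolding has_weak_deriv_def by blast
  show "(LINT x|lebesgue. mi_partial (\<mu>(i := Suc (\<mu> i))) \<phi> x *\<^sub>R f x) = (- 1) ^ mi_order (\<mu>(i := Suc (\<mu> i))) * (LINT x|lebesgue. \<phi> x *\<^sub>R h x)"
    using 1 2 unfolding mi_partial_upd(1)[OF test_smooth[OF t]] mi_partial_unit[OF test_smooth[OF test_mi_partial[OF t]]] mi_order_upd
    by simp
qed (use assms in \<open>auto simp: has_weak_deriv_def\<close>)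

section \<open>Weak derivatives and increments along lines\<close>

lemma nn_integral_lborel_shift:
  fixes f :: "'a::euclidean_space \<Rightarrow> ennreal"
  assumes [measurable]: "f \<in> borel_measurable borel"
  shows "(\<integral>\<^sup>+x. f (x + c) \<partial>lborel) = (\<integral>\<^sup>+x. f x \<partial>lborel)"
proof -
  have "(\<integral>\<^sup>+x. f x \<partial>lborel) = (\<integral>\<^sup>+x. f x \<partial>distr lborel borel ((+) c))"
    by (simp add: lborel_distr_plus)
  also have "\<dots> = (\<integral>\<^sup>+x. f (c + x) \<partial>lborel)" by (subst nn_integral_distr) auto
  finally show ?thesis by (simp add: add.commute)
qed

lemma integral_lborel_shift:
  fixes f :: "'a::euclidean_space \<Rightarrow> 'b::euclidean_space"
  assumes [measurable]: "f \<in> borel_measurable borel"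
  shows "(LINT x|lborel. f (x + c)) = (LINT x|lborel. f x)"
proof -
  have "(LINT x|lborel. f x) = (LINT x|distr lborel borel ((+) c). f x)"
    by (simp add: lborel_distr_plus)
  also have "\<dots> = (LINT x|lborel. f (c + x))" by (subst integral_distr) auto
  finally show ?thesis by (simp add: add.commute)
qed

lemma loc_int_shift:
  fixes g :: "real^'n::finite \<Rightarrow> 'b::euclidean_space"
  assumes g: "loc_int g"
  shows "loc_int (\<lambda>x. g (x + c))"
proof (rule loc_intI)
  have [measurable]: "g \<in> borel_measurable borel" by (rule loc_int_measurable[OF g])
  show "(\<lambda>x. g (x + c)) \<in> borel_measurable borel" by measurable
  fix R
  have [measurable]: "cball (0::real^'n) R \<in> sets borel" by simp
  have "(\<integral>\<^sup>+x. indicator (cball 0 R) x * ennreal (norm (g (x + c))) \<partial>lborel)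
     = (\<integral>\<^sup>+x. indicator (cball 0 R) (x + c - c) * ennreal (norm (g (x + c))) \<partial>lborel)" by simp
  also have "\<dots> = (\<integral>\<^sup>+x. indicator (cball 0 R) (x - c) * ennreal (norm (g x)) \<partial>lborel)"
    by (rule nn_integral_lborel_shift[where f = "\<lambda>x. indicator (cball 0 R) (x - c) * ennreal (norm (g x))"]) measurable
  also have "\<dots> \<le> (\<integral>\<^sup>+x. indicator (cball 0 (R + norm c)) x * ennreal (norm (g x)) \<partial>lborel)"
  proof (intro nn_integral_mono mult_right_mono)
    fix x
    have "norm x \<le> norm (x - c) + norm c" by (metis norm_triangle_sub add.commute)
    then show "indicator (cball 0 R) (x - c) \<le> (indicator (cball 0 (R + norm c)) x :: ennreal)"
      by (auto simp: indicator_def)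
  qed auto
  also have "\<dots> < \<infinity>" by (rule loc_int_finite[OF g])
  finally show "(\<integral>\<^sup>+x. indicator (cball 0 R) x * ennreal (norm (g (x + c))) \<partial>lborel) < \<infinity>" .
qed

text \<open>
  Every translate of \<open>G\<close> by at most \<open>t h\<close> contributes no more than the integral of its norm over one larger
  ball.
\<close>

lemma line_average_finite:
  fixes G :: "real^'n::finite \<Rightarrow> 'b::euclidean_space"
  assumes G: "loc_int G"
  shows "(\<integral>\<^sup>+\<tau>. \<integral>\<^sup>+x. indicator {0..t} \<tau> * (indicator (cball 0 R) x * ennreal (norm (G (x + \<tau> *\<^sub>R h)))) \<partial>lborel \<partial>lborel) < \<infinity>"
proof -
  have [measurable]: "G \<in> borel_measurable borel" by (rule loc_int_measurable[OF G])
  have [measurable]: "cball (0::real^'n) R \<in> sets borel" for R by simp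
  define S where "S = (\<integral>\<^sup>+x. indicator (cball 0 (R + t * norm h)) x * ennreal (norm (G x)) \<partial>lborel)"
  have "(\<integral>\<^sup>+x. indicator {0..t} \<tau> * (indicator (cball 0 R) x * ennreal (norm (G (x + \<tau> *\<^sub>R h)))) \<partial>lborel)
     \<le> indicator {0..t} \<tau> * S" for \<tau>
  proof (cases "\<tau> \<in> {0..t}")
    case True
    have "(\<integral>\<^sup>+x. indicator (cball 0 R) x * ennreal (norm (G (x + \<tau> *\<^sub>R h))) \<partial>lborel)
      = (\<integral>\<^sup>+x. indicator (cball 0 R) (x + \<tau> *\<^sub>R h - \<tau> *\<^sub>R h) * ennreal (norm (G (x + \<tau> *\<^sub>R h))) \<partial>lborel)" by simp
    also have "\<dots> = (\<integral>\<^sup>+x. indicator (cball 0 R) (x - \<tau> *\<^sub>R h) * ennreal (norm (G x)) \<partial>lborel)"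
      by (rule nn_integral_lborel_shift[where f = "\<lambda>x. indicator (cball 0 R) (x - \<tau> *\<^sub>R h) * ennreal (norm (G x))"]) measurable
    also have "\<dots> \<le> S" unfolding S_def
    proof (intro nn_integral_mono mult_right_mono)
      fix x
      have "norm x \<le> norm (x - \<tau> *\<^sub>R h) + norm (\<tau> *\<^sub>R h)" by (metis norm_triangle_sub add.commute)
      moreover have "norm (\<tau> *\<^sub>R h) \<le> t * norm h" using True by (auto intro: mult_right_mono)
      ultimately show "indicator (cball 0 R) (x - \<tau> *\<^sub>R h) \<le> (indicator (cball 0 (R + t * norm h)) x :: ennreal)"
        by (auto simp: indicator_def)
    qed auto
    finally show ?thesis using True by simp
  qed simp
  then have "(\<integral>\<^sup>+\<tau>. \<integral>\<^sup>+x. indicator {0..t} \<tau> * (indicator (cball 0 R) x * ennreal (norm (G (x + \<tau> *\<^sub>R h)))) \<partial>lborel \<partial>lborel)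
     \<le> (\<integral>\<^sup>+\<tau>. indicator {0..t} \<tau> * S \<partial>lborel)" by (rule nn_integral_mono)
  also have "\<dots> = emeasure lborel {0..t} * S" by (subst nn_integral_multc) auto
  also have "\<dots> < \<infinity>"
    using loc_int_finite[OF G] unfolding S_def by (auto simp: ennreal_mult_less_top emeasure_lborel_Icc_eq)
  finally show ?thesis .
qed

lemma line_average_integrable:
  fixes G :: "real^'n::finite \<Rightarrow> 'b::euclidean_space"
  assumes G: "loc_int G" and \<phi>[measurable]: "\<phi> \<in> borel_measurable borel"
    and B: "\<And>x. \<bar>\<phi> x\<bar> \<le> B" and R: "\<And>x. R < norm x \<Longrightarrow> \<phi> x = 0"
  shows "integrable (lborel \<Otimes>\<^sub>M lborel) (\<lambda>(x, \<tau>). (\<phi> x * indicator {0..t} \<tau>) *\<^sub>R G (x + \<tau> *\<^sub>R h))"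
    and "integrable (lborel \<Otimes>\<^sub>M lborel) (\<lambda>(y, \<tau>). (\<phi> (y - \<tau> *\<^sub>R h) * indicator {0..t} \<tau>) *\<^sub>R G y)"
proof -
  have [measurable]: "G \<in> borel_measurable borel" by (rule loc_int_measurable[OF G])
  have [measurable]: "cball (0::real^'n) R \<in> sets borel" for R by simp
  have B0: "0 \<le> B" using B[of 0] by linarith
  have bnd: "ennreal (norm ((\<phi> x * indicator {0..t} \<tau>) *\<^sub>R z))
      \<le> ennreal B * (indicator {0..t} \<tau> * (indicator (cball 0 R) x * ennreal (norm z)))" for x \<tau> and z :: 'b
  proof (cases "R < norm x \<or> \<tau> \<notin> {0..t}")
    case False
    have "ennreal (\<bar>\<phi> x\<bar> * norm z) \<le> ennreal (B * norm z)"
      using B[of x] by (intro ennreal_leI mult_right_mono) auto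
    then show ?thesis using False B0 by (simp add: indicator_def ennreal_mult)
  qed (auto simp: R)
  have fin: "(\<integral>\<^sup>+\<tau>. \<integral>\<^sup>+x. ennreal (norm ((\<phi> x * indicator {0..t} \<tau>) *\<^sub>R G (x + \<tau> *\<^sub>R h))) \<partial>lborel \<partial>lborel) < \<infinity>"
  proof -
    have "(\<integral>\<^sup>+\<tau>. \<integral>\<^sup>+x. ennreal (norm ((\<phi> x * indicator {0..t} \<tau>) *\<^sub>R G (x + \<tau> *\<^sub>R h))) \<partial>lborel \<partial>lborel)
      \<le> (\<integral>\<^sup>+\<tau>. \<integral>\<^sup>+x. ennreal B * (indicator {0..t} \<tau> * (indicator (cball 0 R) x * ennreal (norm (G (x + \<tau> *\<^sub>R h))))) \<partial>lborel \<partial>lborel)"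
      by (intro nn_integral_mono bnd)
    also have "\<dots> = ennreal B * (\<integral>\<^sup>+\<tau>. \<integral>\<^sup>+x. (indicator {0..t} \<tau> * (indicator (cball 0 R) x * ennreal (norm (G (x + \<tau> *\<^sub>R h))))) \<partial>lborel \<partial>lborel)"
    proof -
      have "(\<integral>\<^sup>+x. ennreal B * (indicator {0..t} \<tau> * (indicator (cball 0 R) x * ennreal (norm (G (x + \<tau> *\<^sub>R h))))) \<partial>lborel)
        = ennreal B * (\<integral>\<^sup>+x. (indicator {0..t} \<tau> * (indicator (cball 0 R) x * ennreal (norm (G (x + \<tau> *\<^sub>R h))))) \<partial>lborel)" for \<tau>
        by (rule nn_integral_cmult) measurable
      then show ?thesis by (simp only:, intro nn_integral_cmult) measurable
    qed
    also have "\<dots> < \<infinity>" using line_average_finite[OF G] by (simp add: ennreal_mult_less_top)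
    finally show ?thesis .
  qed
  show "integrable (lborel \<Otimes>\<^sub>M lborel) (\<lambda>(x, \<tau>). (\<phi> x * indicator {0..t} \<tau>) *\<^sub>R G (x + \<tau> *\<^sub>R h))"
    unfolding integrable_iff_bounded
  proof
    have m: "(\<lambda>p. ennreal (norm (case p of (x, \<tau>) \<Rightarrow> (\<phi> x * indicator {0..t} \<tau>) *\<^sub>R G (x + \<tau> *\<^sub>R h)))) \<in> borel_measurable (lborel \<Otimes>\<^sub>M lborel)"
      by measurable
    show "(\<integral>\<^sup>+p. ennreal (norm (case p of (x, \<tau>) \<Rightarrow> (\<phi> x * indicator {0..t} \<tau>) *\<^sub>R G (x + \<tau> *\<^sub>R h))) \<partial>(lborel \<Otimes>\<^sub>M lborel)) < \<infinity>"
      unfolding lborel_pair.nn_integral_snd[OF m, symmetric] using fin by (simp only: prod.case)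
  qed measurable
  have eq: "(\<integral>\<^sup>+y. ennreal (norm ((\<phi> (y - \<tau> *\<^sub>R h) * indicator {0..t} \<tau>) *\<^sub>R G y)) \<partial>lborel)
     = (\<integral>\<^sup>+x. ennreal (norm ((\<phi> x * indicator {0..t} \<tau>) *\<^sub>R G (x + \<tau> *\<^sub>R h))) \<partial>lborel)" for \<tau>
    using nn_integral_lborel_shift[of "\<lambda>y. ennreal (norm ((\<phi> (y - \<tau> *\<^sub>R h) * indicator {0..t} \<tau>) *\<^sub>R G y))" "\<tau> *\<^sub>R h"]
    by simp
  show "integrable (lborel \<Otimes>\<^sub>M lborel) (\<lambda>(y, \<tau>). (\<phi> (y - \<tau> *\<^sub>R h) * indicator {0..t} \<tau>) *\<^sub>R G y)"
    unfolding integrable_iff_bounded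
  proof
    have m: "(\<lambda>p. ennreal (norm (case p of (y, \<tau>) \<Rightarrow> (\<phi> (y - \<tau> *\<^sub>R h) * indicator {0..t} \<tau>) *\<^sub>R G y))) \<in> borel_measurable (lborel \<Otimes>\<^sub>M lborel)"
      by measurable
    show "(\<integral>\<^sup>+p. ennreal (norm (case p of (y, \<tau>) \<Rightarrow> (\<phi> (y - \<tau> *\<^sub>R h) * indicator {0..t} \<tau>) *\<^sub>R G y)) \<partial>(lborel \<Otimes>\<^sub>M lborel)) < \<infinity>"
      unfolding lborel_pair.nn_integral_snd[OF m, symmetric] using fin eq by (simp only: prod.case)
  qed measurable
qed

text \<open>
  In the first equation the translation is moved from \<open>G\<close> to the test function, in the second the average
  over the segment.
\<close>

lemma line_average_Fubini:
  fixes G :: "real^'n::finite \<Rightarrow> 'b::euclidean_space"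
  assumes G: "loc_int G" and \<phi>[measurable]: "\<phi> \<in> borel_measurable borel"
    and B: "\<And>x. \<bar>\<phi> x\<bar> \<le> B" and R: "\<And>x. R < norm x \<Longrightarrow> \<phi> x = 0"
  shows "(LINT x|lborel. \<phi> x *\<^sub>R (LINT \<tau>|lborel. indicator {0..t} \<tau> *\<^sub>R G (x + \<tau> *\<^sub>R h)))
       = (LINT \<tau>|lborel. indicator {0..t} \<tau> *\<^sub>R (LINT y|lborel. \<phi> (y - \<tau> *\<^sub>R h) *\<^sub>R G y))"
    and "(LINT \<tau>|lborel. indicator {0..t} \<tau> *\<^sub>R (LINT y|lborel. \<phi> (y - \<tau> *\<^sub>R h) *\<^sub>R G y))
       = (LINT y|lborel. (LINT \<tau>|lborel. \<phi> (y - \<tau> *\<^sub>R h) * indicator {0..t} \<tau>) *\<^sub>R G y)"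
proof -
  have [measurable]: "G \<in> borel_measurable borel" by (rule loc_int_measurable[OF G])
  have "(LINT x|lborel. \<phi> x *\<^sub>R (LINT \<tau>|lborel. indicator {0..t} \<tau> *\<^sub>R G (x + \<tau> *\<^sub>R h)))
      = (LINT x|lborel. LINT \<tau>|lborel. (\<phi> x * indicator {0..t} \<tau>) *\<^sub>R G (x + \<tau> *\<^sub>R h))"
    by (simp flip: scaleR_scaleR)
  also have "\<dots> = (LINT \<tau>|lborel. LINT x|lborel. (\<phi> x * indicator {0..t} \<tau>) *\<^sub>R G (x + \<tau> *\<^sub>R h))"
    by (rule lborel_pair.Fubini_integral[symmetric, OF line_average_integrable(1)[OF assms]])
  also have "\<dots> = (LINT \<tau>|lborel. LINT y|lborel. (\<phi> (y - \<tau> *\<^sub>R h) * indicator {0..t} \<tau>) *\<^sub>R G y)"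
  proof (rule Bochner_Integration.integral_cong[OF refl])
    fix \<tau>
    show "(LINT x|lborel. (\<phi> x * indicator {0..t} \<tau>) *\<^sub>R G (x + \<tau> *\<^sub>R h)) = (LINT y|lborel. (\<phi> (y - \<tau> *\<^sub>R h) * indicator {0..t} \<tau>) *\<^sub>R G y)"
      using integral_lborel_shift[of "\<lambda>y. (\<phi> (y - \<tau> *\<^sub>R h) * indicator {0..t} \<tau>) *\<^sub>R G y" "\<tau> *\<^sub>R h"] by simp
  qed
  also have eq: "(LINT \<tau>|lborel. LINT y|lborel. (\<phi> (y - \<tau> *\<^sub>R h) * indicator {0..t} \<tau>) *\<^sub>R G y)
      = (LINT \<tau>|lborel. indicator {0..t} \<tau> *\<^sub>R (LINT y|lborel. \<phi> (y - \<tau> *\<^sub>R h) *\<^sub>R G y))"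
    by (simp add: mult.commute[of _ "indicator _ _"] flip: scaleR_scaleR)
  finally show "(LINT x|lborel. \<phi> x *\<^sub>R (LINT \<tau>|lborel. indicator {0..t} \<tau> *\<^sub>R G (x + \<tau> *\<^sub>R h)))
       = (LINT \<tau>|lborel. indicator {0..t} \<tau> *\<^sub>R (LINT y|lborel. \<phi> (y - \<tau> *\<^sub>R h) *\<^sub>R G y))" .
  have "(LINT \<tau>|lborel. LINT y|lborel. (\<phi> (y - \<tau> *\<^sub>R h) * indicator {0..t} \<tau>) *\<^sub>R G y)
     = (LINT y|lborel. LINT \<tau>|lborel. (\<phi> (y - \<tau> *\<^sub>R h) * indicator {0..t} \<tau>) *\<^sub>R G y)"
    by (rule lborel_pair.Fubini_integral[OF line_average_integrable(2)[OF assms]])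
  also have "\<dots> = (LINT y|lborel. (LINT \<tau>|lborel. \<phi> (y - \<tau> *\<^sub>R h) * indicator {0..t} \<tau>) *\<^sub>R G y)"
  proof (rule Bochner_Integration.integral_cong[OF refl], rule integral_scaleR_left)
    fix y
    show "integrable lborel (\<lambda>\<tau>. \<phi> (y - \<tau> *\<^sub>R h) * indicator {0..t} \<tau>)"
      by (rule integrableI_bounded_set[where A = "{0..t}" and B = B])
         (use B in \<open>auto simp: indicator_def emeasure_lborel_Icc_eq\<close>)
  qed
  finally show "(LINT \<tau>|lborel. indicator {0..t} \<tau> *\<^sub>R (LINT y|lborel. \<phi> (y - \<tau> *\<^sub>R h) *\<^sub>R G y))
       = (LINT y|lborel. (LINT \<tau>|lborel. \<phi> (y - \<tau> *\<^sub>R h) * indicator {0..t} \<tau>) *\<^sub>R G y)"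
    using eq by simp
qed

lemma line_average_loc_int:
  fixes G :: "real^'n::finite \<Rightarrow> 'b::euclidean_space"
  assumes G: "loc_int G"
  shows "loc_int (\<lambda>x. LINT \<tau>|lborel. indicator {0..t} \<tau> *\<^sub>R G (x + \<tau> *\<^sub>R h))"
proof (rule loc_intI)
  have [measurable]: "G \<in> borel_measurable borel" by (rule loc_int_measurable[OF G])
  have [measurable]: "cball (0::real^'n) R \<in> sets borel" for R by simp
  show "(\<lambda>x. LINT \<tau>|lborel. indicator {0..t} \<tau> *\<^sub>R G (x + \<tau> *\<^sub>R h)) \<in> borel_measurable borel"
    by measurable
  fix R
  have "indicator (cball 0 R) x * ennreal (norm (LINT \<tau>|lborel. indicator {0..t} \<tau> *\<^sub>R G (x + \<tau> *\<^sub>R h)))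
     \<le> (\<integral>\<^sup>+\<tau>. indicator {0..t} \<tau> * (indicator (cball 0 R) x * ennreal (norm (G (x + \<tau> *\<^sub>R h)))) \<partial>lborel)" for x
  proof -
    have "ennreal (norm (LINT \<tau>|lborel. indicator {0..t} \<tau> *\<^sub>R G (x + \<tau> *\<^sub>R h)))
       \<le> (\<integral>\<^sup>+\<tau>. indicator {0..t} \<tau> * ennreal (norm (G (x + \<tau> *\<^sub>R h))) \<partial>lborel)"
    proof (cases "integrable lborel (\<lambda>\<tau>. indicator {0..t} \<tau> *\<^sub>R G (x + \<tau> *\<^sub>R h))")
      case True
      have "ennreal (norm (indicator {0..t} \<tau> *\<^sub>R G (x + \<tau> *\<^sub>R h))) = indicator {0..t} \<tau> * ennreal (norm (G (x + \<tau> *\<^sub>R h)))" for \<tau>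
        by (auto simp: indicator_def)
      then show ?thesis using integral_norm_bound_ennreal[OF True] by simp
    qed (simp add: not_integrable_integral_eq)
    then show ?thesis by (auto simp: indicator_def)
  qed
  then have "(\<integral>\<^sup>+x. indicator (cball 0 R) x * ennreal (norm (LINT \<tau>|lborel. indicator {0..t} \<tau> *\<^sub>R G (x + \<tau> *\<^sub>R h))) \<partial>lborel)
     \<le> (\<integral>\<^sup>+x. \<integral>\<^sup>+\<tau>. indicator {0..t} \<tau> * (indicator (cball 0 R) x * ennreal (norm (G (x + \<tau> *\<^sub>R h)))) \<partial>lborel \<partial>lborel)"
    by (rule nn_integral_mono)
  also have "\<dots> = (\<integral>\<^sup>+\<tau>. \<integral>\<^sup>+x. indicator {0..t} \<tau> * (indicator (cball 0 R) x * ennreal (norm (G (x + \<tau> *\<^sub>R h)))) \<partial>lborel \<partial>lborel)"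
    by (rule lborel_pair.Fubini'[symmetric]) measurable
  also have "\<dots> < \<infinity>" by (rule line_average_finite[OF G])
  finally show "(\<integral>\<^sup>+x. indicator (cball 0 R) x * ennreal (norm (LINT \<tau>|lborel. indicator {0..t} \<tau> *\<^sub>R G (x + \<tau> *\<^sub>R h))) \<partial>lborel) < \<infinity>" .
qed

definition dir_deriv :: "real^'n \<Rightarrow> (real^'n::finite \<Rightarrow> real) \<Rightarrow> real^'n \<Rightarrow> real" where
  "dir_deriv h \<phi> x = (\<Sum>i\<in>UNIV. h $ i * partial i \<phi> x)"

definition weak_dir :: "real^'n \<Rightarrow> (real^'n::finite \<Rightarrow> 'b::euclidean_space) \<Rightarrow> (real^'n \<Rightarrow> 'b) \<Rightarrow> bool" where
  "weak_dir h g G \<longleftrightarrow> (\<forall>\<phi>. test_function \<phi> \<longrightarrow>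
      (LINT x|lborel. dir_deriv h \<phi> x *\<^sub>R g x) = - (LINT x|lborel. \<phi> x *\<^sub>R G x))"

text \<open>
  The exceptional null set may depend on \<open>t\<close>.
\<close>

definition line_increment :: "real^'n \<Rightarrow> (real^'n::finite \<Rightarrow> 'b::euclidean_space) \<Rightarrow> (real^'n \<Rightarrow> 'b) \<Rightarrow> bool" where
  "line_increment h g G \<longleftrightarrow> (\<forall>t\<ge>0. AE x in lborel.
      g (x + t *\<^sub>R h) - g x = (LINT \<tau>|lborel. indicator {0..t} \<tau> *\<^sub>R G (x + \<tau> *\<^sub>R h)))"

lemma dir_deriv_continuous: "test_function \<phi> \<Longrightarrow> continuous_on UNIV (dir_deriv h \<phi>)"
  unfolding dir_deriv_def[abs_def] by (intro continuous_intros test_continuous test_partial)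

lemma dir_deriv_measurable: "test_function \<phi> \<Longrightarrow> dir_deriv h \<phi> \<in> borel_measurable borel"
  by (simp add: borel_measurable_continuous_onI dir_deriv_continuous)

lemma dir_deriv_bounded:
  fixes \<phi> :: "real^'n::finite \<Rightarrow> real"
  assumes t: "test_function \<phi>"
  obtains B R where "B > 0" "\<And>x. \<bar>dir_deriv h \<phi> x\<bar> \<le> B" "\<And>x. R < norm x \<Longrightarrow> dir_deriv h \<phi> x = 0"
proof -
  have "\<exists>B R. B > 0 \<and> R > 0 \<and> (\<forall>x. \<bar>partial i \<phi> x\<bar> \<le> B) \<and> (\<forall>x. R < norm x \<longrightarrow> partial i \<phi> x = 0)" for i
    using test_bounded[OF test_partial[OF t, of i]] by metis
  then obtain B R where BR: "\<And>i. B i > 0" "\<And>i. R i > (0::real)" "\<And>i x. \<bar>partial i \<phi> x\<bar> \<le> B i"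
      "\<And>i x. R i < norm x \<Longrightarrow> partial i \<phi> x = 0" by metis
  show ?thesis
  proof (rule that)
    show "0 < (\<Sum>i\<in>UNIV. \<bar>h $ i\<bar> * B i) + 1"
      using BR(1) by (intro add_nonneg_pos sum_nonneg mult_nonneg_nonneg) (auto intro: less_imp_le)
    show "\<bar>dir_deriv h \<phi> x\<bar> \<le> (\<Sum>i\<in>UNIV. \<bar>h $ i\<bar> * B i) + 1" for x
    proof -
      have "\<bar>dir_deriv h \<phi> x\<bar> \<le> (\<Sum>i\<in>UNIV. \<bar>h $ i * partial i \<phi> x\<bar>)" unfolding dir_deriv_def by (rule sum_abs)
      also have "\<dots> \<le> (\<Sum>i\<in>UNIV. \<bar>h $ i\<bar> * B i)"
        using BR(3) by (intro sum_mono) (auto simp: abs_mult intro: mult_left_mono)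
      finally show ?thesis by simp
    qed
    show "dir_deriv h \<phi> x = 0" if "(\<Sum>i\<in>UNIV. R i) < norm x" for x
    proof -
      have "R i < norm x" for i
        using member_le_sum[of i UNIV R] BR(2) that by (smt (verit) UNIV_I finite)
      then show ?thesis using BR(4) by (simp add: dir_deriv_def)
    qed
  qed
qed

lemma test_line_derivative:
  assumes "test_function \<phi>"
  shows "((\<lambda>\<tau>. \<phi> (y - \<tau> *\<^sub>R h)) has_real_derivative - dir_deriv h \<phi> (y - \<tau> *\<^sub>R h)) (at \<tau>)"
proof -
  have "((\<lambda>\<tau>. y - \<tau> *\<^sub>R h) has_derivative (\<lambda>d. - (d *\<^sub>R h))) (at \<tau>)"
    by (auto intro!: derivative_eq_intros)
  from has_derivative_compose[OF this smooth_has_derivative[OF test_smooth[OF assms]]]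
  show ?thesis
    by (rule has_derivative_imp_has_field_derivative)
       (simp add: dir_deriv_def sum_distrib_left sum_negf algebra_simps)
qed

text \<open>
  Both sides have the same integral against every test function: shifting \<open>\<phi>\<close> along the segment, the
  average of \<open>G\<close> turns into the average of \<open>g\<close> against the derivative of the shifted \<open>\<phi>\<close>, and the fundamental theorem
  of calculus evaluates the latter.
\<close>

lemma weak_dir_line_increment:
  fixes g G :: "real^'n::finite \<Rightarrow> 'b::euclidean_space"
  assumes g: "loc_int g" and G: "loc_int G" and w: "weak_dir h g G"
  shows "line_increment h g G"
  unfolding line_increment_def
proof (intro allI impI)
  fix t :: real assume t: "t \<ge> 0"
  define K where "K = (\<lambda>x. LINT \<tau>|lborel. indicator {0..t} \<tau> *\<^sub>R G (x + \<tau> *\<^sub>R h))"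
  have K: "loc_int K" unfolding K_def by (rule line_average_loc_int[OF G])
  have gs: "loc_int (\<lambda>x. g (x + t *\<^sub>R h))" by (rule loc_int_shift[OF g])
  have [measurable]: "g \<in> borel_measurable borel" by (rule loc_int_measurable[OF g])
  have "AE x in lborel. g (x + t *\<^sub>R h) - g x - K x = 0"
  proof (rule fundamental_lemma)
    show "loc_int (\<lambda>x. g (x + t *\<^sub>R h) - g x - K x)" by (intro loc_int_diff K g gs)
    fix \<phi> :: "real^'n \<Rightarrow> real" assume \<phi>: "test_function \<phi>"
    have m[measurable]: "\<phi> \<in> borel_measurable borel" by (rule test_measurable[OF \<phi>])
    obtain B R where BR: "\<And>x. \<bar>\<phi> x\<bar> \<le> B" "\<And>x. R < norm x \<Longrightarrow> \<phi> x = 0"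
      using test_bounded[OF \<phi>] by metis
    obtain B' R' where BR': "\<And>x. \<bar>dir_deriv h \<phi> x\<bar> \<le> B'" "\<And>x. R' < norm x \<Longrightarrow> dir_deriv h \<phi> x = 0"
      using dir_deriv_bounded[OF \<phi>, of h] by metis
    have t1: "test_function (\<lambda>x. \<phi> (x - c))" for c
      using test_translate[OF \<phi>, of "- c"] by simp
    have dd: "dir_deriv h (\<lambda>x. \<phi> (x - c)) x = dir_deriv h \<phi> (x - c)" for c x
      using smooth_translate(2)[OF test_smooth[OF \<phi>], of _ "- c"] by (simp add: dir_deriv_def)
    have "(LINT x|lborel. \<phi> x *\<^sub>R K x)
        = (LINT \<tau>|lborel. indicator {0..t} \<tau> *\<^sub>R (LINT y|lborel. \<phi> (y - \<tau> *\<^sub>R h) *\<^sub>R G y))"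
      unfolding K_def by (rule line_average_Fubini(1)[OF G m BR])
    also have "\<dots> = (LINT \<tau>|lborel. - (indicator {0..t} \<tau> *\<^sub>R (LINT y|lborel. dir_deriv h \<phi> (y - \<tau> *\<^sub>R h) *\<^sub>R g y)))"
    proof (rule Bochner_Integration.integral_cong[OF refl])
      fix \<tau> :: real
      have "(LINT y|lborel. dir_deriv h \<phi> (y - \<tau> *\<^sub>R h) *\<^sub>R g y) = - (LINT y|lborel. \<phi> (y - \<tau> *\<^sub>R h) *\<^sub>R G y)"
        using w[unfolded weak_dir_def, rule_format, OF t1[of "\<tau> *\<^sub>R h"]] unfolding dd .
      then show "indicator {0..t} \<tau> *\<^sub>R (LINT y|lborel. \<phi> (y - \<tau> *\<^sub>R h) *\<^sub>R G y)
         = - (indicator {0..t} \<tau> *\<^sub>R (LINT y|lborel. dir_deriv h \<phi> (y - \<tau> *\<^sub>R h) *\<^sub>R g y))" by simp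
    qed
    also have "\<dots> = - (LINT \<tau>|lborel. indicator {0..t} \<tau> *\<^sub>R (LINT y|lborel. dir_deriv h \<phi> (y - \<tau> *\<^sub>R h) *\<^sub>R g y))"
      by simp
    also have "\<dots> = - (LINT y|lborel. (LINT \<tau>|lborel. dir_deriv h \<phi> (y - \<tau> *\<^sub>R h) * indicator {0..t} \<tau>) *\<^sub>R g y)"
      by (rule arg_cong[where f = uminus], rule line_average_Fubini(2)[OF g dir_deriv_measurable[OF \<phi>] BR'])
    also have "\<dots> = - (LINT y|lborel. (\<phi> y - \<phi> (y - t *\<^sub>R h)) *\<^sub>R g y)"
    proof -
      have "(LINT \<tau>|lborel. dir_deriv h \<phi> (y - \<tau> *\<^sub>R h) * indicator {0..t} \<tau>) = \<phi> y - \<phi> (y - t *\<^sub>R h)" for y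
      proof -
        have "(LINT \<tau>|lborel. indicator {0..t} \<tau> *\<^sub>R dir_deriv h \<phi> (y - \<tau> *\<^sub>R h)) = - \<phi> (y - t *\<^sub>R h) - (- \<phi> (y - 0 *\<^sub>R h))"
        proof (rule integral_FTC_atLeastAtMost[OF t, where F = "\<lambda>\<tau>. - \<phi> (y - \<tau> *\<^sub>R h)"])
          have "((\<lambda>\<tau>. - \<phi> (y - \<tau> *\<^sub>R h)) has_real_derivative dir_deriv h \<phi> (y - \<tau> *\<^sub>R h)) (at \<tau>)" for \<tau>
            using DERIV_minus[OF test_line_derivative[OF \<phi>, of y h \<tau>]] by simp
          then show "((\<lambda>\<tau>. - \<phi> (y - \<tau> *\<^sub>R h)) has_vector_derivative dir_deriv h \<phi> (y - \<tau> *\<^sub>R h)) (at \<tau> within {0..t})" for \<tau>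
            using has_real_derivative_iff_has_vector_derivative has_vector_derivative_at_within by blast
          show "continuous_on {0..t} (\<lambda>\<tau>. dir_deriv h \<phi> (y - \<tau> *\<^sub>R h))"
            by (rule continuous_on_compose2[OF dir_deriv_continuous[OF \<phi>]]) (auto intro!: continuous_intros)
        qed
        then show ?thesis by (simp add: mult.commute)
      qed
      then show ?thesis by simp
    qed
    also have "\<dots> = (LINT y|lborel. \<phi> (y - t *\<^sub>R h) *\<^sub>R g y) - (LINT y|lborel. \<phi> y *\<^sub>R g y)"
      using integrable_test_times[OF g \<phi>] integrable_test_times[OF g t1, of "t *\<^sub>R h"]
      by (simp add: scaleR_diff_left)
    also have "(LINT y|lborel. \<phi> (y - t *\<^sub>R h) *\<^sub>R g y) = (LINT x|lborel. \<phi> x *\<^sub>R g (x + t *\<^sub>R h))"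
      using integral_lborel_shift[of "\<lambda>y. \<phi> (y - t *\<^sub>R h) *\<^sub>R g y" "t *\<^sub>R h"] by simp
    finally have "(LINT x|lborel. \<phi> x *\<^sub>R K x) = (LINT x|lborel. \<phi> x *\<^sub>R g (x + t *\<^sub>R h)) - (LINT y|lborel. \<phi> y *\<^sub>R g y)" .
    moreover have "(LINT x|lborel. \<phi> x *\<^sub>R (g (x + t *\<^sub>R h) - g x - K x))
        = (LINT x|lborel. \<phi> x *\<^sub>R g (x + t *\<^sub>R h)) - (LINT y|lborel. \<phi> y *\<^sub>R g y) - (LINT x|lborel. \<phi> x *\<^sub>R K x)"
      using integrable_test_times[OF g \<phi>] integrable_test_times[OF gs \<phi>] integrable_test_times[OF K \<phi>]
      by (simp add: scaleR_diff_right)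
    ultimately show "(LINT x|lborel. \<phi> x *\<^sub>R (g (x + t *\<^sub>R h) - g x - K x)) = 0" by simp
  qed
  then show "AE x in lborel. g (x + t *\<^sub>R h) - g x = (LINT \<tau>|lborel. indicator {0..t} \<tau> *\<^sub>R G (x + \<tau> *\<^sub>R h))"
    by eventually_elim (simp add: K_def)
qed

text \<open>
  Tested with \<open>\<phi>\<close> and divided by \<open>t\<close>, the increments become difference quotients of \<open>\<phi>\<close> against \<open>g\<close> and
  averages of \<open>\<phi>\<close> over short segments against \<open>G\<close>; both converge dominatedly as \<open>t \<rightarrow> 0\<close>.
\<close>

lemma line_increment_weak_dir:
  fixes g G :: "real^'n::finite \<Rightarrow> 'b::euclidean_space"
  assumes g: "loc_int g" and G: "loc_int G" and w: "line_increment h g G"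
  shows "weak_dir h g G"
  unfolding weak_dir_def
proof (intro allI impI)
  fix \<phi> :: "real^'n \<Rightarrow> real" assume \<phi>: "test_function \<phi>"
  have m[measurable]: "\<phi> \<in> borel_measurable borel" by (rule test_measurable[OF \<phi>])
  have m'[measurable]: "dir_deriv h \<phi> \<in> borel_measurable borel" by (rule dir_deriv_measurable[OF \<phi>])
  have [measurable]: "g \<in> borel_measurable borel" "G \<in> borel_measurable borel"
    by (rule loc_int_measurable[OF g] loc_int_measurable[OF G])+
  obtain B R where BR: "B > 0" "R > 0" "\<And>x. \<bar>\<phi> x\<bar> \<le> B" "\<And>x. R < norm x \<Longrightarrow> \<phi> x = 0"
    using test_bounded[OF \<phi>] by metis
  obtain B' R' where BR': "B' > 0" "\<And>x. \<bar>dir_deriv h \<phi> x\<bar> \<le> B'" "\<And>x. R' < norm x \<Longrightarrow> dir_deriv h \<phi> x = 0"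
    using dir_deriv_bounded[OF \<phi>, of h] by metis
  have t1: "test_function (\<lambda>x. \<phi> (x - c))" for c
    using test_translate[OF \<phi>, of "- c"] by simp
  have gs: "loc_int (\<lambda>x. g (x + c))" for c by (rule loc_int_shift[OF g])
  define t where "t = (\<lambda>n. inverse (real (Suc n)))"
  have t: "t n > 0" "t n \<le> 1" for n by (auto simp: t_def field_simps)
  have t0: "t \<longlonglongrightarrow> 0" unfolding t_def by (rule LIMSEQ_inverse_real_of_nat)
  \<comment> \<open>\<open>P\<close> are the difference quotients, \<open>Q\<close> the averages, rescaled to the unit interval\<close>
  define P where "P = (\<lambda>n y. (\<phi> (y - t n *\<^sub>R h) - \<phi> y) / t n)"
  define Q where "Q = (\<lambda>n y. LINT \<sigma>|lborel. \<phi> (y - (t n * \<sigma>) *\<^sub>R h) * indicator {0..1} \<sigma>)"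
  have PQ: "(LINT y|lborel. P n y *\<^sub>R g y) = (LINT y|lborel. Q n y *\<^sub>R G y)" for n
  proof -
    have "(LINT y|lborel. (\<phi> (y - t n *\<^sub>R h) - \<phi> y) *\<^sub>R g y) = (LINT y|lborel. \<phi> (y - t n *\<^sub>R h) *\<^sub>R g y) - (LINT y|lborel. \<phi> y *\<^sub>R g y)"
      using integrable_test_times[OF g \<phi>] integrable_test_times[OF g t1, of "t n *\<^sub>R h"]
      by (simp add: scaleR_diff_left)
    also have "(LINT y|lborel. \<phi> (y - t n *\<^sub>R h) *\<^sub>R g y) = (LINT x|lborel. \<phi> x *\<^sub>R g (x + t n *\<^sub>R h))"
      using integral_lborel_shift[of "\<lambda>y. \<phi> (y - t n *\<^sub>R h) *\<^sub>R g y" "t n *\<^sub>R h"] by simp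
    also have "\<dots> - (LINT y|lborel. \<phi> y *\<^sub>R g y) = (LINT x|lborel. \<phi> x *\<^sub>R (g (x + t n *\<^sub>R h) - g x))"
      using integrable_test_times[OF g \<phi>] integrable_test_times[OF gs \<phi>]
      by (simp add: scaleR_diff_right)
    also have "\<dots> = (LINT x|lborel. \<phi> x *\<^sub>R (LINT \<tau>|lborel. indicator {0..t n} \<tau> *\<^sub>R G (x + \<tau> *\<^sub>R h)))"
    proof (rule integral_cong_AE)
      have "AE x in lborel. g (x + t n *\<^sub>R h) - g x = (LINT \<tau>|lborel. indicator {0..t n} \<tau> *\<^sub>R G (x + \<tau> *\<^sub>R h))"
        using w t[of n] by (auto simp: line_increment_def)
      then show "AE x in lborel. \<phi> x *\<^sub>R (g (x + t n *\<^sub>R h) - g x) = \<phi> x *\<^sub>R (LINT \<tau>|lborel. indicator {0..t n} \<tau> *\<^sub>R G (x + \<tau> *\<^sub>R h))"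
        by eventually_elim simp
    qed measurable
    also have "\<dots> = (LINT y|lborel. (LINT \<tau>|lborel. \<phi> (y - \<tau> *\<^sub>R h) * indicator {0..t n} \<tau>) *\<^sub>R G y)"
      by (simp only: line_average_Fubini[OF G m BR(3,4)])
    also have "\<dots> = (LINT y|lborel. (t n * Q n y) *\<^sub>R G y)"
    proof -
      have "(LINT \<tau>|lborel. \<phi> (y - \<tau> *\<^sub>R h) * indicator {0..t n} \<tau>) = t n * Q n y" for y
      proof -
        have *: "indicator {0..t n} (t n * \<sigma>) = (indicator {0..1} \<sigma> :: real)" for \<sigma>
          using t[of n] by (auto simp: indicator_def zero_le_mult_iff mult_le_cancel_left1)
        show ?thesis
          using lborel_integral_real_affine[of "t n" "\<lambda>\<tau>. \<phi> (y - \<tau> *\<^sub>R h) * indicator {0..t n} \<tau>" 0] t(1)[of n]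
          by (simp add: Q_def *)
      qed
      then show ?thesis by simp
    qed
    finally have *: "(LINT y|lborel. (\<phi> (y - t n *\<^sub>R h) - \<phi> y) *\<^sub>R g y) = t n *\<^sub>R (LINT y|lborel. Q n y *\<^sub>R G y)"
      by (simp flip: scaleR_scaleR)
    have "(LINT y|lborel. P n y *\<^sub>R g y) = (LINT y|lborel. (1 / t n) *\<^sub>R (\<phi> (y - t n *\<^sub>R h) - \<phi> y) *\<^sub>R g y)"
      by (simp add: P_def)
    also have "\<dots> = (1 / t n) *\<^sub>R (LINT y|lborel. (\<phi> (y - t n *\<^sub>R h) - \<phi> y) *\<^sub>R g y)"
      by (rule integral_scaleR_right)
    also have "\<dots> = (LINT y|lborel. Q n y *\<^sub>R G y)"
      unfolding * using t(1)[of n] by simp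
    finally show ?thesis .
  qed
  have out: "\<phi> (y - \<tau> *\<^sub>R h) = 0" if "R + norm h < norm y" "0 \<le> \<tau>" "\<tau> \<le> 1" for y \<tau>
  proof (rule BR(4))
    have "norm (\<tau> *\<^sub>R h) \<le> norm h" using that by (simp add: mult_left_le_one_le)
    then show "R < norm (y - \<tau> *\<^sub>R h)"
      using norm_triangle_ineq2[of y "\<tau> *\<^sub>R h"] that by linarith
  qed
  have Pmv: "\<exists>\<xi>. 0 < \<xi> \<and> \<xi> < t n \<and> P n y = - dir_deriv h \<phi> (y - \<xi> *\<^sub>R h)" for n y
  proof -
    obtain \<xi> where \<xi>: "0 < \<xi>" "\<xi> < t n"
      "\<phi> (y - t n *\<^sub>R h) - \<phi> (y - 0 *\<^sub>R h) = (t n - 0) * (- dir_deriv h \<phi> (y - \<xi> *\<^sub>R h))"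
      using MVT2[OF t(1)[of n], of "\<lambda>\<tau>. \<phi> (y - \<tau> *\<^sub>R h)" "\<lambda>\<tau>. - dir_deriv h \<phi> (y - \<tau> *\<^sub>R h)"]
        test_line_derivative[OF \<phi>] by blast
    have "\<phi> (y - t n *\<^sub>R h) - \<phi> y = t n * (- dir_deriv h \<phi> (y - \<xi> *\<^sub>R h))" using \<xi>(3) by simp
    then show ?thesis using \<xi>(1,2) t(1)[of n] by (intro exI[of _ \<xi>]) (simp add: P_def)
  qed
  have [measurable]: "P n \<in> borel_measurable borel" for n unfolding P_def by measurable
  have [measurable]: "Q n \<in> borel_measurable borel" for n unfolding Q_def by measurable
  have 1: "(\<lambda>n. LINT y|lborel. P n y *\<^sub>R g y) \<longlonglongrightarrow> (LINT y|lborel. (- dir_deriv h \<phi> y) *\<^sub>R g y)"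
  proof (rule integral_dominated_convergence)
    show "integrable lborel (\<lambda>y. norm (B' *\<^sub>R (indicator (cball 0 (R + norm h)) y *\<^sub>R g y)))"
      by (intro integrable_norm integrable_scaleR_right loc_int_integrable[OF g])
    show "AE y in lborel. norm (P n y *\<^sub>R g y) \<le> norm (B' *\<^sub>R (indicator (cball 0 (R + norm h)) y *\<^sub>R g y))" for n
    proof (intro AE_I2)
      fix y
      show "norm (P n y *\<^sub>R g y) \<le> norm (B' *\<^sub>R (indicator (cball 0 (R + norm h)) y *\<^sub>R g y))"
      proof (cases "R + norm h < norm y")
        case True
        have "P n y = 0"
          using out[OF True, of "t n"] out[OF True, of 0] t[of n] by (simp add: P_def)
        then show ?thesis by simp
      next
        case False
        obtain \<xi> where "P n y = - dir_deriv h \<phi> (y - \<xi> *\<^sub>R h)" using Pmv by blast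
        then have "\<bar>P n y\<bar> \<le> B'" using BR'(2) by simp
        then show ?thesis using False BR'(1) by (simp add: indicator_def mult_right_mono)
      qed
    qed
    show "AE y in lborel. (\<lambda>n. P n y *\<^sub>R g y) \<longlonglongrightarrow> (- dir_deriv h \<phi> y) *\<^sub>R g y"
    proof (intro AE_I2 tendsto_scaleR tendsto_const)
      fix y
      obtain \<xi> where \<xi>: "\<And>n. 0 < \<xi> n" "\<And>n. \<xi> n < t n" "\<And>n. P n y = - dir_deriv h \<phi> (y - \<xi> n *\<^sub>R h)"
        using Pmv[of _ y] by metis
      have "\<xi> \<longlonglongrightarrow> 0"
        by (rule tendsto_sandwich[OF _ _ tendsto_const t0]) (use \<xi> in \<open>auto intro!: always_eventually less_imp_le\<close>)
      then have "(\<lambda>n. y - \<xi> n *\<^sub>R h) \<longlonglongrightarrow> y - 0 *\<^sub>R h" by (intro tendsto_intros)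
      then have "(\<lambda>n. - dir_deriv h \<phi> (y - \<xi> n *\<^sub>R h)) \<longlonglongrightarrow> - dir_deriv h \<phi> y"
        using dir_deriv_continuous[OF \<phi>, of h]
        by (intro tendsto_minus) (auto simp: continuous_on_eq_continuous_at intro: isCont_tendsto_compose)
      then show "(\<lambda>n. P n y) \<longlonglongrightarrow> - dir_deriv h \<phi> y" using \<xi>(3) by simp
    qed
  qed measurable
  have Qb: "\<bar>Q n y\<bar> \<le> B" for n y
  proof -
    have "norm (Q n y) \<le> (LINT \<sigma>|lborel. B * indicator {0..1} (\<sigma>::real))"
      unfolding Q_def
    proof (rule Bochner_Integration.integral_norm_bound_integral)
      show "integrable lborel (\<lambda>\<sigma>. \<phi> (y - (t n * \<sigma>) *\<^sub>R h) * indicator {0..1} \<sigma>)"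
        by (rule integrableI_bounded_set[where A = "{0..1}" and B = B])
           (use BR in \<open>auto simp: indicator_def emeasure_lborel_Icc_eq\<close>)
      show "integrable lborel (\<lambda>\<sigma>::real. B * indicator {0..1} \<sigma> :: real)"
        by (rule integrableI_bounded_set[where A = "{0..1}" and B = B])
           (use BR in \<open>auto simp: indicator_def emeasure_lborel_Icc_eq\<close>)
    qed (use BR in \<open>auto simp: indicator_def\<close>)
    then show ?thesis by (simp add: measure_lborel_Icc)
  qed
  have 2: "(\<lambda>n. LINT y|lborel. Q n y *\<^sub>R G y) \<longlonglongrightarrow> (LINT y|lborel. \<phi> y *\<^sub>R G y)"
  proof (rule integral_dominated_convergence)
    show "integrable lborel (\<lambda>y. norm (B *\<^sub>R (indicator (cball 0 (R + norm h)) y *\<^sub>R G y)))"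
      by (intro integrable_norm integrable_scaleR_right loc_int_integrable[OF G])
    show "AE y in lborel. norm (Q n y *\<^sub>R G y) \<le> norm (B *\<^sub>R (indicator (cball 0 (R + norm h)) y *\<^sub>R G y))" for n
    proof (intro AE_I2)
      fix y
      show "norm (Q n y *\<^sub>R G y) \<le> norm (B *\<^sub>R (indicator (cball 0 (R + norm h)) y *\<^sub>R G y))"
      proof (cases "R + norm h < norm y")
        case True
        have "\<phi> (y - (t n * \<sigma>) *\<^sub>R h) * indicator {0..1} \<sigma> = 0" for \<sigma>
          using out[OF True, of "t n * \<sigma>"] t[of n] by (auto simp: indicator_def mult_le_one)
        then have "Q n y = 0" unfolding Q_def by (simp only: integral_zero)
        then show ?thesis by simp
      next
        case False
        then show ?thesis using Qb[of n y] BR(1) by (simp add: indicator_def mult_right_mono)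
      qed
    qed
    show "AE y in lborel. (\<lambda>n. Q n y *\<^sub>R G y) \<longlonglongrightarrow> \<phi> y *\<^sub>R G y"
    proof (intro AE_I2 tendsto_scaleR tendsto_const)
      fix y
      have "(\<lambda>n. Q n y) \<longlonglongrightarrow> (LINT \<sigma>|lborel. \<phi> y * indicator {0..1} (\<sigma>::real))"
        unfolding Q_def
      proof (rule integral_dominated_convergence)
        show "integrable lborel (\<lambda>\<sigma>::real. B * indicator {0..1} \<sigma> :: real)"
          by (rule integrableI_bounded_set[where A = "{0..1}" and B = B])
             (use BR in \<open>auto simp: indicator_def emeasure_lborel_Icc_eq\<close>)
        show "AE \<sigma> in lborel. norm (\<phi> (y - (t n * \<sigma>) *\<^sub>R h) * indicator {0..1} \<sigma>) \<le> B * indicator {0..1} \<sigma>" for n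
          using BR(3) by (auto simp: indicator_def)
        show "AE \<sigma> in lborel. (\<lambda>n. \<phi> (y - (t n * \<sigma>) *\<^sub>R h) * indicator {0..1} \<sigma>) \<longlonglongrightarrow> \<phi> y * indicator {0..1} \<sigma>"
        proof (intro AE_I2 tendsto_mult tendsto_const)
          fix \<sigma>
          have "(\<lambda>n. y - (t n * \<sigma>) *\<^sub>R h) \<longlonglongrightarrow> y - (0 * \<sigma>) *\<^sub>R h" by (intro tendsto_intros t0)
          then show "(\<lambda>n. \<phi> (y - (t n * \<sigma>) *\<^sub>R h)) \<longlonglongrightarrow> \<phi> y"
            using test_continuous[OF \<phi>] by (auto simp: continuous_on_eq_continuous_at intro: isCont_tendsto_compose)
        qed
      qed measurable
      then show "(\<lambda>n. Q n y) \<longlonglongrightarrow> \<phi> y" by simp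
    qed
  qed measurable
  have "(LINT y|lborel. (- dir_deriv h \<phi> y) *\<^sub>R g y) = (LINT y|lborel. \<phi> y *\<^sub>R G y)"
    using LIMSEQ_unique[OF 1[unfolded PQ] 2] .
  then show "(LINT x|lborel. dir_deriv h \<phi> x *\<^sub>R g x) = - (LINT x|lborel. \<phi> x *\<^sub>R G x)"
    by (simp add: minus_equation_iff)
qed

section \<open>The product rule\<close>

lemma integrable_times_pair:
  fixes F G :: "real \<Rightarrow> 'b::{real_normed_field,euclidean_space}"
  assumes F: "integrable lborel F" and G: "integrable lborel G"
  shows "integrable (lborel \<Otimes>\<^sub>M lborel) (\<lambda>(\<tau>, \<sigma>). F \<tau> * G \<sigma>)"
proof (rule lborel_pair.Fubini_integrable)
  have [measurable]: "F \<in> borel_measurable borel" "G \<in> borel_measurable borel"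
    using F G borel_measurable_integrable by force+
  show "(\<lambda>(\<tau>, \<sigma>). F \<tau> * G \<sigma>) \<in> borel_measurable (lborel \<Otimes>\<^sub>M lborel)" by measurable
  show "integrable lborel (\<lambda>\<tau>. LINT \<sigma>|lborel. norm (case (\<tau>, \<sigma>) of (\<tau>, \<sigma>) \<Rightarrow> F \<tau> * G \<sigma>))"
    using F by (simp add: norm_mult)
  show "AE \<tau> in lborel. integrable lborel (\<lambda>\<sigma>. case (\<tau>, \<sigma>) of (\<tau>, \<sigma>) \<Rightarrow> F \<tau> * G \<sigma>)"
    using G by simp
qed

text \<open>
  The two iterated integrals cover the parts of the square below and above the diagonal, which
  itself is a null set.
\<close>

lemma integral_by_parts_line:
  fixes F G :: "real \<Rightarrow> 'b::{real_normed_field,euclidean_space}"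
  assumes F: "integrable lborel F" and G: "integrable lborel G"
  defines "IF \<equiv> \<lambda>\<tau>. LINT \<sigma>|lborel. (if \<sigma> \<le> \<tau> then F \<sigma> else 0)"
    and "IG \<equiv> \<lambda>\<tau>. LINT \<sigma>|lborel. (if \<sigma> \<le> \<tau> then G \<sigma> else 0)"
  shows "integrable lborel (\<lambda>\<tau>. F \<tau> * IG \<tau>)" "integrable lborel (\<lambda>\<tau>. IF \<tau> * G \<tau>)"
    "(LINT \<tau>|lborel. F \<tau> * IG \<tau>) + (LINT \<tau>|lborel. IF \<tau> * G \<tau>) = (LINT \<tau>|lborel. F \<tau>) * (LINT \<tau>|lborel. G \<tau>)"
proof -
  have [measurable]: "F \<in> borel_measurable borel" "G \<in> borel_measurable borel"
    using F G borel_measurable_integrable by force+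
  have Fi: "integrable lborel (\<lambda>\<sigma>. if P \<sigma> then F \<sigma> else 0)" if [measurable]: "Measurable.pred borel P" for P
    by (rule Bochner_Integration.integrable_bound[OF F]) auto
  have Gi: "integrable lborel (\<lambda>\<sigma>. if P \<sigma> then G \<sigma> else 0)" if [measurable]: "Measurable.pred borel P" for P
    by (rule Bochner_Integration.integrable_bound[OF G]) auto
  have i1: "integrable (lborel \<Otimes>\<^sub>M lborel) (\<lambda>(\<tau>, \<sigma>). if \<sigma> \<le> \<tau> then F \<tau> * G \<sigma> else 0)"
    by (rule Bochner_Integration.integrable_bound[OF integrable_times_pair[OF F G]]) auto
  have i2: "integrable (lborel \<Otimes>\<^sub>M lborel) (\<lambda>(\<tau>, \<sigma>). if \<tau> \<le> \<sigma> then F \<tau> * G \<sigma> else 0)"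
    by (rule Bochner_Integration.integrable_bound[OF integrable_times_pair[OF F G]]) auto
  have e1: "F \<tau> * IG \<tau> = (LINT \<sigma>|lborel. (if \<sigma> \<le> \<tau> then F \<tau> * G \<sigma> else 0))" for \<tau>
  proof -
    have "F \<tau> * IG \<tau> = (LINT \<sigma>|lborel. F \<tau> * (if \<sigma> \<le> \<tau> then G \<sigma> else 0))"
      unfolding IG_def using Gi by simp
    also have "\<dots> = (LINT \<sigma>|lborel. (if \<sigma> \<le> \<tau> then F \<tau> * G \<sigma> else 0))"
      by (rule Bochner_Integration.integral_cong) auto
    finally show ?thesis .
  qed
  have e2: "IF \<sigma> * G \<sigma> = (LINT \<tau>|lborel. (if \<tau> \<le> \<sigma> then F \<tau> * G \<sigma> else 0))" for \<sigma>
  proof -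
    have "IF \<sigma> * G \<sigma> = (LINT \<tau>|lborel. (if \<tau> \<le> \<sigma> then F \<tau> else 0) * G \<sigma>)"
      unfolding IF_def using Fi by simp
    also have "\<dots> = (LINT \<tau>|lborel. (if \<tau> \<le> \<sigma> then F \<tau> * G \<sigma> else 0))"
      by (rule Bochner_Integration.integral_cong) auto
    finally show ?thesis .
  qed
  show 1: "integrable lborel (\<lambda>\<tau>. F \<tau> * IG \<tau>)"
    unfolding e1 using lborel_pair.integrable_fst[OF i1] .
  show "integrable lborel (\<lambda>\<tau>. IF \<tau> * G \<tau>)"
    unfolding e2 using lborel_pair.integrable_snd[OF i2] .
  have "(LINT \<tau>|lborel. IF \<tau> * G \<tau>) = (LINT \<tau>|lborel. LINT \<sigma>|lborel. (if \<tau> \<le> \<sigma> then F \<tau> * G \<sigma> else 0))"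
    unfolding e2 by (rule lborel_pair.Fubini_integral[OF i2])
  then have "(LINT \<tau>|lborel. F \<tau> * IG \<tau>) + (LINT \<tau>|lborel. IF \<tau> * G \<tau>)
     = (LINT \<tau>|lborel. (LINT \<sigma>|lborel. (if \<sigma> \<le> \<tau> then F \<tau> * G \<sigma> else 0)) + (LINT \<sigma>|lborel. (if \<tau> \<le> \<sigma> then F \<tau> * G \<sigma> else 0)))"
    unfolding e1 using lborel_pair.integrable_fst[OF i1] lborel_pair.integrable_fst[OF i2]
    by (subst Bochner_Integration.integral_add) auto
  also have "\<dots> = (LINT \<tau>|lborel. F \<tau> * (LINT \<sigma>|lborel. G \<sigma>))"
  proof (rule Bochner_Integration.integral_cong[OF refl])
    fix \<tau> :: real
    have m: "integrable lborel (\<lambda>\<sigma>. if P \<sigma> then F \<tau> * G \<sigma> else 0)" if [measurable]: "Measurable.pred borel P" for P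
      by (rule Bochner_Integration.integrable_bound[OF integrable_mult_right[OF G, of "F \<tau>"]]) auto
    have "(LINT \<sigma>|lborel. (if \<sigma> \<le> \<tau> then F \<tau> * G \<sigma> else 0)) + (LINT \<sigma>|lborel. (if \<tau> \<le> \<sigma> then F \<tau> * G \<sigma> else 0))
       = (LINT \<sigma>|lborel. (if \<sigma> \<le> \<tau> then F \<tau> * G \<sigma> else 0) + (if \<tau> \<le> \<sigma> then F \<tau> * G \<sigma> else 0))"
      using m by (subst Bochner_Integration.integral_add) auto
    also have "\<dots> = (LINT \<sigma>|lborel. F \<tau> * G \<sigma>)"
    proof (rule integral_cong_AE)
      have "AE \<sigma> in lborel. \<sigma> \<noteq> \<tau>" by (rule AE_lborel_singleton)
      then show "AE \<sigma> in lborel. (if \<sigma> \<le> \<tau> then F \<tau> * G \<sigma> else 0) + (if \<tau> \<le> \<sigma> then F \<tau> * G \<sigma> else 0) = F \<tau> * G \<sigma>"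
        by eventually_elim auto
    qed measurable
    finally show "(LINT \<sigma>|lborel. (if \<sigma> \<le> \<tau> then F \<tau> * G \<sigma> else 0)) + (LINT \<sigma>|lborel. (if \<tau> \<le> \<sigma> then F \<tau> * G \<sigma> else 0))
      = F \<tau> * (LINT \<sigma>|lborel. G \<sigma>)" using G by simp
  qed
  also have "\<dots> = (LINT \<tau>|lborel. F \<tau>) * (LINT \<tau>|lborel. G \<tau>)" using F by simp
  finally show "(LINT \<tau>|lborel. F \<tau> * IG \<tau>) + (LINT \<tau>|lborel. IF \<tau> * G \<tau>) = (LINT \<tau>|lborel. F \<tau>) * (LINT \<tau>|lborel. G \<tau>)" .
qed

lemma increment_product:
  fixes F G :: "real \<Rightarrow> 'b::{real_normed_field,euclidean_space}" and f0 g0 :: 'b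
  assumes t: "t \<ge> 0"
    and F: "integrable lborel (\<lambda>\<tau>. indicator {0..t} \<tau> *\<^sub>R F \<tau>)"
    and G: "integrable lborel (\<lambda>\<tau>. indicator {0..t} \<tau> *\<^sub>R G \<tau>)"
  defines "f \<equiv> \<lambda>\<tau>. f0 + (LINT \<sigma>|lborel. indicator {0..\<tau>} \<sigma> *\<^sub>R F \<sigma>)"
    and "g \<equiv> \<lambda>\<tau>. g0 + (LINT \<sigma>|lborel. indicator {0..\<tau>} \<sigma> *\<^sub>R G \<sigma>)"
  shows "f t * g t - f0 * g0 = (LINT \<tau>|lborel. indicator {0..t} \<tau> *\<^sub>R (F \<tau> * g \<tau> + f \<tau> * G \<tau>))"
proof -
  define F' where "F' = (\<lambda>\<tau>. indicator {0..t} \<tau> *\<^sub>R F \<tau>)"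
  define G' where "G' = (\<lambda>\<tau>. indicator {0..t} \<tau> *\<^sub>R G \<tau>)"
  define IF where "IF = (\<lambda>\<tau>. LINT \<sigma>|lborel. (if \<sigma> \<le> \<tau> then F' \<sigma> else 0))"
  define IG where "IG = (\<lambda>\<tau>. LINT \<sigma>|lborel. (if \<sigma> \<le> \<tau> then G' \<sigma> else 0))"
  have fF: "f \<tau> = f0 + IF \<tau>" and gG: "g \<tau> = g0 + IG \<tau>" if "\<tau> \<in> {0..t}" for \<tau>
    using that unfolding f_def g_def IF_def IG_def F'_def G'_def
    by (auto intro!: Bochner_Integration.integral_cong simp: indicator_def)
  have F'i: "integrable lborel F'" and G'i: "integrable lborel G'" using F G by (auto simp: F'_def G'_def)
  have bp: "integrable lborel (\<lambda>\<tau>. F' \<tau> * IG \<tau>)" "integrable lborel (\<lambda>\<tau>. IF \<tau> * G' \<tau>)"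
    "(LINT \<tau>|lborel. F' \<tau> * IG \<tau>) + (LINT \<tau>|lborel. IF \<tau> * G' \<tau>) = (LINT \<tau>|lborel. F' \<tau>) * (LINT \<tau>|lborel. G' \<tau>)"
    unfolding IF_def IG_def by (rule integral_by_parts_line[OF F'i G'i])+
  have ft: "f t = f0 + (LINT \<tau>|lborel. F' \<tau>)" "g t = g0 + (LINT \<tau>|lborel. G' \<tau>)"
    by (auto simp: f_def g_def F'_def G'_def)
  have "(LINT \<tau>|lborel. indicator {0..t} \<tau> *\<^sub>R (F \<tau> * g \<tau> + f \<tau> * G \<tau>))
     = (LINT \<tau>|lborel. (F' \<tau> * g0 + F' \<tau> * IG \<tau>) + (f0 * G' \<tau> + IF \<tau> * G' \<tau>))"
  proof (rule Bochner_Integration.integral_cong[OF refl])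
    fix \<tau> :: real
    show "indicator {0..t} \<tau> *\<^sub>R (F \<tau> * g \<tau> + f \<tau> * G \<tau>) = (F' \<tau> * g0 + F' \<tau> * IG \<tau>) + (f0 * G' \<tau> + IF \<tau> * G' \<tau>)"
    proof (cases "\<tau> \<in> {0..t}")
      case True
      then show ?thesis using fF[OF True] gG[OF True] by (simp add: F'_def G'_def algebra_simps)
    qed (simp add: F'_def G'_def)
  qed
  also have "\<dots> = ((LINT \<tau>|lborel. F' \<tau>) * g0 + (LINT \<tau>|lborel. F' \<tau> * IG \<tau>)) + (f0 * (LINT \<tau>|lborel. G' \<tau>) + (LINT \<tau>|lborel. IF \<tau> * G' \<tau>))"
    using F'i G'i bp(1,2) by simp
  also have "\<dots> = f t * g t - f0 * g0"
    using bp(3) unfolding ft by (simp add: algebra_simps)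
  finally show ?thesis by simp
qed

lemma primitive_measurable:
  fixes F :: "real^'n::finite \<Rightarrow> 'b::euclidean_space"
  assumes [measurable]: "F \<in> borel_measurable borel"
  shows "(\<lambda>p. LINT \<sigma>|lborel. indicator {0..snd p} \<sigma> *\<^sub>R F (fst p + \<sigma> *\<^sub>R h)) \<in> borel_measurable (lborel \<Otimes>\<^sub>M lborel)"
proof -
  have "(\<lambda>p. LINT \<sigma>|lborel. (if 0 \<le> \<sigma> \<and> \<sigma> \<le> snd p then 1 else 0) *\<^sub>R F (fst p + \<sigma> *\<^sub>R h)) \<in> borel_measurable (lborel \<Otimes>\<^sub>M lborel)"
    by measurable
  then show ?thesis by (simp add: indicator_def of_bool_def)
qed

lemma AE_line_integrable:
  fixes F :: "real^'n::finite \<Rightarrow> 'b::euclidean_space"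
  assumes F: "loc_int F"
  shows "AE x in lborel. integrable lborel (\<lambda>\<tau>. indicator {0..t} \<tau> *\<^sub>R F (x + \<tau> *\<^sub>R h))"
proof -
  have "AE x in lborel. integrable lborel (\<lambda>\<tau>. (indicator (cball 0 (real k)) x * indicator {0..t} \<tau>) *\<^sub>R F (x + \<tau> *\<^sub>R h))" for k
  proof (rule lborel_pair.AE_integrable_fst)
    have [measurable]: "cball (0::real^'n) r \<in> sets borel" for r by simp
    show "integrable (lborel \<Otimes>\<^sub>M lborel) (\<lambda>(x, \<tau>). (indicator (cball 0 (real k)) x * indicator {0..t} \<tau>) *\<^sub>R F (x + \<tau> *\<^sub>R h))"
    proof (rule line_average_integrable(1)[OF F, where B = 1 and R = "real k"])
      show "indicator (cball 0 (real k)) \<in> borel_measurable (borel :: (real^'n) measure)" by measurable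
    qed (auto simp: indicator_def)
  qed
  then have "AE x in lborel. \<forall>k. integrable lborel (\<lambda>\<tau>. (indicator (cball 0 (real k)) x * indicator {0..t} \<tau>) *\<^sub>R F (x + \<tau> *\<^sub>R h))"
    by (simp add: AE_all_countable)
  then show ?thesis
  proof eventually_elim
    case (elim x)
    obtain k :: nat where "norm x \<le> real k" using real_arch_simple by blast
    then show ?case using elim[rule_format, of k] by (simp add: indicator_def)
  qed
qed

text \<open>
  Fubini's theorem exchanges the quantifiers over points and times, so that on almost every line the
  function agrees almost everywhere with a primitive.
\<close>

lemma line_increment_AE_line:
  fixes f F :: "real^'n::finite \<Rightarrow> 'b::euclidean_space"
  assumes f: "loc_int f" and F: "loc_int F" and inc: "line_increment h f F"
  shows "AE x in lborel. AE \<tau> in lborel. 0 \<le> \<tau> \<longrightarrow>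
           f (x + \<tau> *\<^sub>R h) = f x + (LINT \<sigma>|lborel. indicator {0..\<tau>} \<sigma> *\<^sub>R F (x + \<sigma> *\<^sub>R h))"
proof -
  have [measurable]: "f \<in> borel_measurable borel" "F \<in> borel_measurable borel"
    by (rule loc_int_measurable[OF f] loc_int_measurable[OF F])+
  note primitive_measurable[measurable]
  have "AE \<tau> in lborel. AE x in lborel. 0 \<le> \<tau> \<longrightarrow>
           f (x + \<tau> *\<^sub>R h) = f x + (LINT \<sigma>|lborel. indicator {0..\<tau>} \<sigma> *\<^sub>R F (x + \<sigma> *\<^sub>R h))"
  proof (rule AE_I2)
    fix \<tau> :: real
    show "AE x in lborel. 0 \<le> \<tau> \<longrightarrow>
           f (x + \<tau> *\<^sub>R h) = f x + (LINT \<sigma>|lborel. indicator {0..\<tau>} \<sigma> *\<^sub>R F (x + \<sigma> *\<^sub>R h))"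
    proof (cases "0 \<le> \<tau>")
      case True
      with inc have "AE x in lborel. f (x + \<tau> *\<^sub>R h) - f x = (LINT \<sigma>|lborel. indicator {0..\<tau>} \<sigma> *\<^sub>R F (x + \<sigma> *\<^sub>R h))"
        by (simp add: line_increment_def)
      then show ?thesis by eventually_elim (simp add: diff_eq_eq add.commute)
    qed simp
  qed
  moreover have "{p \<in> space (lborel \<Otimes>\<^sub>M lborel). 0 \<le> snd p \<longrightarrow>
      f (fst p + snd p *\<^sub>R h) = f (fst p) + (LINT \<sigma>|lborel. indicator {0..snd p} \<sigma> *\<^sub>R F (fst p + \<sigma> *\<^sub>R h))}
      \<in> sets (lborel \<Otimes>\<^sub>M lborel)"
    by measurable
  ultimately show ?thesis by (subst lborel_pair.AE_commute)
qed

text \<open>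
  On almost every line \<open>f\<close> and \<open>g\<close> are almost everywhere equal to primitives, and at both ends of the segment
  the values agree as well; there the product rule is integration by parts.
\<close>

lemma line_increment_product:
  fixes f g F G :: "real^'n::finite \<Rightarrow> 'b::{real_normed_field,euclidean_space}"
  assumes f: "loc_int f" "loc_int F" "line_increment h f F"
    and g: "loc_int g" "loc_int G" "line_increment h g G"
  shows "line_increment h (\<lambda>x. f x * g x) (\<lambda>x. F x * g x + f x * G x)"
  unfolding line_increment_def
proof (intro allI impI)
  fix t :: real assume t: "t \<ge> 0"
  have [measurable]: "f \<in> borel_measurable borel" "F \<in> borel_measurable borel" "g \<in> borel_measurable borel" "G \<in> borel_measurable borel"
    by (rule loc_int_measurable f g)+
  have 1: "AE x in lborel. f (x + t *\<^sub>R h) - f x = (LINT \<sigma>|lborel. indicator {0..t} \<sigma> *\<^sub>R F (x + \<sigma> *\<^sub>R h))"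
    using f(3) t by (simp add: line_increment_def)
  have 2: "AE x in lborel. g (x + t *\<^sub>R h) - g x = (LINT \<sigma>|lborel. indicator {0..t} \<sigma> *\<^sub>R G (x + \<sigma> *\<^sub>R h))"
    using g(3) t by (simp add: line_increment_def)
  show "AE x in lborel. f (x + t *\<^sub>R h) * g (x + t *\<^sub>R h) - f x * g x =
      (LINT \<tau>|lborel. indicator {0..t} \<tau> *\<^sub>R (F (x + \<tau> *\<^sub>R h) * g (x + \<tau> *\<^sub>R h) + f (x + \<tau> *\<^sub>R h) * G (x + \<tau> *\<^sub>R h)))"
    using line_increment_AE_line[OF f] line_increment_AE_line[OF g] 1 2
      AE_line_integrable[OF f(2), of t h] AE_line_integrable[OF g(2), of t h]
  proof eventually_elim
    case (elim x)
    define ff where "ff = (\<lambda>\<tau>. f x + (LINT \<sigma>|lborel. indicator {0..\<tau>} \<sigma> *\<^sub>R F (x + \<sigma> *\<^sub>R h)))"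
    define gg where "gg = (\<lambda>\<tau>. g x + (LINT \<sigma>|lborel. indicator {0..\<tau>} \<sigma> *\<^sub>R G (x + \<sigma> *\<^sub>R h)))"
    have "(\<lambda>\<tau>. LINT \<sigma>|lborel. indicator {0..snd (x, \<tau>)} \<sigma> *\<^sub>R F (fst (x, \<tau>) + \<sigma> *\<^sub>R h)) \<in> borel_measurable lborel"
      by (rule measurable_compose[OF measurable_Pair1' primitive_measurable]) auto
    then have [measurable]: "ff \<in> borel_measurable borel" by (simp add: ff_def)
    have "(\<lambda>\<tau>. LINT \<sigma>|lborel. indicator {0..snd (x, \<tau>)} \<sigma> *\<^sub>R G (fst (x, \<tau>) + \<sigma> *\<^sub>R h)) \<in> borel_measurable lborel"
      by (rule measurable_compose[OF measurable_Pair1' primitive_measurable]) auto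
    then have [measurable]: "gg \<in> borel_measurable borel" by (simp add: gg_def)
    have "f (x + t *\<^sub>R h) * g (x + t *\<^sub>R h) - f x * g x = ff t * gg t - f x * g x"
      using elim(3,4) by (simp add: ff_def gg_def diff_eq_eq add.commute)
    also have "\<dots> = (LINT \<tau>|lborel. indicator {0..t} \<tau> *\<^sub>R (F (x + \<tau> *\<^sub>R h) * gg \<tau> + ff \<tau> * G (x + \<tau> *\<^sub>R h)))"
      unfolding ff_def gg_def by (rule increment_product[OF t elim(5,6)])
    also have "\<dots> = (LINT \<tau>|lborel. indicator {0..t} \<tau> *\<^sub>R (F (x + \<tau> *\<^sub>R h) * g (x + \<tau> *\<^sub>R h) + f (x + \<tau> *\<^sub>R h) * G (x + \<tau> *\<^sub>R h)))"
    proof (rule integral_cong_AE)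
      show "AE \<tau> in lborel. indicator {0..t} \<tau> *\<^sub>R (F (x + \<tau> *\<^sub>R h) * gg \<tau> + ff \<tau> * G (x + \<tau> *\<^sub>R h)) =
        indicator {0..t} \<tau> *\<^sub>R (F (x + \<tau> *\<^sub>R h) * g (x + \<tau> *\<^sub>R h) + f (x + \<tau> *\<^sub>R h) * G (x + \<tau> *\<^sub>R h))"
        using elim(1,2) by eventually_elim (auto simp: ff_def gg_def indicator_def)
    qed measurable
    finally show ?case .
  qed
qed

lemma dir_deriv_axis: "dir_deriv (axis i 1) \<phi> = partial i \<phi>"
  by (rule ext) (simp add: dir_deriv_def sum_axis)

lemma has_weak_deriv_unit_iff:
  fixes u w :: "real^'n::finite \<Rightarrow> 'b::{real_normed_field,euclidean_space}"
  assumes u: "u' \<in> borel_measurable borel" "AE x in lborel. u x = u' x"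
    and w: "w' \<in> borel_measurable borel" "AE x in lborel. w x = w' x"
  shows "has_weak_deriv (unit_index i) u w \<longleftrightarrow> loc_int u' \<and> loc_int w' \<and> weak_dir (axis i 1) u' w'"
  unfolding has_weak_deriv_borel_iff[OF u w] weak_dir_def
  by (auto simp: mi_order_unit dir_deriv_axis mi_partial_unit test_smooth)

lemma has_weak_deriv_unit_obtain:
  fixes u w :: "real^'n::finite \<Rightarrow> 'b::{real_normed_field,euclidean_space}"
  assumes "has_weak_deriv (unit_index i) u w"
  obtains u' w' where "loc_int u'" "loc_int w'" "AE x in lborel. u x = u' x" "AE x in lborel. w x = w' x"
    "weak_dir (axis i 1) u' w'"
proof -
  obtain u' w' where *: "loc_int u'" "loc_int w'" "AE x in lborel. u x = u' x" "AE x in lborel. w x = w' x"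
    using has_weak_deriv_borel_obtain[OF assms] by metis
  then have "weak_dir (axis i 1) u' w'"
    using has_weak_deriv_unit_iff[OF loc_int_measurable[OF *(1)] *(3) loc_int_measurable[OF *(2)] *(4), of i] assms by simp
  then show ?thesis using that * by blast
qed

text \<open>
  By increments along lines. An approximation of one factor by smooth functions would ask for dual
  exponents; here the products only have to be locally integrable.
\<close>

lemma has_weak_deriv_product:
  fixes f g f1 g1 :: "real^'n::finite \<Rightarrow> 'b::{real_normed_field,euclidean_space}"
  assumes f: "has_weak_deriv (unit_index i) f f1" and g: "has_weak_deriv (unit_index i) g g1"
    and fg: "locally_integrable (\<lambda>x. f x * g x)" and f1g: "locally_integrable (\<lambda>x. f1 x * g x)"
    and fg1: "locally_integrable (\<lambda>x. f x * g1 x)"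
  shows "has_weak_deriv (unit_index i) (\<lambda>x. f x * g x) (\<lambda>x. f1 x * g x + f x * g1 x)"
proof -
  obtain f' f1' where f': "loc_int f'" "loc_int f1'" "AE x in lborel. f x = f' x" "AE x in lborel. f1 x = f1' x"
    "weak_dir (axis i 1) f' f1'" using has_weak_deriv_unit_obtain[OF f] by metis
  obtain g' g1' where g': "loc_int g'" "loc_int g1'" "AE x in lborel. g x = g' x" "AE x in lborel. g1 x = g1' x"
    "weak_dir (axis i 1) g' g1'" using has_weak_deriv_unit_obtain[OF g] by metis
  have [measurable]: "f' \<in> borel_measurable borel" "f1' \<in> borel_measurable borel" "g' \<in> borel_measurable borel" "g1' \<in> borel_measurable borel"
    by (rule loc_int_measurable f' g')+
  have ae: "AE x in lborel. f x * g x = f' x * g' x" "AE x in lborel. f1 x * g x = f1' x * g' x"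
      "AE x in lborel. f x * g1 x = f' x * g1' x"
      "AE x in lborel. f1 x * g x + f x * g1 x = f1' x * g' x + f' x * g1' x"
    using f'(3,4) g'(3,4) by (eventually_elim, simp)+
  have l1: "loc_int (\<lambda>x. f' x * g' x)" using locally_integrable_iff[OF _ ae(1)] fg by simp
  have l2: "loc_int (\<lambda>x. f1' x * g' x)" using locally_integrable_iff[OF _ ae(2)] f1g by simp
  have l3: "loc_int (\<lambda>x. f' x * g1' x)" using locally_integrable_iff[OF _ ae(3)] fg1 by simp
  have "line_increment (axis i 1) (\<lambda>x. f' x * g' x) (\<lambda>x. f1' x * g' x + f' x * g1' x)"
    by (intro line_increment_product weak_dir_line_increment f' g')
  then have "weak_dir (axis i 1) (\<lambda>x. f' x * g' x) (\<lambda>x. f1' x * g' x + f' x * g1' x)"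
    by (intro line_increment_weak_dir l1 loc_int_add l2 l3)
  then show ?thesis
    using has_weak_deriv_unit_iff[OF _ ae(1) _ ae(4), of i] l1 loc_int_add[OF l2 l3] by simp
qed

section \<open>From estimates between level sets to integrability\<close>

lemma Chebyshev_powr:
  assumes "a > 0" and [measurable]: "f \<in> borel_measurable lborel" and f: "\<And>x::real^'n::finite. f x \<ge> (0::real)"
    and p: "p > 0" and i: "(\<integral>\<^sup>+x. ennreal (f x powr p) \<partial>lborel) \<le> ennreal X" and X: "X \<ge> 0"
  shows "emeasure lborel {x. a < f x} < \<infinity>" "a powr p * measure lborel {x. a < f x} \<le> X"
proof -
  have "ennreal (a powr p) * emeasure lborel {x. a < f x} = (\<integral>\<^sup>+x. ennreal (a powr p) * indicator {x. a < f x} x \<partial>lborel)"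
    by (subst nn_integral_cmult_indicator) auto
  also have "\<dots> \<le> (\<integral>\<^sup>+x. ennreal (f x powr p) \<partial>lborel)"
    using assms(1) p by (intro nn_integral_mono) (auto simp: indicator_def intro!: ennreal_leI powr_mono2)
  finally have *: "ennreal (a powr p) * emeasure lborel {x. a < f x} \<le> ennreal X" using i by (rule order_trans)
  then show fin: "emeasure lborel {x. a < f x} < \<infinity>"
    using assms(1) by (auto simp: ennreal_mult_eq_top_iff top.not_eq_extremum dest: ennreal_mult_less_top[THEN iffD1, OF le_less_trans])
  then have "emeasure lborel {x. a < f x} = ennreal (measure lborel {x. a < f x})"
    by (simp add: emeasure_eq_ennreal_measure)
  with * show "a powr p * measure lborel {x. a < f x} \<le> X"
    using X by (simp add: ennreal_mult[symmetric])
qed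

text \<open>
  The common property of functions of order \<open>\<theta>\<close>, fractional or one: at distance less than \<open>r\<close> the function
  climbs from below \<open>a\<close> to above \<open>b\<close> only on a set of pairs whose measure is controlled by the energy \<open>D a b\<close>
  that it spends between these two levels.
\<close>

definition climbing_bound :: "real \<Rightarrow> real \<Rightarrow> (real \<Rightarrow> real \<Rightarrow> real) \<Rightarrow> (real^'n::finite \<Rightarrow> real) \<Rightarrow> bool" where
  "climbing_bound \<theta> p D f \<longleftrightarrow> (\<forall>a b r. 0 < a \<longrightarrow> a < b \<longrightarrow> 0 < r \<longrightarrow>
     ennreal ((b - a) powr p) *
       (\<integral>\<^sup>+x. indicator {x. b < f x} x * emeasure lborel (ball x r \<inter> {y. f y \<le> a}) \<partial>lborel)
     \<le> ennreal (r powr (real CARD('n) + \<theta> * p) * D a b))"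

text \<open>
  A ball of twice the measure of \<open>{f > a}\<close> meets \<open>{f \<le> a}\<close> in at least half of its measure, so each point of
  \<open>{f > b}\<close> is the end of many climbs.
\<close>

lemma level_decay:
  fixes f :: "real^'n::finite \<Rightarrow> real"
  defines "\<omega> \<equiv> measure lborel (ball (0::real^'n) 1)"
  defines "n \<equiv> real CARD('n)"
  assumes cb: "climbing_bound \<theta> p D f" and [measurable]: "f \<in> borel_measurable borel"
    and D: "D a b \<ge> 0" and ab: "0 < a" "a < b"
    and fin: "emeasure lborel {x. a < f x} < \<infinity>"
  shows "(b - a) powr p * measure lborel {x. b < f x}
     \<le> (2 / \<omega>) powr (1 + \<theta> * p / n) * measure lborel {x. a < f x} powr (\<theta> * p / n) * D a b"
proof -
  define \<alpha> where "\<alpha> = measure lborel {x. a < f x}"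
  define \<beta> where "\<beta> = measure lborel {x. b < f x}"
  have n: "n > 0" by (simp add: n_def)
  have w: "\<omega> > 0" unfolding \<omega>_def by (rule content_ball_pos) simp
  have ea: "emeasure lborel {x. a < f x} = ennreal \<alpha>"
    unfolding \<alpha>_def using fin by (simp add: emeasure_eq_ennreal_measure)
  have sub: "{x. b < f x} \<subseteq> {x. a < f x}" using ab by auto
  have "emeasure lborel {x. b < f x} \<le> emeasure lborel {x. a < f x}"
    by (rule emeasure_mono[OF sub]) simp
  then have "emeasure lborel {x. b < f x} < \<infinity>" using fin by (rule le_less_trans)
  then have eb: "emeasure lborel {x. b < f x} = ennreal \<beta>"
    unfolding \<beta>_def by (simp add: emeasure_eq_ennreal_measure)
  have b0: "\<beta> \<ge> 0" and a0: "\<alpha> \<ge> 0" by (auto simp: \<beta>_def \<alpha>_def)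
  have ba: "\<beta> \<le> \<alpha>"
    using \<open>emeasure lborel {x. b < f x} \<le> emeasure lborel {x. a < f x}\<close> a0 by (simp add: ea eb)
  show ?thesis
  proof (cases "\<alpha> = 0")
    case True
    then have "\<beta> = 0" using ba b0 by simp
    then show ?thesis using D by (simp add: \<beta>_def)
  next
    case False
    then have ap: "\<alpha> > 0" using a0 by simp
    \<comment> \<open>the radius for which the ball has measure \<open>2 \<alpha>\<close>\<close>
    define r where "r = (2 * \<alpha> / \<omega>) powr (1 / n)"
    have r: "r > 0" using ap w by (simp add: r_def)
    have rn: "r powr n = 2 * \<alpha> / \<omega>" using ap w n by (simp add: r_def powr_powr)
    have ball: "emeasure lborel (ball x r) = ennreal (2 * \<alpha>)" for x :: "real^'n"
    proof -
      have "measure lborel (ball x r) = r ^ CARD('n) * \<omega>"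
        using content_ball_conv_unit_ball[of r x] r by (simp add: \<omega>_def)
      also have "r ^ CARD('n) = r powr n" using r by (simp add: n_def powr_realpow)
      finally have "measure lborel (ball x r) = 2 * \<alpha>" using rn w by simp
      moreover have "emeasure lborel (ball x r) < \<infinity>" by (rule emeasure_bounded_finite) simp
      ultimately show ?thesis by (simp add: emeasure_eq_ennreal_measure)
    qed
    have low: "ennreal \<alpha> \<le> emeasure lborel (ball x r \<inter> {y. f y \<le> a})" for x
    proof -
      have "ennreal (2 * \<alpha>) \<le> emeasure lborel ((ball x r \<inter> {y. f y \<le> a}) \<union> {y. a < f y})"
        unfolding ball[of x, symmetric] by (rule emeasure_mono) auto
      also have "\<dots> \<le> emeasure lborel (ball x r \<inter> {y. f y \<le> a}) + emeasure lborel {y. a < f y}"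
        by (rule emeasure_subadditive) auto
      finally have "ennreal \<alpha> + ennreal \<alpha> \<le> ennreal \<alpha> + emeasure lborel (ball x r \<inter> {y. f y \<le> a})"
        using a0 by (simp add: ea ennreal_plus[symmetric] add.commute del: ennreal_plus)
      then show ?thesis by (simp add: ennreal_add_left_cancel_le)
    qed
    have "ennreal ((b - a) powr p) * (ennreal \<alpha> * ennreal \<beta>)
       = ennreal ((b - a) powr p) * (\<integral>\<^sup>+x. ennreal \<alpha> * indicator {x. b < f x} x \<partial>lborel)"
      by (subst nn_integral_cmult_indicator) (auto simp: eb)
    also have "\<dots> \<le> ennreal ((b - a) powr p) * (\<integral>\<^sup>+x. indicator {x. b < f x} x * emeasure lborel (ball x r \<inter> {y. f y \<le> a}) \<partial>lborel)"
      using low by (intro mult_left_mono nn_integral_mono) (auto simp: indicator_def)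
    also have "\<dots> \<le> ennreal (r powr (n + \<theta> * p) * D a b)"
      using cb ab r unfolding climbing_bound_def n_def by blast
    finally have "ennreal ((b - a) powr p * (\<alpha> * \<beta>)) \<le> ennreal (r powr (n + \<theta> * p) * D a b)"
      using a0 b0 by (simp add: ennreal_mult)
    then have main: "(b - a) powr p * (\<alpha> * \<beta>) \<le> r powr (n + \<theta> * p) * D a b"
      using D r by simp
    have "r powr (n + \<theta> * p) = (2 * \<alpha> / \<omega>) powr (1 + \<theta> * p / n)"
      using n by (simp add: r_def powr_powr add_divide_distrib)
    also have "\<dots> = (2 / \<omega>) powr (1 + \<theta> * p / n) * \<alpha> powr (1 + \<theta> * p / n)"
      using ap w by (subst powr_mult[symmetric]) (auto simp: field_simps)
    also have "\<alpha> powr (1 + \<theta> * p / n) = \<alpha> * \<alpha> powr (\<theta> * p / n)" using ap by (simp add: powr_add)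
    finally have "\<alpha> * ((b - a) powr p * \<beta>) \<le> \<alpha> * ((2 / \<omega>) powr (1 + \<theta> * p / n) * \<alpha> powr (\<theta> * p / n) * D a b)"
      using main by (simp add: mult_ac)
    then show ?thesis using ap by (simp add: \<alpha>_def[symmetric] \<beta>_def[symmetric])
  qed
qed

text \<open>
  The levels are dyadic. Writing \<open>N\<close> for the integral of \<open>f\<^sup>q\<close>, Chebyshev's inequality bounds
  the measure of \<open>{f > 2\<^sup>k}\<close> by \<open>2\<^sup>-\<^sup>k\<^sup>q N\<close>; inserted into the decay of level sets, this
  gives \<open>N \<le> A + B N\<^sup>\<kappa>\<close> with \<open>\<kappa> < 1\<close>, hence a bound for \<open>N\<close>. Truncation at the height \<open>2\<^sup>K\<close>
  makes \<open>N\<close> finite beforehand. The exponent \<open>\<kappa> = 1 - p / q\<close> may be critical.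
\<close>

lemma climbing_bound_Lq_truncated:
  fixes f :: "real^'n::finite \<Rightarrow> real" and \<theta> p q :: real
  defines "\<omega> \<equiv> measure lborel (ball (0::real^'n) 1)"
  defines "n \<equiv> real CARD('n)"
  defines "C \<equiv> (2 / \<omega>) powr (1 + \<theta> * p / n)"
  assumes p: "p \<ge> 1" and q: "q \<ge> p" and crit: "1 / q \<ge> 1 / p - \<theta> / n"
    and cb: "climbing_bound \<theta> p D f" and fm[measurable]: "f \<in> borel_measurable borel" and f0: "\<And>x. f x \<ge> 0"
    and i: "(\<integral>\<^sup>+x. ennreal (f x powr p) \<partial>lborel) \<le> 1"
    and D: "\<And>a b. D a b \<ge> 0" and sD: "\<And>K. (\<Sum>k<K. D (2 ^ k) (2 ^ Suc k)) \<le> 1"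
  shows "(\<integral>\<^sup>+x. ennreal (min (f x) (2 ^ K) powr q) \<partial>lborel) \<le> ennreal (max 1 ((2 powr q + 4 powr q * C) powr (q / p)))"
proof -
  define \<kappa> where "\<kappa> = 1 - p / q"
  have n: "n > 0" by (simp add: n_def)
  have q0: "q > 0" "p > 0" using p q by auto
  have k0: "0 \<le> \<kappa>" "\<kappa> < 1" using q0 q by (auto simp: \<kappa>_def)
  have kk: "\<kappa> \<le> \<theta> * p / n"
  proof -
    have "p * (1 / p - \<theta> / n) \<le> p * (1 / q)" using crit q0 by (intro mult_left_mono) auto
    then show ?thesis using q0 by (simp add: \<kappa>_def algebra_simps)
  qed
  have qk: "q * \<kappa> = q - p" using q0 by (simp add: \<kappa>_def algebra_simps)
  have w: "\<omega> > 0" unfolding \<omega>_def by (rule content_ball_pos) simp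
  have C0: "C \<ge> 0" by (simp add: C_def)
  define g where "g = (\<lambda>x. min (f x) (2 ^ K))"
  have gm[measurable]: "g \<in> borel_measurable borel" unfolding g_def by measurable
  have g0: "g x \<ge> 0" for x using f0 by (simp add: g_def)
  define I where "I = (\<integral>\<^sup>+x. ennreal (g x powr q) \<partial>lborel)"
  have "I \<le> (\<integral>\<^sup>+x. ennreal ((2 ^ K) powr (q - p)) * ennreal (f x powr p) \<partial>lborel)"
    unfolding I_def
  proof (intro nn_integral_mono)
    fix x
    have "g x powr q = g x powr (q - p) * g x powr p" by (simp flip: powr_add)
    also have "\<dots> \<le> (2 ^ K) powr (q - p) * f x powr p"
      using g0[of x] q q0 f0[of x] by (intro mult_mono powr_mono2) (auto simp: g_def)
    finally show "ennreal (g x powr q) \<le> ennreal ((2 ^ K) powr (q - p)) * ennreal (f x powr p)"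
      by (simp add: ennreal_mult[symmetric] ennreal_leI)
  qed
  also have "\<dots> = ennreal ((2 ^ K) powr (q - p)) * (\<integral>\<^sup>+x. ennreal (f x powr p) \<partial>lborel)"
    by (rule nn_integral_cmult) measurable
  also have "\<dots> \<le> ennreal ((2 ^ K) powr (q - p)) * 1" by (intro mult_left_mono i) auto
  also have "\<dots> < \<infinity>" by simp
  finally have Ifin: "I < \<infinity>" .
  define X where "X = enn2real I"
  have IX: "I = ennreal X" and X0: "X \<ge> 0" using Ifin by (auto simp: X_def)
  define a where "a = (\<lambda>k::nat. measure lborel {x. 2 ^ k < f x})"
  have afin: "emeasure lborel {x. 2 ^ k < f x} < \<infinity>" and ap: "(2 ^ k) powr p * a k \<le> 1" for k :: nat
    using Chebyshev_powr[of "2 ^ k" f p 1] f0 q0 i by (auto simp: a_def)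
  have a0: "a k \<ge> 0" for k by (simp add: a_def)
  have a1: "a k \<le> 1" for k
  proof -
    have "1 * a k \<le> (2 ^ k) powr p * a k"
      using q0 by (intro mult_right_mono a0) (auto intro!: ge_one_powr_ge_zero)
    then show ?thesis using ap[of k] by simp
  qed
  have aq: "(2 ^ k) powr q * a k \<le> X" if "k < K" for k :: nat
  proof -
    have "{x. 2 ^ k < f x} = {x. 2 ^ k < g x}" using that by (auto simp: g_def)
    moreover have "(2 ^ k) powr q * measure lborel {x. 2 ^ k < g x} \<le> X"
      by (rule Chebyshev_powr(2)) (use g0 q0 X0 IX in \<open>auto simp: I_def\<close>)
    ultimately show ?thesis by (simp add: a_def)
  qed
  have step: "(2 ^ k) powr q * a (Suc k) \<le> C * X powr \<kappa> * D (2 ^ k) (2 ^ Suc k)" if k: "k < K" for k :: nat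
  proof -
    define s :: real where "s = 2 ^ k"
    have s: "s > 0" by (simp add: s_def)
    have "s powr p * a (Suc k) = (2 ^ Suc k - 2 ^ k) powr p * a (Suc k)" by (simp add: s_def)
    also have "\<dots> \<le> C * a k powr (\<theta> * p / n) * D (2 ^ k) (2 ^ Suc k)"
      unfolding a_def C_def n_def \<omega>_def
      by (rule level_decay[OF cb fm D]) (use afin in auto)
    also have "\<dots> \<le> C * a k powr \<kappa> * D (2 ^ k) (2 ^ Suc k)"
      by (intro mult_right_mono mult_left_mono powr_mono' kk a0 a1 C0 D)
    also have "\<dots> \<le> C * (X / s powr q) powr \<kappa> * D (2 ^ k) (2 ^ Suc k)"
      using aq[OF k] a0[of k] k0 s
      by (intro mult_right_mono mult_left_mono powr_mono2 C0 D) (auto simp: field_simps s_def)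
    also have "(X / s powr q) powr \<kappa> = X powr \<kappa> / s powr (q - p)"
      using X0 s by (simp add: powr_divide powr_powr qk)
    finally have *: "s powr p * a (Suc k) \<le> C * (X powr \<kappa> / s powr (q - p)) * D (2 ^ k) (2 ^ Suc k)" .
    have "s powr q * a (Suc k) = s powr (q - p) * (s powr p * a (Suc k))"
      by (simp add: mult.assoc[symmetric] flip: powr_add)
    also have "\<dots> \<le> s powr (q - p) * (C * (X powr \<kappa> / s powr (q - p)) * D (2 ^ k) (2 ^ Suc k))"
      by (intro mult_left_mono *) auto
    also have "\<dots> = C * X powr \<kappa> * D (2 ^ k) (2 ^ Suc k)" using s by simp
    finally show ?thesis by (simp add: s_def)
  qed
  have pw: "g x powr q \<le> 2 powr q * f x powr p + (\<Sum>k<K. 4 powr q * (2 ^ k) powr q * indicator {x. 2 ^ Suc k < f x} x)" for x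
  proof (cases "g x \<le> 2")
    case True
    have "g x powr q = g x powr (q - p) * g x powr p" by (simp flip: powr_add)
    also have "\<dots> \<le> 2 powr (q - p) * f x powr p"
      using g0[of x] q q0 f0[of x] True by (intro mult_mono powr_mono2) (auto simp: g_def)
    also have "\<dots> \<le> 2 powr q * f x powr p" using q0 by (intro mult_right_mono powr_mono) auto
    finally show ?thesis by (smt (verit) sum_nonneg mult_nonneg_nonneg indicator_pos_le powr_ge_zero)
  next
    case False
    \<comment> \<open>the value \<open>g x\<close> is counted at the level \<open>2\<^sup>k\<^sup>+\<^sup>1\<close>, where \<open>m = k + 2\<close>; at most a factor \<open>4\<close> is lost against \<open>2\<^sup>k\<close>\<close>
    define m where "m = (LEAST m. g x \<le> 2 ^ m)"
    have ex: "g x \<le> 2 ^ K" by (simp add: g_def)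
    have m1: "g x \<le> 2 ^ m" unfolding m_def by (rule LeastI[of "\<lambda>m. g x \<le> 2 ^ m", OF ex])
    have mK: "m \<le> K" unfolding m_def by (rule Least_le[of "\<lambda>m. g x \<le> 2 ^ m", OF ex])
    have "m \<noteq> 0"
    proof
      assume "m = 0"
      with m1 have "g x \<le> 1" by simp
      with False show False by simp
    qed
    moreover have "m \<noteq> 1"
    proof
      assume "m = 1"
      with m1 have "g x \<le> 2" by simp
      with False show False by simp
    qed
    ultimately obtain k where mk: "m = Suc (Suc k)" by (metis One_nat_def not0_implies_Suc)
    have "\<not> g x \<le> 2 ^ Suc k"
    proof
      assume "g x \<le> 2 ^ Suc k"
      then have "m \<le> Suc k" unfolding m_def by (rule Least_le)
      then show False using mk by simp
    qed
    then have fk: "2 ^ Suc k < f x" by (simp add: g_def)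
    have kK: "k < K" using mK mk by simp
    have "g x powr q \<le> (4 * 2 ^ k) powr q"
      using m1 mk g0[of x] q0 by (intro powr_mono2) auto
    also have "\<dots> = 4 powr q * (2 ^ k) powr q * indicator {x. 2 ^ Suc k < f x} x"
      using fk by (simp add: powr_mult)
    also have "\<dots> \<le> (\<Sum>k<K. 4 powr q * (2 ^ k) powr q * indicator {x. 2 ^ Suc k < f x} x)"
      using kK by (intro member_le_sum) auto
    finally show ?thesis by (smt (verit) mult_nonneg_nonneg powr_ge_zero)
  qed
  have "I \<le> (\<integral>\<^sup>+x. ennreal (2 powr q) * ennreal (f x powr p) + (\<Sum>k<K. ennreal (4 powr q * (2 ^ k) powr q) * indicator {x. 2 ^ Suc k < f x} x) \<partial>lborel)"
    unfolding I_def
  proof (intro nn_integral_mono)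
    fix x
    have "ennreal (g x powr q) \<le> ennreal (2 powr q * f x powr p + (\<Sum>k<K. 4 powr q * (2 ^ k) powr q * indicator {x. 2 ^ Suc k < f x} x))"
      by (rule ennreal_leI[OF pw])
    also have "\<dots> = ennreal (2 powr q) * ennreal (f x powr p) + (\<Sum>k<K. ennreal (4 powr q * (2 ^ k) powr q) * indicator {x. 2 ^ Suc k < f x} x)"
      by (subst ennreal_plus, simp, simp add: sum_nonneg, subst sum_ennreal[symmetric])
         (auto simp: ennreal_mult ennreal_indicator)
    finally show "ennreal (g x powr q) \<le> \<dots>" .
  qed
  also have "\<dots> = ennreal (2 powr q) * (\<integral>\<^sup>+x. ennreal (f x powr p) \<partial>lborel)
      + (\<Sum>k<K. ennreal (4 powr q * (2 ^ k) powr q) * emeasure lborel {x. 2 ^ Suc k < f x})"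
  proof -
    have "(\<integral>\<^sup>+x. (\<Sum>k<K. ennreal (4 powr q * (2 ^ k) powr q) * indicator {x. 2 ^ Suc k < f x} x) \<partial>lborel)
      = (\<Sum>k<K. \<integral>\<^sup>+x. ennreal (4 powr q * (2 ^ k) powr q) * indicator {x. 2 ^ Suc k < f x} x \<partial>lborel)"
      by (rule nn_integral_sum) measurable
    also have "\<dots> = (\<Sum>k<K. ennreal (4 powr q * (2 ^ k) powr q) * emeasure lborel {x. 2 ^ Suc k < f x})"
      by (rule sum.cong[OF refl], rule nn_integral_cmult_indicator) measurable
    finally show ?thesis
      by (subst nn_integral_add) (measurable, simp add: nn_integral_cmult)
  qed
  also have "\<dots> \<le> ennreal (2 powr q) * 1 + (\<Sum>k<K. ennreal (4 powr q * (C * X powr \<kappa> * D (2 ^ k) (2 ^ Suc k))))"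
  proof (intro add_mono mult_left_mono i sum_mono)
    fix k assume k: "k \<in> {..<K}"
    have "emeasure lborel {x. 2 ^ Suc k < f x} = ennreal (a (Suc k))"
      unfolding a_def using afin[of "Suc k"] by (simp add: emeasure_eq_ennreal_measure)
    then have "ennreal (4 powr q * (2 ^ k) powr q) * emeasure lborel {x. 2 ^ Suc k < f x}
       = ennreal (4 powr q * ((2 ^ k) powr q * a (Suc k)))"
      by (simp add: ennreal_mult[symmetric] a0 mult.assoc)
    also have "\<dots> \<le> ennreal (4 powr q * (C * X powr \<kappa> * D (2 ^ k) (2 ^ Suc k)))"
      using step[of k] k by (intro ennreal_leI mult_left_mono) auto
    finally show "ennreal (4 powr q * (2 ^ k) powr q) * emeasure lborel {x. 2 ^ Suc k < f x} \<le> \<dots>" .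
  qed auto
  also have "\<dots> = ennreal (2 powr q + 4 powr q * C * X powr \<kappa> * (\<Sum>k<K. D (2 ^ k) (2 ^ Suc k)))"
    using C0 D by (subst sum_ennreal) (auto simp: sum_distrib_left mult_ac sum_nonneg simp flip: ennreal_plus)
  also have "\<dots> \<le> ennreal (2 powr q + 4 powr q * C * X powr \<kappa> * 1)"
    using C0 sD[of K] by (intro ennreal_leI add_left_mono mult_left_mono) auto
  finally have key: "X \<le> 2 powr q + 4 powr q * C * X powr \<kappa>"
    using C0 unfolding IX by (simp flip: ennreal_plus)
  have "X \<le> max 1 ((2 powr q + 4 powr q * C) powr (q / p))"
  proof (cases "X \<le> 1")
    case False
    have "1 \<le> X powr \<kappa>" using False k0 by (simp add: ge_one_powr_ge_zero)
    then have "2 powr q * 1 \<le> 2 powr q * X powr \<kappa>" by (intro mult_left_mono) auto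
    then have "X \<le> (2 powr q + 4 powr q * C) * X powr \<kappa>" using key unfolding distrib_right by linarith
    moreover have "X = X powr (p / q) * X powr \<kappa>" using False by (simp add: \<kappa>_def flip: powr_add)
    ultimately have "X powr (p / q) * X powr \<kappa> \<le> (2 powr q + 4 powr q * C) * X powr \<kappa>" by simp
    then have *: "X powr (p / q) \<le> 2 powr q + 4 powr q * C" using False by simp
    have "X = (X powr (p / q)) powr (q / p)" using False q0 by (simp add: powr_powr)
    also have "\<dots> \<le> (2 powr q + 4 powr q * C) powr (q / p)" using * q0 by (intro powr_mono2) auto
    finally show ?thesis by simp
  qed simp
  then have "I \<le> ennreal (max 1 ((2 powr q + 4 powr q * C) powr (q / p)))"
    unfolding IX by (rule ennreal_leI)
  then show ?thesis by (simp add: I_def g_def)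
qed

lemma climbing_bound_Lq:
  assumes p: "p \<ge> 1" and q: "q \<ge> p" and crit: "1 / q \<ge> 1 / p - \<theta> / real CARD('n)"
  obtains C where "C > 0"
    "\<And>(f :: real^'n::finite \<Rightarrow> real) D. climbing_bound \<theta> p D f \<Longrightarrow> f \<in> borel_measurable borel \<Longrightarrow>
       (\<And>x. f x \<ge> 0) \<Longrightarrow> (\<integral>\<^sup>+x. ennreal (f x powr p) \<partial>lborel) \<le> 1 \<Longrightarrow>
       (\<And>a b. D a b \<ge> 0) \<Longrightarrow> (\<And>K. (\<Sum>k<K. D (2 ^ k) (2 ^ Suc k)) \<le> 1) \<Longrightarrow>
       (\<integral>\<^sup>+x. ennreal (f x powr q) \<partial>lborel) \<le> ennreal (C powr q)"
proof -
  define C where "C = max 1 ((2 powr q + 4 powr q * (2 / measure lborel (ball (0::real^'n) 1)) powr (1 + \<theta> * p / real CARD('n))) powr (q / p))"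
  have C1: "C \<ge> 1" by (simp add: C_def)
  show ?thesis
  proof (rule that)
    show "C powr (1 / q) > 0" using C1 by simp
    fix f :: "real^'n \<Rightarrow> real" and D
    assume cb: "climbing_bound \<theta> p D f" and fm[measurable]: "f \<in> borel_measurable borel" and f0: "\<And>x. f x \<ge> 0"
      and i: "(\<integral>\<^sup>+x. ennreal (f x powr p) \<partial>lborel) \<le> 1"
      and D: "\<And>a b. D a b \<ge> 0" and sD: "\<And>K. (\<Sum>k<K. D (2 ^ k) (2 ^ Suc k)) \<le> 1"
    have q0: "q > 0" using p q by auto
    have "(\<integral>\<^sup>+x. ennreal (f x powr q) \<partial>lborel) = (\<integral>\<^sup>+x. liminf (\<lambda>K. ennreal (min (f x) (2 ^ K) powr q)) \<partial>lborel)"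
    proof (rule nn_integral_cong)
      fix x
      obtain k0 :: nat where k0: "f x < 2 ^ k0" using real_arch_pow[of 2 "f x"] by auto
      have "\<forall>\<^sub>F K in sequentially. ennreal (min (f x) (2 ^ K) powr q) = ennreal (f x powr q)"
      proof (rule eventually_sequentiallyI[of k0])
        fix K assume "k0 \<le> K"
        then have "(2::real) ^ k0 \<le> 2 ^ K" by simp
        then show "ennreal (min (f x) (2 ^ K) powr q) = ennreal (f x powr q)" using k0 by (subst min_absorb1, linarith, simp)
      qed
      then have "(\<lambda>K. ennreal (min (f x) (2 ^ K) powr q)) \<longlonglongrightarrow> ennreal (f x powr q)" by (rule tendsto_eventually)
      from lim_imp_Liminf[OF _ this] show "ennreal (f x powr q) = liminf (\<lambda>K. ennreal (min (f x) (2 ^ K) powr q))" by simp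
    qed
    also have "\<dots> \<le> liminf (\<lambda>K. \<integral>\<^sup>+x. ennreal (min (f x) (2 ^ K) powr q) \<partial>lborel)"
      by (rule nn_integral_liminf) measurable
    also have "\<dots> \<le> ennreal C"
    proof (rule order_trans[OF Liminf_le_Limsup])
      show "limsup (\<lambda>K. \<integral>\<^sup>+x. ennreal (min (f x) (2 ^ K) powr q) \<partial>lborel) \<le> ennreal C"
        using climbing_bound_Lq_truncated[OF p q crit cb fm f0 i D sD]
        by (intro Limsup_bounded always_eventually allI) (simp add: C_def)
    qed simp
    also have "ennreal C = ennreal ((C powr (1 / q)) powr q)" using q0 C1 by (simp add: powr_powr)
    finally show "(\<integral>\<^sup>+x. ennreal (f x powr q) \<partial>lborel) \<le> ennreal ((C powr (1 / q)) powr q)" .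
  qed
qed

text \<open>
  De Giorgi's iteration: along the levels \<open>M - M / 2\<^sup>k\<^sup>+\<^sup>1\<close> the measures of the superlevel sets
  satisfy a superlinear recursion, so they decrease geometrically once \<open>M\<close> is large.
\<close>

lemma climbing_bound_bounded:
  assumes p: "p \<ge> 1" and crit: "1 / p < \<theta> / real CARD('n)"
  obtains M where "M > 0"
    "\<And>(f :: real^'n::finite \<Rightarrow> real) D. climbing_bound \<theta> p D f \<Longrightarrow> f \<in> borel_measurable borel \<Longrightarrow>
       (\<And>x. f x \<ge> 0) \<Longrightarrow> (\<integral>\<^sup>+x. ennreal (f x powr p) \<partial>lborel) \<le> 1 \<Longrightarrow>
       (\<And>a b. D a b \<ge> 0) \<Longrightarrow> (\<And>a b. 0 < a \<Longrightarrow> a < b \<Longrightarrow> D a b \<le> 1) \<Longrightarrow> AE x in lborel. f x \<le> M"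
proof -
  define n where "n = real CARD('n)"
  define \<omega> where "\<omega> = measure lborel (ball (0::real^'n) 1)"
  define \<kappa> where "\<kappa> = \<theta> * p / n"
  define \<epsilon> where "\<epsilon> = \<kappa> - 1"
  define C where "C = (2 / \<omega>) powr (1 + \<theta> * p / n)"
  have n: "n > 0" by (simp add: n_def)
  have w: "\<omega> > 0" unfolding \<omega>_def by (rule content_ball_pos) simp
  have C0: "C > 0" using w by (simp add: C_def)
  have eps: "\<epsilon> > 0"
    using crit p n by (simp add: \<epsilon>_def \<kappa>_def n_def[symmetric] field_simps)
  \<comment> \<open>the ratio for which the gain \<open>l\<^sup>\<epsilon>\<close> in every step of the recursion cancels its factor \<open>2\<^sup>p\<close>\<close>
  define l where "l = 2 powr (- p / \<epsilon>)"
  have l: "0 < l" "l < 1" using eps p by (auto simp: l_def powr_less_one)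
  have le: "2 powr p * l powr \<epsilon> = 1" using eps by (simp add: l_def powr_powr flip: powr_add)
  define M where "M = max 2 ((C * 4 powr p / l) powr (1 / p))"
  have M2: "M \<ge> 2" by (simp add: M_def)
  have Mp: "C * 4 powr p \<le> l * M powr p"
  proof -
    have "C * 4 powr p / l = ((C * 4 powr p / l) powr (1 / p)) powr p" using C0 l p by (simp add: powr_powr)
    also have "\<dots> \<le> M powr p" using p by (intro powr_mono2) (auto simp: M_def)
    finally show ?thesis using l by (simp add: field_simps)
  qed
  show ?thesis
  proof (rule that)
    show "M > 0" using M2 by simp
    fix f :: "real^'n \<Rightarrow> real" and D
    assume cb: "climbing_bound \<theta> p D f" and fm[measurable]: "f \<in> borel_measurable borel" and f0: "\<And>x. f x \<ge> 0"
      and i: "(\<integral>\<^sup>+x. ennreal (f x powr p) \<partial>lborel) \<le> 1"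
      and D: "\<And>a b. D a b \<ge> 0" and D1: "\<And>a b. 0 < a \<Longrightarrow> a < b \<Longrightarrow> D a b \<le> 1"
    define t where "t = (\<lambda>k::nat. M - M / 2 ^ Suc k)"
    have td: "t (Suc k) - t k = M / (4 * 2 ^ k)" for k by (simp add: t_def field_simps)
    have t1: "t k \<ge> 1" "t k < M" "t k < t (Suc k)" for k
    proof -
      have "M / 2 ^ Suc k \<le> M / 2" using M2 by (intro divide_left_mono) (auto simp: field_simps)
      then show "t k \<ge> 1" using M2 by (simp add: t_def)
      show "t k < M" using M2 by (simp add: t_def)
      have "M / (4 * 2 ^ k) > 0" using M2 by simp
      then show "t k < t (Suc k)" using td[of k] by linarith
    qed
    define a where "a = (\<lambda>k::nat. measure lborel {x. t k < f x})"
    have tp: "0 < t k" for k using t1(1)[of k] by linarith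
    have afin: "emeasure lborel {x. t k < f x} < \<infinity>" and ap: "t k powr p * a k \<le> 1" for k :: nat
      using Chebyshev_powr[of "t k" f p 1] f0 p i tp[of k] by (auto simp: a_def)
    have a0: "a k \<ge> 0" for k by (simp add: a_def)
    have "a k \<le> l ^ k" for k
    proof (induction k)
      case 0
      have "1 * a 0 \<le> t 0 powr p * a 0"
        using t1(1)[of 0] p by (intro mult_right_mono a0) (auto intro!: ge_one_powr_ge_zero)
      then show ?case using ap[of 0] by simp
    next
      case (Suc k)
      define s :: real where "s = 2 ^ k"
      have s: "s > 0" by (simp add: s_def)
      have "(M / (4 * s)) powr p * a (Suc k) = (t (Suc k) - t k) powr p * a (Suc k)" by (simp add: td s_def)
      also have "\<dots> \<le> C * a k powr \<kappa> * D (t k) (t (Suc k))"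
        unfolding a_def C_def n_def \<omega>_def \<kappa>_def
        by (rule level_decay[OF cb fm D]) (use afin t1 tp in auto)
      also have "\<dots> \<le> C * a k powr \<kappa> * 1"
        using C0 t1 tp by (intro mult_left_mono D1) auto
      also have "\<dots> \<le> C * (l ^ k) powr \<kappa>"
        using C0 Suc a0[of k] eps by (auto intro!: mult_left_mono powr_mono2 simp: \<epsilon>_def)
      also have "(l ^ k) powr \<kappa> = l ^ k * (l powr \<epsilon>) ^ k"
      proof -
        have "(l ^ k) powr \<kappa> = (l ^ k) powr (1 + \<epsilon>)" by (simp add: \<epsilon>_def)
        also have "\<dots> = l ^ k * (l ^ k) powr \<epsilon>" using l by (simp add: powr_add)
        also have "(l ^ k) powr \<epsilon> = (l powr \<epsilon>) ^ k"
          using l by (simp add: powr_powr mult.commute flip: powr_realpow)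
        finally show ?thesis .
      qed
      finally have *: "(M / (4 * s)) powr p * a (Suc k) \<le> C * (l ^ k * (l powr \<epsilon>) ^ k)" .
      have sp: "s powr p * (l powr \<epsilon>) ^ k = 1"
      proof -
        have "s powr p = (2 powr p) ^ k"
          unfolding s_def by (simp add: powr_powr mult.commute flip: powr_realpow)
        then show ?thesis using le by (simp flip: power_mult_distrib)
      qed
      have "M powr p * a (Suc k) = (4 * s) powr p * ((M / (4 * s)) powr p * a (Suc k))"
        using s M2 by (simp add: powr_divide)
      also have "\<dots> \<le> (4 * s) powr p * (C * (l ^ k * (l powr \<epsilon>) ^ k))" by (intro mult_left_mono *) auto
      also have "\<dots> = C * 4 powr p * l ^ k * (s powr p * (l powr \<epsilon>) ^ k)" using s by (simp add: powr_mult)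
      also have "\<dots> = C * 4 powr p * l ^ k" by (simp add: sp)
      also have "\<dots> \<le> l * M powr p * l ^ k" using l by (intro mult_right_mono Mp) auto
      finally have "M powr p * a (Suc k) \<le> M powr p * l ^ Suc k" by (simp add: mult_ac)
      then show ?case using M2 by simp
    qed
    note al = this
    have "emeasure lborel {x. M < f x} \<le> ennreal (l ^ k)" for k
    proof -
      have "emeasure lborel {x. M < f x} \<le> emeasure lborel {x. t k < f x}"
        using t1(2)[of k] by (intro emeasure_mono) auto
      also have "\<dots> = ennreal (a k)" unfolding a_def using afin[of k] by (simp add: emeasure_eq_ennreal_measure)
      also have "\<dots> \<le> ennreal (l ^ k)" by (rule ennreal_leI[OF al])
      finally show ?thesis .
    qed
    moreover have "(\<lambda>k. ennreal (l ^ k)) \<longlonglongrightarrow> ennreal 0"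
      using l by (intro tendsto_ennrealI LIMSEQ_realpow_zero) auto
    ultimately have "emeasure lborel {x. M < f x} \<le> 0"
      by (metis LIMSEQ_le_const ennreal_0)
    then have "emeasure lborel {x. M < f x} = 0" by simp
    then have "{x. M < f x} \<in> null_sets lborel" by (auto simp: null_sets_def)
    from AE_not_in[OF this] show "AE x in lborel. f x \<le> M" by eventually_elim auto
  qed
qed

section \<open>Climbing bounds for functions of fractional and of first order\<close>

lemma powr_superadditive:
  fixes a b p :: real
  assumes "p \<ge> 1" "a \<ge> 0" "b \<ge> 0"
  shows "a powr p + b powr p \<le> (a + b) powr p"
proof -
  have *: "c powr p \<le> c * (a + b) powr (p - 1)" if "0 \<le> c" "c \<le> a + b" for c
  proof (cases "c = 0")
    case False
    have "c powr p = c * c powr (p - 1)" using that False by (simp add: powr_diff)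
    also have "\<dots> \<le> c * (a + b) powr (p - 1)" using that assms(1) by (intro mult_left_mono powr_mono2) auto
    finally show ?thesis .
  qed simp
  have "a powr p + b powr p \<le> (a + b) * (a + b) powr (p - 1)"
    using *[of a] *[of b] assms by (simp add: distrib_right)
  also have "\<dots> = (a + b) powr p"
    using assms by (cases "a + b = 0") (auto simp: powr_diff)
  finally show ?thesis .
qed

text \<open>
  The intervals \<open>[2\<^sup>k, 2\<^sup>k\<^sup>+\<^sup>1]\<close> inside \<open>[s, t]\<close> do not overlap, and powers with exponent at least one are
  superadditive.
\<close>

lemma dyadic_steps:
  fixes p s t :: real
  assumes p: "p \<ge> 1"
  shows "(\<Sum>k<K. if s \<le> 2 ^ k \<and> 2 ^ Suc k < t then (2 ^ Suc k - 2 ^ k) powr p else 0)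
     \<le> max 0 (min t (2 ^ K) - s) powr p"
proof (induction K)
  case (Suc K)
  show ?case
  proof (cases "s \<le> 2 ^ K \<and> 2 ^ Suc K < t")
    case True
    have "(2::real) ^ K \<le> 2 ^ Suc K" by simp
    then have *: "min t (2 ^ K) = 2 ^ K" "min t (2 ^ Suc K) = 2 ^ Suc K" using True by linarith+
    have "(2 ^ K - s) powr p + (2 ^ K) powr p \<le> (2 ^ K - s + 2 ^ K) powr p"
      using True p by (intro powr_superadditive) auto
    moreover have "max 0 (2 ^ Suc K - s) = 2 ^ K - s + 2 ^ K" "max 0 (2 ^ K - s) = 2 ^ K - s"
      using True zero_less_power[of "2::real" K] unfolding max_def power_Suc by (simp_all, linarith)
    ultimately have "max 0 (min t (2 ^ K) - s) powr p + (2 ^ Suc K - 2 ^ K) powr p \<le> max 0 (min t (2 ^ Suc K) - s) powr p"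
      unfolding * by simp
    then show ?thesis using Suc True by simp
  next
    case False
    have "(2::real) ^ K \<le> 2 ^ Suc K" by simp
    then have "max 0 (min t (2 ^ K) - s) \<le> max 0 (min t (2 ^ Suc K) - s)"
      by (intro max.mono diff_mono min.mono) auto
    then have "max 0 (min t (2 ^ K) - s) powr p \<le> max 0 (min t (2 ^ Suc K) - s) powr p"
      using p by (intro powr_mono2) auto
    then show ?thesis using Suc False by auto
  qed
qed simp

lemma nn_integral_cmult_mono:
  fixes c d :: ennreal
  assumes "g \<in> borel_measurable M" "h \<in> borel_measurable M" "\<And>y. c * g y \<le> d * h y"
  shows "c * (\<integral>\<^sup>+y. g y \<partial>M) \<le> d * (\<integral>\<^sup>+y. h y \<partial>M)"
proof -
  have "c * (\<integral>\<^sup>+y. g y \<partial>M) = (\<integral>\<^sup>+y. c * g y \<partial>M)" using assms(1) by (rule nn_integral_cmult[symmetric])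
  also have "\<dots> \<le> (\<integral>\<^sup>+y. d * h y \<partial>M)" using assms(3) by (rule nn_integral_mono)
  also have "\<dots> = d * (\<integral>\<^sup>+y. h y \<partial>M)" using assms(2) by (rule nn_integral_cmult)
  finally show ?thesis .
qed

lemma indicator_times_emeasure_ball:
  fixes f :: "real^'n::finite \<Rightarrow> real"
  assumes [measurable]: "f \<in> borel_measurable borel"
  shows "indicator {x. b < f x} x * emeasure lborel (ball x r \<inter> {y. f y \<le> a})
       = (\<integral>\<^sup>+y. (if b < f x \<and> dist x y < r \<and> f y \<le> a then 1 else 0) \<partial>lborel)"
proof -
  have [measurable]: "ball x r \<inter> {y. f y \<le> a} \<in> sets lborel" by measurable
  have "(\<integral>\<^sup>+y. (if b < f x \<and> dist x y < r \<and> f y \<le> a then 1 else 0) \<partial>lborel)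
     = (\<integral>\<^sup>+y. indicator {x. b < f x} x * indicator (ball x r \<inter> {y. f y \<le> a}) y \<partial>lborel)"
    by (rule nn_integral_cong) (auto simp: indicator_def)
  also have "\<dots> = indicator {x. b < f x} x * emeasure lborel (ball x r \<inter> {y. f y \<le> a})"
    by (rule nn_integral_cmult_indicator) measurable
  finally show ?thesis by simp
qed

text \<open>
  The energy is the part of the double integral over the pairs that cross from one level to the
  other. A pair contributes to the levels that it crosses, in total at most the power of its own increment.
\<close>

lemma slobodeckij_climbing_bound:
  fixes u :: "real^'n::finite \<Rightarrow> 'b::euclidean_space"
  assumes p: "p \<ge> 1" and \<theta>: "\<theta> > 0" and [measurable]: "u \<in> borel_measurable borel"
    and E: "(\<integral>\<^sup>+x. \<integral>\<^sup>+y. ennreal (norm (u x - u y) powr p / norm (x - y) powr (real CARD('n) + \<theta> * p)) \<partial>lborel \<partial>lborel) \<le> 1"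
  obtains D where "climbing_bound \<theta> p D (\<lambda>x. norm (u x))" "\<And>a b. D a b \<ge> 0"
    "\<And>K. (\<Sum>k<K. D (2 ^ k) (2 ^ Suc k)) \<le> 1" "\<And>a b. 0 < a \<Longrightarrow> a < b \<Longrightarrow> D a b \<le> 1"
proof -
  define n where "n = real CARD('n) + \<theta> * p"
  have n: "n > 0" using p \<theta> by (simp add: n_def add_pos_pos)
  define f where "f = (\<lambda>x. norm (u x))"
  have [measurable]: "f \<in> borel_measurable borel" unfolding f_def by measurable
  define e where "e = (\<lambda>a b. \<integral>\<^sup>+x. \<integral>\<^sup>+y. (if b < f x \<and> f y \<le> a
       then ennreal ((b - a) powr p / norm (x - y) powr n) else 0) \<partial>lborel \<partial>lborel)"
  have fu: "\<bar>f x - f y\<bar> \<le> norm (u x - u y)" for x y unfolding f_def by (rule norm_triangle_ineq3)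
  have e1: "e a b \<le> 1" if "0 < a" "a < b" for a b
  proof -
    have "e a b \<le> (\<integral>\<^sup>+x. \<integral>\<^sup>+y. ennreal (norm (u x - u y) powr p / norm (x - y) powr n) \<partial>lborel \<partial>lborel)"
      unfolding e_def
    proof (intro nn_integral_mono)
      fix x y
      show "(if b < f x \<and> f y \<le> a then ennreal ((b - a) powr p / norm (x - y) powr n) else 0)
          \<le> ennreal (norm (u x - u y) powr p / norm (x - y) powr n)"
        using fu[of x y] that p by (auto intro!: ennreal_leI divide_right_mono powr_mono2)
    qed
    then show ?thesis using E unfolding n_def by (rule order_trans)
  qed
  define D where "D = (\<lambda>a b. enn2real (e a b))"
  have eD: "e a b = ennreal (D a b)" if "0 < a" "a < b" for a b
    unfolding D_def using e1[OF that] by (simp add: ennreal_enn2real order_le_less_trans)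
  show ?thesis
  proof (rule that[of D])
    show D0: "D a b \<ge> 0" for a b by (simp add: D_def)
    show "D a b \<le> 1" if "0 < a" "a < b" for a b
      using e1[OF that] D0 unfolding eD[OF that] by (simp flip: ennreal_1)
    show "(\<Sum>k<K. D (2 ^ k) (2 ^ Suc k)) \<le> 1" for K
    proof -
      let ?t = "\<lambda>k x y. if 2 ^ Suc k < f x \<and> f y \<le> 2 ^ k then (2 ^ Suc k - 2 ^ k) powr p / norm (x - y) powr n else 0"
      have "ennreal (\<Sum>k<K. D (2 ^ k) (2 ^ Suc k)) = (\<Sum>k<K. e (2 ^ k) (2 ^ Suc k))"
        by (subst sum_ennreal[symmetric]) (auto simp: D0 eD)
      also have "\<dots> = (\<Sum>k<K. \<integral>\<^sup>+x. \<integral>\<^sup>+y. ennreal (?t k x y) \<partial>lborel \<partial>lborel)"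
        unfolding e_def by (intro sum.cong refl nn_integral_cong) auto
      also have "\<dots> = (\<integral>\<^sup>+x. (\<Sum>k<K. \<integral>\<^sup>+y. ennreal (?t k x y) \<partial>lborel) \<partial>lborel)"
        by (rule nn_integral_sum[symmetric]) measurable
      also have "\<dots> = (\<integral>\<^sup>+x. \<integral>\<^sup>+y. (\<Sum>k<K. ennreal (?t k x y)) \<partial>lborel \<partial>lborel)"
        by (rule nn_integral_cong, rule nn_integral_sum[symmetric]) measurable
      also have "\<dots> \<le> (\<integral>\<^sup>+x. \<integral>\<^sup>+y. ennreal (norm (u x - u y) powr p / norm (x - y) powr n) \<partial>lborel \<partial>lborel)"
      proof (intro nn_integral_mono)
        fix x y
        have "(\<Sum>k<K. ?t k x y) = (\<Sum>k<K. if f y \<le> 2 ^ k \<and> 2 ^ Suc k < f x then (2 ^ Suc k - 2 ^ k) powr p else 0) / norm (x - y) powr n"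
          unfolding sum_divide_distrib by (intro sum.cong) auto
        also have "\<dots> \<le> max 0 (min (f x) (2 ^ K) - f y) powr p / norm (x - y) powr n"
          by (intro divide_right_mono dyadic_steps p) auto
        also have "\<dots> \<le> norm (u x - u y) powr p / norm (x - y) powr n"
          using fu[of x y] p by (intro divide_right_mono powr_mono2) auto
        finally have "(\<Sum>k<K. ?t k x y) \<le> norm (u x - u y) powr p / norm (x - y) powr n" .
        moreover have "(\<Sum>k<K. ennreal (?t k x y)) = ennreal (\<Sum>k<K. ?t k x y)"
          by (rule sum_ennreal) auto
        ultimately show "(\<Sum>k<K. ennreal (?t k x y)) \<le> ennreal (norm (u x - u y) powr p / norm (x - y) powr n)"
          by (simp only: ennreal_leI)
      qed
      also have "\<dots> \<le> 1" using E by (simp add: n_def)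
      finally show ?thesis by (simp flip: ennreal_1)
    qed
    show "climbing_bound \<theta> p D (\<lambda>x. norm (u x))"
      unfolding climbing_bound_def f_def[symmetric] n_def[symmetric]
    proof (intro allI impI)
      fix a b r :: real assume ab: "0 < a" "a < b" and r: "0 < r"
      have "ennreal ((b - a) powr p) * (\<integral>\<^sup>+x. indicator {x. b < f x} x * emeasure lborel (ball x r \<inter> {y. f y \<le> a}) \<partial>lborel)
         = ennreal ((b - a) powr p) * (\<integral>\<^sup>+x. \<integral>\<^sup>+y. (if b < f x \<and> dist x y < r \<and> f y \<le> a then 1 else 0) \<partial>lborel \<partial>lborel)"
        by (simp only: indicator_times_emeasure_ball[OF \<open>f \<in> borel_measurable borel\<close>])
      also have "\<dots> \<le> ennreal (r powr n) * (\<integral>\<^sup>+x. \<integral>\<^sup>+y. (if b < f x \<and> f y \<le> a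
             then ennreal ((b - a) powr p / norm (x - y) powr n) else 0) \<partial>lborel \<partial>lborel)"
      proof (rule nn_integral_cmult_mono, measurable, rule nn_integral_cmult_mono, measurable)
        fix x y
        show "ennreal ((b - a) powr p) * (if b < f x \<and> dist x y < r \<and> f y \<le> a then 1 else 0)
            \<le> ennreal (r powr n) * (if b < f x \<and> f y \<le> a then ennreal ((b - a) powr p / norm (x - y) powr n) else 0)"
        proof (cases "b < f x \<and> f y \<le> a \<and> dist x y < r")
          case True
          then have xy: "norm (x - y) > 0" using ab by auto
          have "(b - a) powr p * norm (x - y) powr n \<le> (b - a) powr p * r powr n"
            using True n by (intro mult_left_mono powr_mono2) (auto simp: dist_norm)
          then have "(b - a) powr p \<le> r powr n * ((b - a) powr p / norm (x - y) powr n)"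
            using xy by (simp add: field_simps)
          then show ?thesis using True by (simp add: ennreal_mult[symmetric] ennreal_leI)
        qed auto
      qed
      also have "\<dots> = ennreal (r powr n) * e a b" unfolding e_def ..
      also have "\<dots> = ennreal (r powr n * D a b)" using D0 by (simp add: eD[OF ab] ennreal_mult)
      finally show "ennreal ((b - a) powr p) * (\<integral>\<^sup>+x. indicator {x. b < f x} x * emeasure lborel (ball x r \<inter> {y. f y \<le> a}) \<partial>lborel)
          \<le> ennreal (r powr n * D a b)" .
    qed
  qed
qed

text \<open>
  Young's inequality bounds \<open>p c\<^sup>p\<^sup>-\<^sup>1 g\<close> by \<open>g\<^sup>p + (p - 1) c\<^sup>p\<close>, which is integrated over the unit interval.
\<close>

lemma powr_integral_Jensen:
  fixes g :: "real \<Rightarrow> real"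
  assumes p: "p \<ge> 1" and c: "c > 0" and [measurable]: "g \<in> borel_measurable borel" and g: "\<And>x. g x \<ge> 0"
    and le: "ennreal c \<le> (\<integral>\<^sup>+x. indicator {0..1} x * ennreal (g x) \<partial>lborel)"
  shows "ennreal (c powr p) \<le> (\<integral>\<^sup>+x. indicator {0..1} x * ennreal (g x powr p) \<partial>lborel)"
proof (cases "p = 1")
  case True
  then show ?thesis using le c g by (simp add: powr_one)
next
  case False
  then have p1: "p > 1" using p by simp
  have Y: "p * c powr (p - 1) * z \<le> z powr p + (p - 1) * c powr p" if "z \<ge> 0" for z
  proof -
    define q where "q = p / (p - 1)"
    have q: "q > 1" "1 / p + 1 / q = 1" using p1 by (auto simp: q_def field_simps)
    have "z * c powr (p - 1) \<le> z powr p / p + (c powr (p - 1)) powr q / q"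
      by (rule Youngs_inequality[OF p1 q that]) simp
    also have "(c powr (p - 1)) powr q = c powr p" using p1 by (simp add: powr_powr q_def)
    also have "z powr p / p + c powr p / q = (z powr p + (p - 1) * c powr p) / p"
      using p1 by (simp add: q_def field_simps)
    finally show ?thesis using p1 by (simp add: field_simps)
  qed
  have "ennreal (c powr p) + ennreal ((p - 1) * c powr p) = ennreal (p * c powr (p - 1)) * ennreal c"
    using c p1 by (simp add: ennreal_mult[symmetric] powr_diff left_diff_distrib flip: ennreal_plus)
  also have "\<dots> \<le> ennreal (p * c powr (p - 1)) * (\<integral>\<^sup>+x. indicator {0..1} x * ennreal (g x) \<partial>lborel)"
    by (intro mult_left_mono le) auto
  also have "\<dots> = (\<integral>\<^sup>+x. ennreal (p * c powr (p - 1)) * (indicator {0..1} x * ennreal (g x)) \<partial>lborel)"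
    by (rule nn_integral_cmult[symmetric]) measurable
  also have "\<dots> \<le> (\<integral>\<^sup>+x. indicator {0..1} x * ennreal (g x powr p) + ennreal ((p - 1) * c powr p) * indicator {0..1} x \<partial>lborel)"
  proof (intro nn_integral_mono)
    fix x
    show "ennreal (p * c powr (p - 1)) * (indicator {0..1} x * ennreal (g x))
       \<le> indicator {0..1} x * ennreal (g x powr p) + ennreal ((p - 1) * c powr p) * indicator {0..1} x"
      using Y[OF g[of x]] g[of x] p1
      by (auto simp: indicator_def ennreal_mult[symmetric] ennreal_leI simp flip: ennreal_plus)
  qed
  also have "\<dots> = (\<integral>\<^sup>+x. indicator {0..1} x * ennreal (g x powr p) \<partial>lborel) + ennreal ((p - 1) * c powr p)"
    by (subst nn_integral_add) (auto simp: nn_integral_cmult)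
  finally show ?thesis
    by (simp add: ennreal_add_left_cancel_le add.commute)
qed

text \<open>
  Between the last time \<open>s0\<close> at which the norm of \<open>\<psi>\<close> is at most \<open>a\<close> and the first time \<open>s1\<close> after it at which it is at
  least \<open>b\<close>, it lies strictly between \<open>a\<close> and \<open>b\<close>; the climb is paid by the integral of \<open>F\<close> over this time.
\<close>

lemma climbing_path:
  fixes F :: "real \<Rightarrow> 'b::euclidean_space" and z :: 'b
  assumes F: "integrable lborel (\<lambda>\<tau>. indicator {0..1} \<tau> *\<^sub>R F \<tau>)" and Fm[measurable]: "F \<in> borel_measurable borel"
  defines "\<psi> \<equiv> \<lambda>\<tau>. z + (LINT \<sigma>|lborel. indicator {0..\<tau>} \<sigma> *\<^sub>R F \<sigma>)"
  assumes a: "norm (\<psi> 0) \<le> a" and b: "b < norm (\<psi> 1)" and ab: "a < b"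
    and Nm[measurable]: "N \<in> borel_measurable borel" and N: "AE \<tau> in lborel. 0 \<le> \<tau> \<longrightarrow> N \<tau> = norm (\<psi> \<tau>)"
  shows "ennreal (b - a) \<le> (\<integral>\<^sup>+\<tau>. indicator {0..1} \<tau> * ennreal (indicator {\<tau>. a < N \<tau> \<and> N \<tau> < b} \<tau> * norm (F \<tau>)) \<partial>lborel)"
proof -
  have sI: "set_integrable lborel {0..1} F" using F by (simp add: set_integrable_def)
  have sIt: "set_integrable lborel {0..\<tau>} F" if "\<tau> \<le> 1" for \<tau>
    by (rule set_integrable_subset[OF sI]) (use that in auto)
  have "continuous_on {0..1} (\<lambda>\<tau>. integral {0..\<tau>} F)"
    by (rule indefinite_integral_continuous_1) (rule set_borel_integral_eq_integral(1)[OF sI])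
  moreover have "\<psi> \<tau> = z + integral {0..\<tau>} F" if "\<tau> \<in> {0..1}" for \<tau>
    using set_borel_integral_eq_integral(2)[OF sIt, of \<tau>] that by (simp add: \<psi>_def set_lebesgue_integral_def)
  moreover from calculation(1) have "continuous_on {0..1} (\<lambda>\<tau>. z + integral {0..\<tau>} F)"
    by (intro continuous_on_add continuous_on_const)
  ultimately have "continuous_on {0..1} \<psi>"
    by (metis (no_types, lifting) continuous_on_cong)
  then have cont: "continuous_on {0..1} (\<lambda>\<tau>. norm (\<psi> \<tau>))" by (rule continuous_on_norm)
  have "compact ({0..1} \<inter> (\<lambda>\<tau>. norm (\<psi> \<tau>)) -` {..a})"
    using continuous_closed_preimage[OF cont] by (metis closed_atMost closed_atLeastAtMost compact_Icc compact_Int_closed inf.idem inf_left_idem)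
  moreover have "0 \<in> {0..1} \<inter> (\<lambda>\<tau>. norm (\<psi> \<tau>)) -` {..a}" using a by simp
  ultimately have "\<exists>s\<in>{0..1} \<inter> (\<lambda>\<tau>. norm (\<psi> \<tau>)) -` {..a}. \<forall>t\<in>{0..1} \<inter> (\<lambda>\<tau>. norm (\<psi> \<tau>)) -` {..a}. t \<le> s"
    by (intro compact_attains_sup) blast+
  then obtain s0 where s0: "s0 \<in> {0..1}" "norm (\<psi> s0) \<le> a"
      "\<And>\<tau>. \<tau> \<in> {0..1} \<Longrightarrow> norm (\<psi> \<tau>) \<le> a \<Longrightarrow> \<tau> \<le> s0" by blast
  have cont': "continuous_on {s0..1} (\<lambda>\<tau>. norm (\<psi> \<tau>))"
    by (rule continuous_on_subset[OF cont]) (use s0 in auto)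
  have "compact ({s0..1} \<inter> (\<lambda>\<tau>. norm (\<psi> \<tau>)) -` {b..})"
    using continuous_closed_preimage[OF cont'] by (metis closed_atLeast closed_atLeastAtMost compact_Icc compact_Int_closed inf.idem inf_left_idem)
  moreover have "1 \<in> {s0..1} \<inter> (\<lambda>\<tau>. norm (\<psi> \<tau>)) -` {b..}" using b s0(1) by simp
  ultimately have "\<exists>s\<in>{s0..1} \<inter> (\<lambda>\<tau>. norm (\<psi> \<tau>)) -` {b..}. \<forall>t\<in>{s0..1} \<inter> (\<lambda>\<tau>. norm (\<psi> \<tau>)) -` {b..}. s \<le> t"
    by (intro compact_attains_inf) blast+
  then obtain s1 where s1: "s1 \<in> {s0..1}" "norm (\<psi> s1) \<ge> b"
      "\<And>\<tau>. \<tau> \<in> {s0..1} \<Longrightarrow> norm (\<psi> \<tau>) \<ge> b \<Longrightarrow> s1 \<le> \<tau>" by blast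
  have mid: "a < norm (\<psi> \<tau>)" "norm (\<psi> \<tau>) < b" if "s0 < \<tau>" "\<tau> < s1" for \<tau>
    using s0(3)[of \<tau>] s1(3)[of \<tau>] that s0(1) s1(1) by force+
  have int: "integrable lborel (\<lambda>\<sigma>. indicator {0..\<tau>} \<sigma> *\<^sub>R F \<sigma>)" if "\<tau> \<le> 1" for \<tau>
    using sIt[OF that] by (simp add: set_integrable_def)
  have "\<psi> s1 - \<psi> s0 = (LINT \<sigma>|lborel. indicator {0..s1} \<sigma> *\<^sub>R F \<sigma> - indicator {0..s0} \<sigma> *\<^sub>R F \<sigma>)"
    using int[of s1] int[of s0] s0(1) s1(1) by (simp add: \<psi>_def)
  also have "\<dots> = (LINT \<sigma>|lborel. indicator {s0<..s1} \<sigma> *\<^sub>R F \<sigma>)"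
    using s0(1) s1(1) by (intro Bochner_Integration.integral_cong) (auto simp: indicator_def)
  finally have diff: "\<psi> s1 - \<psi> s0 = (LINT \<sigma>|lborel. indicator {s0<..s1} \<sigma> *\<^sub>R F \<sigma>)" .
  have int2: "integrable lborel (\<lambda>\<sigma>. indicator {s0<..s1} \<sigma> *\<^sub>R F \<sigma>)"
  proof -
    have "{s0<..s1} \<subseteq> {0..1}" using s0(1) s1(1) by auto
    then have "set_integrable lborel {s0<..s1} F" by (intro set_integrable_subset[OF sI]) auto
    then show ?thesis by (simp add: set_integrable_def)
  qed
  have "b - a \<le> norm (\<psi> s1 - \<psi> s0)"
    using norm_triangle_ineq2[of "\<psi> s1" "\<psi> s0"] s0(2) s1(2) by linarith
  then have "ennreal (b - a) \<le> ennreal (norm (LINT \<sigma>|lborel. indicator {s0<..s1} \<sigma> *\<^sub>R F \<sigma>))"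
    unfolding diff by (rule ennreal_leI)
  also have "\<dots> \<le> (\<integral>\<^sup>+\<sigma>. ennreal (norm (indicator {s0<..s1} \<sigma> *\<^sub>R F \<sigma>)) \<partial>lborel)"
    by (rule integral_norm_bound_ennreal[OF int2])
  also have "\<dots> \<le> (\<integral>\<^sup>+\<tau>. indicator {0..1} \<tau> * ennreal (indicator {\<tau>. a < N \<tau> \<and> N \<tau> < b} \<tau> * norm (F \<tau>)) \<partial>lborel)"
  proof (rule nn_integral_mono_AE)
    have "AE \<tau> in lborel. \<tau> \<noteq> s1" by (rule AE_lborel_singleton)
    with N show "AE \<tau> in lborel. ennreal (norm (indicator {s0<..s1} \<tau> *\<^sub>R F \<tau>))
        \<le> indicator {0..1} \<tau> * ennreal (indicator {\<tau>. a < N \<tau> \<and> N \<tau> < b} \<tau> * norm (F \<tau>))"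
    proof eventually_elim
      case (elim \<tau>)
      show ?case
      proof (cases "s0 < \<tau> \<and> \<tau> < s1")
        case True
        then show ?thesis using elim mid[of \<tau>] s0(1) s1(1) by (simp add: indicator_def)
      qed (use elim in \<open>auto simp: indicator_def\<close>)
    qed
  qed
  finally show ?thesis .
qed

lemma weak_dir_sum:
  fixes u :: "real^'n::finite \<Rightarrow> 'b::euclidean_space"
  assumes u: "loc_int u" and w: "\<And>i. loc_int (w i)" "\<And>i. weak_dir (axis i 1) u (w i)"
  shows "weak_dir h u (\<lambda>x. \<Sum>i\<in>UNIV. h $ i *\<^sub>R w i x)"
  unfolding weak_dir_def
proof (intro allI impI)
  fix \<phi> :: "real^'n \<Rightarrow> real" assume \<phi>: "test_function \<phi>"
  have "(LINT x|lborel. dir_deriv h \<phi> x *\<^sub>R u x) = (LINT x|lborel. (\<Sum>i\<in>UNIV. h $ i *\<^sub>R (partial i \<phi> x *\<^sub>R u x)))"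
    by (intro Bochner_Integration.integral_cong) (auto simp: dir_deriv_def scaleR_sum_left)
  also have "\<dots> = (\<Sum>i\<in>UNIV. LINT x|lborel. h $ i *\<^sub>R (partial i \<phi> x *\<^sub>R u x))"
    by (intro Bochner_Integration.integral_sum integrable_scaleR_right integrable_test_times[OF u] test_partial[OF \<phi>])
  also have "\<dots> = (\<Sum>i\<in>UNIV. - (LINT x|lborel. h $ i *\<^sub>R (\<phi> x *\<^sub>R w i x)))"
  proof (rule sum.cong[OF refl])
    fix i
    have "(LINT x|lborel. partial i \<phi> x *\<^sub>R u x) = - (LINT x|lborel. \<phi> x *\<^sub>R w i x)"
      using w(2)[of i] \<phi> by (simp add: weak_dir_def dir_deriv_axis)
    then show "(LINT x|lborel. h $ i *\<^sub>R (partial i \<phi> x *\<^sub>R u x)) = - (LINT x|lborel. h $ i *\<^sub>R (\<phi> x *\<^sub>R w i x))"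
      by (simp only: integral_scaleR_right scaleR_minus_right)
  qed
  also have "\<dots> = - (\<Sum>i\<in>UNIV. LINT x|lborel. h $ i *\<^sub>R (\<phi> x *\<^sub>R w i x))" by (simp add: sum_negf)
  also have "(\<Sum>i\<in>UNIV. LINT x|lborel. h $ i *\<^sub>R (\<phi> x *\<^sub>R w i x)) = (LINT x|lborel. (\<Sum>i\<in>UNIV. h $ i *\<^sub>R (\<phi> x *\<^sub>R w i x)))"
    by (rule Bochner_Integration.integral_sum[symmetric]) (intro integrable_scaleR_right integrable_test_times[OF w(1)] \<phi>)
  also have "\<dots> = (LINT x|lborel. \<phi> x *\<^sub>R (\<Sum>i\<in>UNIV. h $ i *\<^sub>R w i x))"
    by (intro Bochner_Integration.integral_cong) (auto simp: scaleR_sum_right mult.commute)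
  finally show "(LINT x|lborel. dir_deriv h \<phi> x *\<^sub>R u x) = - (LINT x|lborel. \<phi> x *\<^sub>R (\<Sum>i\<in>UNIV. h $ i *\<^sub>R w i x))" .
qed

text \<open>
  The chain rule for truncations, without derivatives of truncations: on almost every line,
  climbing from \<open>a\<close> to \<open>b\<close> uses only the part of the gradient at points where the modulus of
  the function lies strictly between \<open>a\<close> and \<open>b\<close>.
\<close>

lemma translation_climbing:
  fixes u :: "real^'n::finite \<Rightarrow> 'b::euclidean_space"
  assumes p: "p \<ge> 1" and u: "loc_int u" and w: "\<And>i. loc_int (w i)" "\<And>i. weak_dir (axis i 1) u (w i)"
    and ab: "a < b"
  shows "ennreal ((b - a) powr p) * (\<integral>\<^sup>+y. indicator {y. norm (u y) \<le> a \<and> b < norm (u (y + h))} y \<partial>lborel)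
     \<le> ennreal (norm h powr p) * (\<integral>\<^sup>+x. indicator {x. a < norm (u x) \<and> norm (u x) < b} x * ennreal ((\<Sum>i\<in>UNIV. norm (w i x)) powr p) \<partial>lborel)"
proof -
  define F where "F = (\<lambda>x. \<Sum>i\<in>UNIV. h $ i *\<^sub>R w i x)"
  define W where "W = (\<lambda>x. \<Sum>i\<in>UNIV. norm (w i x))"
  have [measurable]: "u \<in> borel_measurable borel" "\<And>i. w i \<in> borel_measurable borel"
    by (rule loc_int_measurable u w)+
  have [measurable]: "W \<in> borel_measurable borel" unfolding W_def by measurable
  have lF: "loc_int F" unfolding F_def by (intro loc_int_sum loc_int_scaleR w) auto
  have [measurable]: "F \<in> borel_measurable borel" by (rule loc_int_measurable[OF lF])
  have FW: "norm (F x) \<le> norm h * W x" for x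
  proof -
    have "norm (F x) \<le> (\<Sum>i\<in>UNIV. norm (h $ i *\<^sub>R w i x))" unfolding F_def by (rule norm_sum)
    also have "\<dots> \<le> (\<Sum>i\<in>UNIV. norm h * norm (w i x))"
      by (intro sum_mono) (auto intro!: mult_right_mono component_le_norm_cart)
    finally show ?thesis by (simp add: W_def sum_distrib_left)
  qed
  have inc: "line_increment h u F"
    unfolding F_def by (rule weak_dir_line_increment[OF u lF[unfolded F_def] weak_dir_sum[OF u w]])
  define I where "I = (\<lambda>x. indicator {x. a < norm (u x) \<and> norm (u x) < b} x * ennreal (norm h powr p * W x powr p))"
  have [measurable]: "I \<in> borel_measurable borel" unfolding I_def by measurable
  have line: "AE y in lborel. ennreal ((b - a) powr p) * indicator {y. norm (u y) \<le> a \<and> b < norm (u (y + h))} y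
      \<le> (\<integral>\<^sup>+\<tau>. indicator {0..1} \<tau> * I (y + \<tau> *\<^sub>R h) \<partial>lborel)"
  proof -
    have "AE y in lborel. u (y + 1 *\<^sub>R h) - u y = (LINT \<tau>|lborel. indicator {0..1} \<tau> *\<^sub>R F (y + \<tau> *\<^sub>R h))"
      using inc unfolding line_increment_def by (rule spec[of _ 1, THEN mp]) simp
    then show ?thesis
      using line_increment_AE_line[OF u lF inc] AE_line_integrable[OF lF, of 1 h]
    proof eventually_elim
      case (elim y)
      show ?case
      proof (cases "norm (u y) \<le> a \<and> b < norm (u (y + h))")
        case True
        define \<psi> where "\<psi> = (\<lambda>\<tau>. u y + (LINT \<sigma>|lborel. indicator {0..\<tau>} \<sigma> *\<^sub>R F (y + \<sigma> *\<^sub>R h)))"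
        have p1: "\<psi> 1 = u (y + h)" using elim(1) by (simp add: \<psi>_def diff_eq_eq add.commute)
        have "(LINT \<sigma>|lborel. indicator {0..0} \<sigma> *\<^sub>R F (y + \<sigma> *\<^sub>R h)) = (LINT \<sigma>|(lborel::real measure). 0)"
        proof (rule integral_cong_AE)
          have "AE \<sigma> in lborel. \<sigma> \<noteq> (0::real)" by (rule AE_lborel_singleton)
          then show "AE \<sigma> in lborel. indicator {0..0::real} \<sigma> *\<^sub>R F (y + \<sigma> *\<^sub>R h) = 0" by eventually_elim auto
        qed measurable
        then have p0: "\<psi> 0 = u y" by (simp add: \<psi>_def)
        have "ennreal (b - a) \<le> (\<integral>\<^sup>+\<tau>. indicator {0..1} \<tau> * ennreal (indicator {\<tau>. a < norm (u (y + \<tau> *\<^sub>R h)) \<and> norm (u (y + \<tau> *\<^sub>R h)) < b} \<tau> * norm (F (y + \<tau> *\<^sub>R h))) \<partial>lborel)"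
        proof (rule climbing_path[where z = "u y", OF elim(3)])
          show "(\<lambda>\<tau>. F (y + \<tau> *\<^sub>R h)) \<in> borel_measurable borel" by measurable
        qed (use elim(2) True p0 p1 ab in \<open>auto simp: \<psi>_def\<close>)
        then have "ennreal ((b - a) powr p) \<le> (\<integral>\<^sup>+\<tau>. indicator {0..1} \<tau> * ennreal ((indicator {\<tau>. a < norm (u (y + \<tau> *\<^sub>R h)) \<and> norm (u (y + \<tau> *\<^sub>R h)) < b} \<tau> * norm (F (y + \<tau> *\<^sub>R h))) powr p) \<partial>lborel)"
          using ab by (intro powr_integral_Jensen p) auto
        also have "\<dots> \<le> (\<integral>\<^sup>+\<tau>. indicator {0..1} \<tau> * I (y + \<tau> *\<^sub>R h) \<partial>lborel)"
        proof (intro nn_integral_mono mult_left_mono)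
          fix \<tau> :: real
          have "norm (F (y + \<tau> *\<^sub>R h)) powr p \<le> (norm h * W (y + \<tau> *\<^sub>R h)) powr p"
            using FW p by (intro powr_mono2) auto
          also have "\<dots> = norm h powr p * W (y + \<tau> *\<^sub>R h) powr p"
            by (simp add: powr_mult)
          finally show "ennreal ((indicator {\<tau>. a < norm (u (y + \<tau> *\<^sub>R h)) \<and> norm (u (y + \<tau> *\<^sub>R h)) < b} \<tau> * norm (F (y + \<tau> *\<^sub>R h))) powr p) \<le> I (y + \<tau> *\<^sub>R h)"
            using p by (auto simp: I_def indicator_def intro!: ennreal_leI)
        qed auto
        finally show ?thesis using True by simp
      qed simp
    qed
  qed
  have "ennreal ((b - a) powr p) * (\<integral>\<^sup>+y. indicator {y. norm (u y) \<le> a \<and> b < norm (u (y + h))} y \<partial>lborel)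
     = (\<integral>\<^sup>+y. ennreal ((b - a) powr p) * indicator {y. norm (u y) \<le> a \<and> b < norm (u (y + h))} y \<partial>lborel)"
    by (rule nn_integral_cmult[symmetric]) measurable
  also have "\<dots> \<le> (\<integral>\<^sup>+y. \<integral>\<^sup>+\<tau>. indicator {0..1} \<tau> * I (y + \<tau> *\<^sub>R h) \<partial>lborel \<partial>lborel)"
    by (rule nn_integral_mono_AE[OF line])
  also have "\<dots> = (\<integral>\<^sup>+\<tau>. \<integral>\<^sup>+y. indicator {0..1} \<tau> * I (y + \<tau> *\<^sub>R h) \<partial>lborel \<partial>lborel)"
    by (rule lborel_pair.Fubini'[symmetric]) measurable
  also have "\<dots> = (\<integral>\<^sup>+\<tau>. (\<integral>\<^sup>+y. I y \<partial>lborel) * indicator {0..1} (\<tau>::real) \<partial>lborel)"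
  proof (rule nn_integral_cong)
    fix \<tau> :: real
    have "(\<integral>\<^sup>+y. indicator {0..1} \<tau> * I (y + \<tau> *\<^sub>R h) \<partial>lborel) = indicator {0..1} \<tau> * (\<integral>\<^sup>+y. I (y + \<tau> *\<^sub>R h) \<partial>lborel)"
      by (rule nn_integral_cmult) measurable
    then show "(\<integral>\<^sup>+y. indicator {0..1} \<tau> * I (y + \<tau> *\<^sub>R h) \<partial>lborel) = (\<integral>\<^sup>+y. I y \<partial>lborel) * indicator {0..1} \<tau>"
      by (simp add: nn_integral_lborel_shift mult.commute)
  qed
  also have "\<dots> = (\<integral>\<^sup>+y. I y \<partial>lborel)"
    by (subst nn_integral_cmult) auto
  also have "\<dots> = (\<integral>\<^sup>+x. ennreal (norm h powr p) * (indicator {x. a < norm (u x) \<and> norm (u x) < b} x * ennreal (W x powr p)) \<partial>lborel)"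
    unfolding I_def by (intro nn_integral_cong) (simp add: ennreal_mult mult_ac)
  also have "\<dots> = ennreal (norm h powr p) * (\<integral>\<^sup>+x. indicator {x. a < norm (u x) \<and> norm (u x) < b} x * ennreal (W x powr p) \<partial>lborel)"
    by (rule nn_integral_cmult) measurable
  finally show ?thesis unfolding W_def .
qed

text \<open>
  The energy between two levels is the integral of the power of the gradient over the points with values
  strictly between them. \<open>translation_climbing\<close> is integrated over all translations shorter than \<open>r\<close>.
\<close>

lemma weak_gradient_climbing_bound:
  fixes u :: "real^'n::finite \<Rightarrow> 'b::euclidean_space"
  defines "\<omega> \<equiv> measure lborel (ball (0::real^'n) 1)"
  assumes p: "p \<ge> 1" and u: "loc_int u" and w: "\<And>i. loc_int (w i)" "\<And>i. weak_dir (axis i 1) u (w i)"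
    and E: "ennreal \<omega> * (\<integral>\<^sup>+x. ennreal ((\<Sum>i\<in>UNIV. norm (w i x)) powr p) \<partial>lborel) \<le> 1"
  obtains D where "climbing_bound 1 p D (\<lambda>x. norm (u x))" "\<And>a b. D a b \<ge> 0"
    "\<And>K. (\<Sum>k<K. D (2 ^ k) (2 ^ Suc k)) \<le> 1" "\<And>a b. 0 < a \<Longrightarrow> a < b \<Longrightarrow> D a b \<le> 1"
proof -
  define f where "f = (\<lambda>x. norm (u x))"
  define W where "W = (\<lambda>x. \<Sum>i\<in>UNIV. norm (w i x))"
  have [measurable]: "u \<in> borel_measurable borel" "\<And>i. w i \<in> borel_measurable borel"
    by (rule loc_int_measurable u w)+
  have [measurable]: "W \<in> borel_measurable borel" "f \<in> borel_measurable borel" unfolding W_def f_def by measurable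
  have w0: "\<omega> \<ge> 0" by (simp add: \<omega>_def)
  define e where "e = (\<lambda>a b. ennreal \<omega> * (\<integral>\<^sup>+x. indicator {x. a < f x \<and> f x < b} x * ennreal (W x powr p) \<partial>lborel))"
  have e1: "e a b \<le> 1" for a b
  proof -
    have "e a b \<le> ennreal \<omega> * (\<integral>\<^sup>+x. ennreal (W x powr p) \<partial>lborel)"
      unfolding e_def by (intro mult_left_mono nn_integral_mono) (auto simp: indicator_def)
    also have "\<dots> \<le> 1" using E by (simp add: W_def)
    finally show ?thesis .
  qed
  define D where "D = (\<lambda>a b. enn2real (e a b))"
  have eD: "e a b = ennreal (D a b)" for a b
    unfolding D_def using e1[of a b] by (simp add: ennreal_enn2real order_le_less_trans)
  show ?thesis
  proof (rule that[of D])
    show D0: "D a b \<ge> 0" for a b by (simp add: D_def)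
    show "D a b \<le> 1" for a b using e1 D0 unfolding eD by (simp flip: ennreal_1)
    show "(\<Sum>k<K. D (2 ^ k) (2 ^ Suc k)) \<le> 1" for K
    proof -
      have "ennreal (\<Sum>k<K. D (2 ^ k) (2 ^ Suc k)) = (\<Sum>k<K. e (2 ^ k) (2 ^ Suc k))"
        by (subst sum_ennreal[symmetric]) (auto simp: D0 eD)
      also have "\<dots> = ennreal \<omega> * (\<integral>\<^sup>+x. (\<Sum>k<K. indicator {x. 2 ^ k < f x \<and> f x < 2 ^ Suc k} x * ennreal (W x powr p)) \<partial>lborel)"
      proof -
        have "(\<integral>\<^sup>+x. (\<Sum>k<K. indicator {x. 2 ^ k < f x \<and> f x < 2 ^ Suc k} x * ennreal (W x powr p)) \<partial>lborel)
          = (\<Sum>k<K. \<integral>\<^sup>+x. indicator {x. 2 ^ k < f x \<and> f x < 2 ^ Suc k} x * ennreal (W x powr p) \<partial>lborel)"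
          by (rule nn_integral_sum) measurable
        note eq = this
        show ?thesis unfolding e_def eq by (rule sum_distrib_left[symmetric])
      qed
      also have "\<dots> \<le> ennreal \<omega> * (\<integral>\<^sup>+x. ennreal (W x powr p) \<partial>lborel)"
      proof (intro mult_left_mono nn_integral_mono)
        fix x
        have dis: "disjoint_family_on (\<lambda>k. {x. 2 ^ k < f x \<and> f x < 2 ^ Suc k}) {..<K}"
        proof -
          have less: "\<not> (2 ^ k < f x \<and> f x < 2 ^ Suc k \<and> 2 ^ l < f x \<and> f x < 2 ^ Suc l)" if "k < l" for k l x
          proof -
            have "(2::real) ^ Suc k \<le> 2 ^ l" using that by (intro power_increasing) auto
            then show ?thesis by linarith
          qed
          show ?thesis unfolding disjoint_family_on_def
          proof (intro ballI impI)
            fix k l :: nat assume "k \<noteq> l"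
            then consider "k < l" | "l < k" by linarith
            then show "{x. 2 ^ k < f x \<and> f x < 2 ^ Suc k} \<inter> {x. 2 ^ l < f x \<and> f x < 2 ^ Suc l} = {}"
              by cases (use less in blast)+
          qed
        qed
        have "(\<Sum>k<K. indicator {x. 2 ^ k < f x \<and> f x < 2 ^ Suc k} x) = (indicator (\<Union>k<K. {x. 2 ^ k < f x \<and> f x < 2 ^ Suc k}) x :: ennreal)"
          by (rule indicator_UN_disjoint[symmetric, OF _ dis]) simp
        also have "\<dots> \<le> 1" by (auto simp: indicator_def)
        finally have "(\<Sum>k<K. indicator {x. 2 ^ k < f x \<and> f x < 2 ^ Suc k} x) * ennreal (W x powr p) \<le> 1 * ennreal (W x powr p)"
          by (rule mult_right_mono) simp
        then show "(\<Sum>k<K. indicator {x. 2 ^ k < f x \<and> f x < 2 ^ Suc k} x * ennreal (W x powr p)) \<le> ennreal (W x powr p)"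
          by (simp add: sum_distrib_right)
      qed auto
      also have "\<dots> \<le> 1" using E by (simp add: W_def)
      finally show ?thesis by (simp flip: ennreal_1)
    qed
    show "climbing_bound 1 p D (\<lambda>x. norm (u x))"
      unfolding climbing_bound_def f_def[symmetric]
    proof (intro allI impI)
      fix a b r :: real assume ab: "0 < a" "a < b" and r: "0 < r"
      define J where "J = (\<integral>\<^sup>+x. indicator {x. a < f x \<and> f x < b} x * ennreal (W x powr p) \<partial>lborel)"
      let ?c = "ennreal ((b - a) powr p)"
      have "?c * (\<integral>\<^sup>+x. indicator {x. b < f x} x * emeasure lborel (ball x r \<inter> {y. f y \<le> a}) \<partial>lborel)
         = ?c * (\<integral>\<^sup>+x. \<integral>\<^sup>+y. (if b < f x \<and> dist x y < r \<and> f y \<le> a then 1 else 0) \<partial>lborel \<partial>lborel)"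
        by (simp only: indicator_times_emeasure_ball[OF \<open>f \<in> borel_measurable borel\<close>])
      also have "\<dots> = ?c * (\<integral>\<^sup>+y. \<integral>\<^sup>+x. (if b < f x \<and> dist x y < r \<and> f y \<le> a then 1 else 0) \<partial>lborel \<partial>lborel)"
        by (rule arg_cong[where f = "(*) ?c"], rule lborel_pair.Fubini'[symmetric]) measurable
      also have "\<dots> = ?c * (\<integral>\<^sup>+y. \<integral>\<^sup>+h. (if b < f (h + y) \<and> norm h < r \<and> f y \<le> a then 1 else 0) \<partial>lborel \<partial>lborel)"
      proof -
        have "(\<integral>\<^sup>+x. (if b < f x \<and> dist x y < r \<and> f y \<le> a then 1 else 0) \<partial>lborel)
           = (\<integral>\<^sup>+h. (if b < f (h + y) \<and> norm h < r \<and> f y \<le> a then 1 else 0) \<partial>lborel)" for y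
          using nn_integral_lborel_shift[of "\<lambda>x. if b < f x \<and> dist x y < r \<and> f y \<le> a then 1 else 0" y]
          by (simp add: dist_norm)
        then show ?thesis by simp
      qed
      also have "\<dots> = ?c * (\<integral>\<^sup>+h. \<integral>\<^sup>+y. (if b < f (h + y) \<and> norm h < r \<and> f y \<le> a then 1 else 0) \<partial>lborel \<partial>lborel)"
        by (rule arg_cong[where f = "(*) ?c"], rule lborel_pair.Fubini'[symmetric]) measurable
      also have "\<dots> = (\<integral>\<^sup>+h. ?c * (\<integral>\<^sup>+y. (if b < f (h + y) \<and> norm h < r \<and> f y \<le> a then 1 else 0) \<partial>lborel) \<partial>lborel)"
        by (rule nn_integral_cmult[symmetric]) measurable
      also have "\<dots> \<le> (\<integral>\<^sup>+h. (ennreal (r powr p) * J) * indicator (ball 0 r) (h::real^'n) \<partial>lborel)"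
      proof (rule nn_integral_mono)
        fix h :: "real^'n"
        show "?c * (\<integral>\<^sup>+y. (if b < f (h + y) \<and> norm h < r \<and> f y \<le> a then 1 else 0) \<partial>lborel) \<le> (ennreal (r powr p) * J) * indicator (ball 0 r) h"
        proof (cases "norm h < r")
          case True
          have "?c * (\<integral>\<^sup>+y. (if b < f (h + y) \<and> norm h < r \<and> f y \<le> a then 1 else 0) \<partial>lborel)
             = ?c * (\<integral>\<^sup>+y. indicator {y. norm (u y) \<le> a \<and> b < norm (u (y + h))} y \<partial>lborel)"
            using True by (intro arg_cong2[where f = "(*)"] nn_integral_cong refl) (auto simp: f_def indicator_def add.commute)
          also have "\<dots> \<le> ennreal (norm h powr p) * J"
            unfolding J_def W_def f_def by (rule translation_climbing[OF p u w ab(2)])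
          also have "\<dots> \<le> ennreal (r powr p) * J"
            using True p by (intro mult_right_mono ennreal_leI powr_mono2) auto
          finally show ?thesis using True by simp
        qed simp
      qed
      also have "\<dots> = (ennreal (r powr p) * J) * emeasure lborel (ball (0::real^'n) r)"
        by (subst nn_integral_cmult_indicator) auto
      also have "emeasure lborel (ball (0::real^'n) r) = ennreal (r powr real CARD('n) * \<omega>)"
      proof -
        have "measure lborel (ball (0::real^'n) r) = r powr real CARD('n) * \<omega>"
          using content_ball_conv_unit_ball[of r "0::real^'n"] r by (simp add: \<omega>_def powr_realpow)
        moreover have "emeasure lborel (ball (0::real^'n) r) < \<infinity>" by (rule emeasure_bounded_finite) simp
        ultimately show ?thesis by (simp add: emeasure_eq_ennreal_measure)
      qed
      also have "(ennreal (r powr p) * J) * ennreal (r powr real CARD('n) * \<omega>)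
          = ennreal (r powr (real CARD('n) + 1 * p)) * (ennreal \<omega> * J)"
        using w0 by (simp add: powr_add ennreal_mult mult_ac)
      also have "ennreal \<omega> * J = ennreal (D a b)" unfolding eD[symmetric] e_def J_def ..
      finally show "?c * (\<integral>\<^sup>+x. indicator {x. b < f x} x * emeasure lborel (ball x r \<inter> {y. f y \<le> a}) \<partial>lborel)
          \<le> ennreal (r powr (real CARD('n) + 1 * p) * D a b)"
        using D0 by (simp add: ennreal_mult)
    qed
  qed
qed

section \<open>Bounds in Lebesgue spaces\<close>

text \<open>
  Convexity on the open half line, extended to the end point zero.
\<close>

lemma powr_convex_nonneg:
  fixes x y t p :: real
  assumes p: "p \<ge> 1" and t: "0 \<le> t" "t \<le> 1" and x: "x \<ge> 0" and y: "y \<ge> 0"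
  shows "((1 - t) * x + t * y) powr p \<le> (1 - t) * x powr p + t * y powr p"
proof -
  have small: "(s * z) powr p \<le> s * z powr p" if "0 \<le> s" "s \<le> 1" "z \<ge> 0" for s z :: real
  proof -
    have "s powr p \<le> s"
    proof (cases "s = 0")
      case False
      then have "s powr p \<le> s powr 1" using that p by (intro powr_mono') auto
      then show ?thesis using that by simp
    qed simp
    then show ?thesis using that by (simp add: powr_mult mult_right_mono)
  qed
  show ?thesis
  proof (cases "x = 0 \<or> y = 0")
    case True
    then show ?thesis using small[of t y] small[of "1 - t" x] t x y by auto
  next
    case False
    then have "x > 0" "y > 0" using x y by auto
    then show ?thesis
      using convex_onD[OF powr_convex[OF p] t, of x y] by simp
  qed
qed

text \<open>
  Convexity of the power function for the normalised functions \<open>F / A\<close> and \<open>G / B\<close>.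
\<close>

lemma Minkowski_nn_integral:
  fixes F G :: "'a \<Rightarrow> real"
  assumes p: "p \<ge> 1" and [measurable]: "F \<in> borel_measurable M" "G \<in> borel_measurable M"
    and F0: "\<And>x. F x \<ge> 0" and G0: "\<And>x. G x \<ge> 0" and A: "A > 0" and B: "B > 0"
    and F: "(\<integral>\<^sup>+x. ennreal (F x powr p) \<partial>M) \<le> ennreal (A powr p)"
    and G: "(\<integral>\<^sup>+x. ennreal (G x powr p) \<partial>M) \<le> ennreal (B powr p)"
  shows "(\<integral>\<^sup>+x. ennreal ((F x + G x) powr p) \<partial>M) \<le> ennreal ((A + B) powr p)"
proof -
  define t where "t = B / (A + B)"
  have t: "0 \<le> t" "t \<le> 1" "1 - t = A / (A + B)" using A B by (auto simp: t_def field_simps)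
  define a where "a = (A + B) powr p * (1 - t) / A powr p"
  define b where "b = (A + B) powr p * t / B powr p"
  have ab: "a \<ge> 0" "b \<ge> 0" using A B t by (auto simp: a_def b_def)
  have pw: "(F x + G x) powr p \<le> a * F x powr p + b * G x powr p" for x
  proof -
    have eq: "(1 - t) * (F x / A) + t * (G x / B) = (F x + G x) / (A + B)"
    proof -
      have "(1 - t) * (F x / A) = F x / (A + B)" using A B by (simp add: t(3))
      moreover have "t * (G x / B) = G x / (A + B)" using A B by (simp add: t_def)
      ultimately show ?thesis by (simp add: add_divide_distrib)
    qed
    have "((F x + G x) / (A + B)) powr p \<le> (1 - t) * (F x / A) powr p + t * (G x / B) powr p"
      unfolding eq[symmetric] using F0[of x] G0[of x] A B by (intro powr_convex_nonneg p t) auto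
    then have "(A + B) powr p * ((F x + G x) / (A + B)) powr p \<le> (A + B) powr p * ((1 - t) * (F x / A) powr p + t * (G x / B) powr p)"
      by (intro mult_left_mono) auto
    then show ?thesis
      using F0[of x] G0[of x] A B by (simp add: powr_divide a_def b_def distrib_left)
  qed
  have "(\<integral>\<^sup>+x. ennreal ((F x + G x) powr p) \<partial>M) \<le> (\<integral>\<^sup>+x. ennreal a * ennreal (F x powr p) + ennreal b * ennreal (G x powr p) \<partial>M)"
    using pw ab by (intro nn_integral_mono) (simp add: ennreal_mult[symmetric] ennreal_leI flip: ennreal_plus)
  also have "\<dots> = ennreal a * (\<integral>\<^sup>+x. ennreal (F x powr p) \<partial>M) + ennreal b * (\<integral>\<^sup>+x. ennreal (G x powr p) \<partial>M)"
    by (simp add: nn_integral_add nn_integral_cmult)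
  also have "\<dots> \<le> ennreal a * ennreal (A powr p) + ennreal b * ennreal (B powr p)"
    by (intro add_mono mult_left_mono F G) auto
  also have "\<dots> = ennreal ((A + B) powr p)"
  proof -
    have "a * A powr p + b * B powr p = (A + B) powr p * (1 - t) + (A + B) powr p * t"
      using A B by (simp add: a_def b_def)
    also have "\<dots> = (A + B) powr p" by (simp add: algebra_simps)
    finally show ?thesis using ab by (simp add: ennreal_mult[symmetric] flip: ennreal_plus)
  qed
  finally show ?thesis .
qed

text \<open>
  The bounds \<open>A\<close> and \<open>B\<close> of \<open>Minkowski_nn_integral\<close> are positive numbers, hence the norms are enlarged by \<open>\<delta>\<close>.
\<close>

lemma Minkowski_integral:
  fixes F G :: "'a \<Rightarrow> real"
  assumes p: "p \<ge> 1" and m[measurable]: "F \<in> borel_measurable M" "G \<in> borel_measurable M"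
    and F0: "\<And>x. F x \<ge> 0" and G0: "\<And>x. G x \<ge> 0"
    and F: "integrable M (\<lambda>x. F x powr p)" and G: "integrable M (\<lambda>x. G x powr p)"
  shows "integrable M (\<lambda>x. (F x + G x) powr p)"
    "(LINT x|M. (F x + G x) powr p) powr (1 / p) \<le> (LINT x|M. F x powr p) powr (1 / p) + (LINT x|M. G x powr p) powr (1 / p)"
proof -
  define A where "A = (LINT x|M. F x powr p) powr (1 / p)"
  define B where "B = (LINT x|M. G x powr p) powr (1 / p)"
  have AB: "A \<ge> 0" "B \<ge> 0" by (auto simp: A_def B_def)
  have nn: "(\<integral>\<^sup>+x. ennreal (F x powr p) \<partial>M) = ennreal (A powr p)" "(\<integral>\<^sup>+x. ennreal (G x powr p) \<partial>M) = ennreal (B powr p)"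
    using p nn_integral_eq_integral[OF F] nn_integral_eq_integral[OF G]
    by (auto simp: A_def B_def powr_powr)
  have le: "(\<integral>\<^sup>+x. ennreal ((F x + G x) powr p) \<partial>M) \<le> ennreal ((A + B + 2 * \<delta>) powr p)" if d: "\<delta> > 0" for \<delta>
  proof -
    have "(\<integral>\<^sup>+x. ennreal ((F x + G x) powr p) \<partial>M) \<le> ennreal (((A + \<delta>) + (B + \<delta>)) powr p)"
      using AB d p by (intro Minkowski_nn_integral p m F0 G0) (auto simp: nn intro!: ennreal_leI powr_mono2)
    then show ?thesis by (simp add: algebra_simps)
  qed
  show int: "integrable M (\<lambda>x. (F x + G x) powr p)"
  proof (rule integrableI_bounded)
    have "ennreal ((A + B + 2 * 1) powr p) < \<infinity>" by simp
    with le[of 1] show "(\<integral>\<^sup>+x. ennreal (norm ((F x + G x) powr p)) \<partial>M) < \<infinity>"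
      by (simp add: order_le_less_trans)
  qed measurable
  define I where "I = (LINT x|M. (F x + G x) powr p)"
  have I0: "I \<ge> 0" unfolding I_def by (rule Bochner_Integration.integral_nonneg) simp
  have "I powr (1 / p) \<le> A + B"
  proof (rule field_le_epsilon)
    fix e :: real assume e: "e > 0"
    have "ennreal I \<le> ennreal ((A + B + 2 * (e / 2)) powr p)"
      unfolding I_def using nn_integral_eq_integral[OF int] le[of "e / 2"] e by simp
    then have "I \<le> (A + B + e) powr p" by simp
    then have "I powr (1 / p) \<le> ((A + B + e) powr p) powr (1 / p)" using I0 p by (intro powr_mono2) auto
    also have "\<dots> = A + B + e" using AB e p by (simp add: powr_powr)
    finally show "I powr (1 / p) \<le> A + B + e" .
  qed
  then show "(LINT x|M. (F x + G x) powr p) powr (1 / p) \<le> (LINT x|M. F x powr p) powr (1 / p) + (LINT x|M. G x powr p) powr (1 / p)"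
    by (simp add: I_def A_def B_def)
qed

text \<open>
  \<open>Lq_bound x A f\<close> bounds the norm of \<open>f\<close> in the Lebesgue space with exponent \<open>1 / x\<close> by \<open>A\<close>,
  where \<open>x = 0\<close> means the essential supremum. In terms of the reciprocal exponent the
  conditions in Hoelder's inequality and in the embeddings are linear.
\<close>

definition Lq_bound :: "real \<Rightarrow> real \<Rightarrow> (real^'n::finite \<Rightarrow> 'b::euclidean_space) \<Rightarrow> bool" where
  "Lq_bound x A f \<longleftrightarrow> f \<in> borel_measurable lebesgue \<and>
     (if x = 0 then AE z in lborel. norm (f z) \<le> A
      else (\<integral>\<^sup>+z. ennreal (norm (f z) powr (1 / x)) \<partial>lebesgue) \<le> ennreal (A powr (1 / x)))"

lemma Lq_bound_measurable: "Lq_bound x A f \<Longrightarrow> f \<in> borel_measurable lebesgue"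
  by (simp add: Lq_bound_def)

lemma Lq_bound_cong:
  assumes "Lq_bound x A f" "AE z in lborel. f z = g z"
  shows "Lq_bound x A g"
proof -
  have g: "g \<in> borel_measurable lebesgue"
    using measurable_lebesgue_AE[OF Lq_bound_measurable[OF assms(1)] assms(2)] .
  show ?thesis
  proof (cases "x = 0")
    case True
    then have "AE z in lborel. norm (f z) \<le> A" using assms(1) by (simp add: Lq_bound_def)
    with assms(2) have "AE z in lborel. norm (g z) \<le> A" by eventually_elim simp
    then show ?thesis using g True by (simp add: Lq_bound_def)
  next
    case False
    have "(\<integral>\<^sup>+z. ennreal (norm (f z) powr (1 / x)) \<partial>lebesgue) = (\<integral>\<^sup>+z. ennreal (norm (g z) powr (1 / x)) \<partial>lebesgue)"
      using AE_completion[OF assms(2)] by (intro nn_integral_cong_AE) (auto elim: eventually_mono)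
    then show ?thesis using assms(1) g False by (simp add: Lq_bound_def)
  qed
qed

lemma Lq_bound_borel:
  assumes "g \<in> borel_measurable borel"
  shows "Lq_bound x A g \<longleftrightarrow> (if x = 0 then AE z in lborel. norm (g z) \<le> A
      else (\<integral>\<^sup>+z. ennreal (norm (g z) powr (1 / x)) \<partial>lborel) \<le> ennreal (A powr (1 / x)))"
  using measurable_borel_lebesgue[OF assms] by (simp add: Lq_bound_def nn_integral_completion)

lemma Lq_bound_mono:
  assumes "Lq_bound x A f" "A \<le> B" "x \<ge> 0" "A \<ge> 0"
  shows "Lq_bound x B f"
proof (cases "x = 0")
  case True
  then show ?thesis using assms by (auto simp: Lq_bound_def elim: eventually_mono)
next
  case False
  have "ennreal (A powr (1 / x)) \<le> ennreal (B powr (1 / x))"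
    using assms False by (intro ennreal_leI powr_mono2) auto
  then show ?thesis using assms(1) False unfolding Lq_bound_def by (auto intro: order_trans)
qed

lemma nn_integral_scale_powr:
  fixes f :: "'a \<Rightarrow> 'b::real_normed_vector"
  assumes A: "A > 0" and [measurable]: "(\<lambda>z. norm (f z)) \<in> borel_measurable M"
    and le: "(\<integral>\<^sup>+z. ennreal (norm (f z) powr q) \<partial>M) \<le> ennreal (B powr q)" and B: "B \<ge> 0"
  shows "(\<integral>\<^sup>+z. ennreal ((norm (f z) / A) powr q) \<partial>M) \<le> ennreal ((B / A) powr q)"
proof -
  have "(\<integral>\<^sup>+z. ennreal ((norm (f z) / A) powr q) \<partial>M) = (\<integral>\<^sup>+z. ennreal (1 / A powr q) * ennreal (norm (f z) powr q) \<partial>M)"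
    using A by (intro nn_integral_cong) (simp add: powr_divide ennreal_mult[symmetric])
  also have "\<dots> = ennreal (1 / A powr q) * (\<integral>\<^sup>+z. ennreal (norm (f z) powr q) \<partial>M)"
    by (rule nn_integral_cmult) measurable
  also have "\<dots> \<le> ennreal (1 / A powr q) * ennreal (B powr q)" by (intro mult_left_mono le) auto
  also have "\<dots> = ennreal ((B / A) powr q)" using A B by (simp add: powr_divide ennreal_mult[symmetric])
  finally show ?thesis .
qed

lemma Lq_bound_scaleR:
  assumes f: "Lq_bound x A f" and c: "c > 0" and x: "x \<ge> 0" and A: "A \<ge> 0"
  shows "Lq_bound x (c * A) (\<lambda>z. c *\<^sub>R f z)"
proof -
  have fm[measurable]: "f \<in> borel_measurable lebesgue" using f by (rule Lq_bound_measurable)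
  show ?thesis
  proof (cases "x = 0")
    case True
    then show ?thesis using f c fm by (auto simp: Lq_bound_def elim!: eventually_mono)
  next
    case False
    have "(\<integral>\<^sup>+z. ennreal ((norm (f z) / (1 / c)) powr (1 / x)) \<partial>lebesgue) \<le> ennreal ((A / (1 / c)) powr (1 / x))"
      by (rule nn_integral_scale_powr) (use f False c A in \<open>auto simp: Lq_bound_def\<close>)
    then show ?thesis using False c fm by (auto simp: Lq_bound_def mult.commute)
  qed
qed

lemma Lq_bound_add:
  assumes f: "Lq_bound x A f" and g: "Lq_bound x B g" and x: "0 \<le> x" "x \<le> 1" and AB: "A > 0" "B > 0"
  shows "Lq_bound x (A + B) (\<lambda>z. f z + g z)"
proof -
  have m[measurable]: "f \<in> borel_measurable lebesgue" "g \<in> borel_measurable lebesgue"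
    using f g by (auto intro: Lq_bound_measurable)
  show ?thesis
  proof (cases "x = 0")
    case True
    then have "AE z in lborel. norm (f z) \<le> A" "AE z in lborel. norm (g z) \<le> B"
      using f g by (auto simp: Lq_bound_def)
    then have "AE z in lborel. norm (f z + g z) \<le> A + B"
      by eventually_elim (rule norm_triangle_mono)
    then show ?thesis using True by (simp add: Lq_bound_def)
  next
    case False
    have "(\<integral>\<^sup>+z. ennreal (norm (f z + g z) powr (1 / x)) \<partial>lebesgue) \<le> (\<integral>\<^sup>+z. ennreal ((norm (f z) + norm (g z)) powr (1 / x)) \<partial>lebesgue)"
      using False x by (intro nn_integral_mono ennreal_leI powr_mono2 norm_triangle_ineq) auto
    also have "\<dots> \<le> ennreal ((A + B) powr (1 / x))"
      by (rule Minkowski_nn_integral) (use f g x False AB in \<open>auto simp: Lq_bound_def\<close>)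
    finally show ?thesis using False by (simp add: Lq_bound_def)
  qed
qed

text \<open>
  Hoelder's inequality: Young's inequality is integrated for the normalised functions.
\<close>

lemma Lq_bound_mult:
  fixes f g :: "real^'n::finite \<Rightarrow> 'b::{real_normed_field,euclidean_space}"
  assumes f: "Lq_bound x A f" and g: "Lq_bound y B g" and x: "0 \<le> x" and y: "0 \<le> y" and AB: "A > 0" "B > 0"
  shows "Lq_bound (x + y) (A * B) (\<lambda>z. f z * g z)"
proof -
  have m[measurable]: "f \<in> borel_measurable lebesgue" "g \<in> borel_measurable lebesgue"
    using f g by (auto intro: Lq_bound_measurable)
  have fgm: "(\<lambda>z. f z * g z) \<in> borel_measurable lebesgue" by measurable
  have one: "(\<integral>\<^sup>+z. ennreal (norm (u z * v z) powr (1 / c)) \<partial>lebesgue) \<le> ennreal ((a * b) powr (1 / c))"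
    if "AE z in lborel. norm (u z) \<le> a" "(\<integral>\<^sup>+z. ennreal (norm (v z) powr (1 / c)) \<partial>lebesgue) \<le> ennreal (b powr (1 / c))"
      "c > 0" "a > 0" "b > 0" "v \<in> borel_measurable lebesgue" for a b c and u v :: "real^'n \<Rightarrow> 'b"
  proof -
    have [measurable]: "v \<in> borel_measurable lebesgue" by fact
    have "(\<integral>\<^sup>+z. ennreal (norm (u z * v z) powr (1 / c)) \<partial>lebesgue) \<le> (\<integral>\<^sup>+z. ennreal (a powr (1 / c)) * ennreal (norm (v z) powr (1 / c)) \<partial>lebesgue)"
    proof (rule nn_integral_mono_AE)
      show "AE z in lebesgue. ennreal (norm (u z * v z) powr (1 / c)) \<le> ennreal (a powr (1 / c)) * ennreal (norm (v z) powr (1 / c))"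
        using AE_completion[OF that(1)]
      proof eventually_elim
        case (elim z)
        have "norm (u z * v z) powr (1 / c) = norm (u z) powr (1 / c) * norm (v z) powr (1 / c)"
          by (simp add: norm_mult powr_mult)
        also have "\<dots> \<le> a powr (1 / c) * norm (v z) powr (1 / c)"
          using elim that by (intro mult_right_mono powr_mono2) auto
        finally show ?case by (simp add: ennreal_mult[symmetric] ennreal_leI)
      qed
    qed
    also have "\<dots> = ennreal (a powr (1 / c)) * (\<integral>\<^sup>+z. ennreal (norm (v z) powr (1 / c)) \<partial>lebesgue)"
      by (rule nn_integral_cmult) measurable
    also have "\<dots> \<le> ennreal (a powr (1 / c)) * ennreal (b powr (1 / c))" by (intro mult_left_mono that) auto
    also have "\<dots> = ennreal ((a * b) powr (1 / c))" using that by (simp add: powr_mult ennreal_mult[symmetric])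
    finally show ?thesis .
  qed
  consider "x = 0" "y = 0" | "x = 0" "y > 0" | "x > 0" "y = 0" | "x > 0" "y > 0" using x y by linarith
  then show ?thesis
  proof cases
    case 1
    then have "AE z in lborel. norm (f z) \<le> A" "AE z in lborel. norm (g z) \<le> B"
      using f g by (auto simp: Lq_bound_def)
    then have "AE z in lborel. norm (f z * g z) \<le> A * B"
      by eventually_elim (use AB in \<open>auto simp: norm_mult intro: mult_mono\<close>)
    then show ?thesis using 1 fgm by (simp add: Lq_bound_def)
  next
    case 2
    then show ?thesis using one[of f A g y B] f g fgm AB m by (simp add: Lq_bound_def)
  next
    case 3
    then show ?thesis using one[of g B f x A] f g fgm AB m by (simp add: Lq_bound_def mult.commute)
  next
    case 4
    define q where "q = 1 / (x + y)"
    have q: "q > 0" using 4 by (simp add: q_def)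
    have nf: "(\<integral>\<^sup>+z. ennreal ((norm (f z) / A) powr (1 / x)) \<partial>lebesgue) \<le> 1"
      using nn_integral_scale_powr[of A f lebesgue "1 / x" A] f AB 4 by (simp add: Lq_bound_def)
    have ng: "(\<integral>\<^sup>+z. ennreal ((norm (g z) / B) powr (1 / y)) \<partial>lebesgue) \<le> 1"
      using nn_integral_scale_powr[of B g lebesgue "1 / y" B] g AB 4 by (simp add: Lq_bound_def)
    have xy: "x * q \<ge> 0" "y * q \<ge> 0" "x * q + y * q = 1" using 4 q by (auto simp: q_def simp flip: add_divide_distrib)
    have pw: "norm (f z * g z) powr q \<le> (A * B) powr q * (x * q) * (norm (f z) / A) powr (1 / x) + (A * B) powr q * (y * q) * (norm (g z) / B) powr (1 / y)" for z
    proof (cases "f z = 0 \<or> g z = 0")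
      case True
      have "0 \<le> (A * B) powr q * (x * q) * (norm (f z) / A) powr (1 / x) + (A * B) powr q * (y * q) * (norm (g z) / B) powr (1 / y)"
        by (intro add_nonneg_nonneg mult_nonneg_nonneg[OF mult_nonneg_nonneg] powr_ge_zero xy(1,2))
      moreover have "norm (f z * g z) powr q = 0" using True by auto
      ultimately show ?thesis by linarith
    next
      case False
      define a where "a = (norm (f z) / A) powr (1 / x)"
      define b where "b = (norm (g z) / B) powr (1 / y)"
      have ab: "a > 0" "b > 0" using False AB by (auto simp: a_def b_def)
      have "norm (f z * g z) powr q = (A * B) powr q * ((norm (f z) / A) powr q * (norm (g z) / B) powr q)"
        using AB False by (simp add: norm_mult powr_mult powr_divide)
      also have "(norm (f z) / A) powr q = a powr (x * q)" using 4 by (simp add: a_def powr_powr)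
      also have "(norm (g z) / B) powr q = b powr (y * q)" using 4 by (simp add: b_def powr_powr)
      also have "(A * B) powr q * (a powr (x * q) * b powr (y * q)) \<le> (A * B) powr q * (x * q * a + y * q * b)"
        using Youngs_inequality_0[OF xy ab] by (intro mult_left_mono) auto
      finally show ?thesis by (simp add: a_def b_def distrib_left mult.assoc)
    qed
    have "(\<integral>\<^sup>+z. ennreal (norm (f z * g z) powr q) \<partial>lebesgue)
      \<le> (\<integral>\<^sup>+z. ennreal ((A * B) powr q * (x * q)) * ennreal ((norm (f z) / A) powr (1 / x)) + ennreal ((A * B) powr q * (y * q)) * ennreal ((norm (g z) / B) powr (1 / y)) \<partial>lebesgue)"
    proof (rule nn_integral_mono)
      fix z
      have "ennreal ((A * B) powr q * (x * q)) * ennreal ((norm (f z) / A) powr (1 / x)) + ennreal ((A * B) powr q * (y * q)) * ennreal ((norm (g z) / B) powr (1 / y))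
        = ennreal ((A * B) powr q * (x * q) * (norm (f z) / A) powr (1 / x) + (A * B) powr q * (y * q) * (norm (g z) / B) powr (1 / y))"
        using xy(1,2) by (simp add: ennreal_mult[symmetric] flip: ennreal_plus)
      then show "ennreal (norm (f z * g z) powr q) \<le> ennreal ((A * B) powr q * (x * q)) * ennreal ((norm (f z) / A) powr (1 / x)) + ennreal ((A * B) powr q * (y * q)) * ennreal ((norm (g z) / B) powr (1 / y))"
        using ennreal_leI[OF pw[of z]] by simp
    qed
    also have "\<dots> = ennreal ((A * B) powr q * (x * q)) * (\<integral>\<^sup>+z. ennreal ((norm (f z) / A) powr (1 / x)) \<partial>lebesgue) + ennreal ((A * B) powr q * (y * q)) * (\<integral>\<^sup>+z. ennreal ((norm (g z) / B) powr (1 / y)) \<partial>lebesgue)"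
      by (simp add: nn_integral_add nn_integral_cmult)
    also have "\<dots> \<le> ennreal ((A * B) powr q * (x * q)) * 1 + ennreal ((A * B) powr q * (y * q)) * 1"
      by (intro add_mono mult_left_mono nf ng) auto
    also have "\<dots> = ennreal ((A * B) powr q * (x * q) + (A * B) powr q * (y * q))"
      using xy by (simp flip: ennreal_plus)
    also have "(A * B) powr q * (x * q) + (A * B) powr q * (y * q) = (A * B) powr q"
      using xy(3) by (simp flip: distrib_left)
    finally show ?thesis using 4 fgm by (simp add: Lq_bound_def q_def)
  qed
qed

lemma Lq_bound_iff_Lp_norm:
  fixes f :: "real^'n::finite \<Rightarrow> 'b::{real_normed_field,euclidean_space}"
  assumes p: "p > 0" and A: "A \<ge> 0"
  shows "Lq_bound (1 / p) A f \<longleftrightarrow> f \<in> Lp_space p \<and> Lp_norm p f \<le> A"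
proof
  assume b: "Lq_bound (1 / p) A f"
  have [measurable]: "f \<in> borel_measurable lebesgue" using b by (rule Lq_bound_measurable)
  have le: "(\<integral>\<^sup>+z. ennreal (norm (f z) powr p) \<partial>lebesgue) \<le> ennreal (A powr p)"
    using b p by (simp add: Lq_bound_def)
  have int: "integrable lebesgue (\<lambda>z. norm (f z) powr p)"
  proof (rule integrableI_bounded)
    show "(\<integral>\<^sup>+z. ennreal (norm (norm (f z) powr p)) \<partial>lebesgue) < \<infinity>"
      using le by (simp add: order_le_less_trans)
  qed measurable
  have I0: "(LINT z|lebesgue. norm (f z) powr p) \<ge> 0" by (rule Bochner_Integration.integral_nonneg) simp
  have "(LINT z|lebesgue. norm (f z) powr p) \<le> A powr p"
    using le nn_integral_eq_integral[OF int] by simp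
  then have "Lp_norm p f \<le> (A powr p) powr (1 / p)"
    unfolding Lp_norm_def using I0 p by (intro powr_mono2) auto
  then show "f \<in> Lp_space p \<and> Lp_norm p f \<le> A"
    using int p A by (simp add: Lp_space_def powr_powr)
next
  assume b: "f \<in> Lp_space p \<and> Lp_norm p f \<le> A"
  then have f: "f \<in> borel_measurable lebesgue" and int: "integrable lebesgue (\<lambda>z. norm (f z) powr p)"
    by (auto simp: Lp_space_def)
  have I0: "(LINT z|lebesgue. norm (f z) powr p) \<ge> 0" by (rule Bochner_Integration.integral_nonneg) simp
  have "(LINT z|lebesgue. norm (f z) powr p) = Lp_norm p f powr p"
    using I0 p by (simp add: Lp_norm_def powr_powr)
  also have "\<dots> \<le> A powr p" using b p by (intro powr_mono2) (auto simp: Lp_norm_def)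
  finally have "ennreal (LINT z|lebesgue. norm (f z) powr p) \<le> ennreal (A powr p)" by (rule ennreal_leI)
  then show "Lq_bound (1 / p) A f"
    using f p nn_integral_eq_integral[OF int] by (simp add: Lq_bound_def)
qed

text \<open>
  Because \<open>norm z\<close> is at most \<open>1\<close> plus any power of it with exponent at least one.
\<close>

lemma Lq_bound_locally_integrable:
  fixes f :: "real^'n::finite \<Rightarrow> 'b::{real_normed_field,euclidean_space}"
  assumes f: "Lq_bound x A f" and x: "0 \<le> x" "x \<le> 1"
  shows "locally_integrable f"
proof -
  obtain g where g: "g \<in> borel_measurable borel" "AE z in lborel. f z = g z"
    using borel_representative[OF Lq_bound_measurable[OF f]] by blast
  have [measurable]: "g \<in> borel_measurable borel" by fact
  have gb: "Lq_bound x A g" by (rule Lq_bound_cong[OF f g(2)])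
  have "loc_int g"
  proof (rule loc_intI[OF g(1)])
    fix R
    have [measurable]: "cball (0::real^'n) R \<in> sets borel" by simp
    have cb: "emeasure lborel (cball (0::real^'n) R) < \<infinity>" by (rule emeasure_lborel_cball_finite)
    show "(\<integral>\<^sup>+x. indicator (cball 0 R) x * ennreal (norm (g x)) \<partial>lborel) < \<infinity>"
    proof (cases "x = 0")
      case True
      then have "AE z in lborel. norm (g z) \<le> A" using gb by (simp add: Lq_bound_def)
      then have "(\<integral>\<^sup>+z. indicator (cball 0 R) z * ennreal (norm (g z)) \<partial>lborel) \<le> (\<integral>\<^sup>+z. ennreal A * indicator (cball 0 R) (z::real^'n) \<partial>lborel)"
        by (intro nn_integral_mono_AE) (auto elim!: eventually_mono simp: indicator_def ennreal_leI)
      also have "\<dots> = ennreal A * emeasure lborel (cball (0::real^'n) R)" by (rule nn_integral_cmult_indicator) simp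
      also have "\<dots> < \<infinity>" using cb by (simp add: ennreal_mult_less_top)
      finally show ?thesis .
    next
      case False
      have "norm (g z) \<le> 1 + norm (g z) powr (1 / x)" for z
      proof (cases "norm (g z) \<le> 1")
        case True
        then show ?thesis by (simp add: add_increasing2)
      next
        case F: False
        then have "norm (g z) powr 1 \<le> norm (g z) powr (1 / x)" using x False by (intro powr_mono) auto
        then show ?thesis by simp
      qed
      then have "ennreal (norm (g z)) \<le> 1 + ennreal (norm (g z) powr (1 / x))" for z
        by (simp add: ennreal_leI flip: ennreal_1 ennreal_plus)
      then have "indicator (cball 0 R) z * ennreal (norm (g z)) \<le> indicator (cball 0 R) z + ennreal (norm (g z) powr (1 / x))" for z
        by (cases "z \<in> cball 0 R") simp_all
      then have "(\<integral>\<^sup>+z. indicator (cball 0 R) z * ennreal (norm (g z)) \<partial>lborel) \<le> (\<integral>\<^sup>+z. indicator (cball 0 R) z + ennreal (norm (g z) powr (1 / x)) \<partial>lborel)"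
        by (rule nn_integral_mono)
      also have "\<dots> = emeasure lborel (cball (0::real^'n) R) + (\<integral>\<^sup>+z. ennreal (norm (g z) powr (1 / x)) \<partial>lborel)"
        by (subst nn_integral_add) auto
      also have "\<dots> < \<infinity>"
        using cb gb False unfolding Lq_bound_borel[OF g(1)] by (auto simp: order_le_less_trans)
      finally show ?thesis .
    qed
  qed
  then show ?thesis using locally_integrable_iff[OF g] by simp
qed

section \<open>Sobolev embeddings of order at most one\<close>

text \<open>
  Joins the bounded and the integrable case. The disjunction on \<open>y\<close> excludes exactly the critical
  embedding into the bounded functions.
\<close>

lemma climbing_embedding:
  fixes \<theta> x y :: real
  assumes x: "0 < x" "x \<le> 1" and y: "0 \<le> y" "y \<le> x" "x - \<theta> / real CARD('n) \<le> y" "y > 0 \<or> x < \<theta> / real CARD('n)"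
  obtains C where "C > 0"
    "\<And>(u :: real^'n::finite \<Rightarrow> 'b::euclidean_space) D. climbing_bound \<theta> (1 / x) D (\<lambda>z. norm (u z)) \<Longrightarrow> u \<in> borel_measurable borel \<Longrightarrow>
       Lq_bound x 1 u \<Longrightarrow> (\<And>a b. D a b \<ge> 0) \<Longrightarrow> (\<And>K. (\<Sum>k<K. D (2 ^ k) (2 ^ Suc k)) \<le> 1) \<Longrightarrow>
       (\<And>a b. 0 < a \<Longrightarrow> a < b \<Longrightarrow> D a b \<le> 1) \<Longrightarrow> Lq_bound y C u"
proof (cases "y = 0")
  case True
  then have "1 / (1 / x) < \<theta> / real CARD('n)" "1 / x \<ge> 1" using x y by auto
  from climbing_bound_bounded[OF this(2,1)] obtain M where M: "M > 0"
    "\<And>(f :: real^'n \<Rightarrow> real) D. climbing_bound \<theta> (1 / x) D f \<Longrightarrow> f \<in> borel_measurable borel \<Longrightarrow>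
       (\<And>x. f x \<ge> 0) \<Longrightarrow> (\<integral>\<^sup>+z. ennreal (f z powr (1 / x)) \<partial>lborel) \<le> 1 \<Longrightarrow>
       (\<And>a b. D a b \<ge> 0) \<Longrightarrow> (\<And>a b. 0 < a \<Longrightarrow> a < b \<Longrightarrow> D a b \<le> 1) \<Longrightarrow> AE x in lborel. f x \<le> M"
    by blast
  show ?thesis
  proof (rule that[OF M(1)])
    fix u :: "real^'n \<Rightarrow> 'b" and D
    assume cb: "climbing_bound \<theta> (1 / x) D (\<lambda>z. norm (u z))" and um: "u \<in> borel_measurable borel"
      and ub: "Lq_bound x 1 u" and D: "\<And>a b. D a b \<ge> 0" "\<And>K. (\<Sum>k<K. D (2 ^ k) (2 ^ Suc k)) \<le> 1"
        "\<And>a b. 0 < a \<Longrightarrow> a < b \<Longrightarrow> D a b \<le> 1"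
    have "AE z in lborel. norm (u z) \<le> M"
      by (rule M(2)[OF cb _ _ _ D(1) D(3)]) (use um ub x in \<open>auto simp: Lq_bound_borel[OF um]\<close>)
    then show "Lq_bound y M u" using True by (simp add: Lq_bound_borel[OF um])
  qed
next
  case False
  then have y0: "y > 0" using y by simp
  have "1 / (1 / y) \<ge> 1 / (1 / x) - \<theta> / real CARD('n)" "1 / x \<ge> 1" "1 / y \<ge> 1 / x"
    using x y y0 by (auto simp: field_simps)
  from climbing_bound_Lq[OF this(2,3,1)] obtain C where C: "C > 0"
    "\<And>(f :: real^'n \<Rightarrow> real) D. climbing_bound \<theta> (1 / x) D f \<Longrightarrow> f \<in> borel_measurable borel \<Longrightarrow>
       (\<And>x. f x \<ge> 0) \<Longrightarrow> (\<integral>\<^sup>+z. ennreal (f z powr (1 / x)) \<partial>lborel) \<le> 1 \<Longrightarrow>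
       (\<And>a b. D a b \<ge> 0) \<Longrightarrow> (\<And>K. (\<Sum>k<K. D (2 ^ k) (2 ^ Suc k)) \<le> 1) \<Longrightarrow>
       (\<integral>\<^sup>+x. ennreal (f x powr (1 / y)) \<partial>lborel) \<le> ennreal (C powr (1 / y))"
    by blast
  show ?thesis
  proof (rule that[OF C(1)])
    fix u :: "real^'n \<Rightarrow> 'b" and D
    assume cb: "climbing_bound \<theta> (1 / x) D (\<lambda>z. norm (u z))" and um: "u \<in> borel_measurable borel"
      and ub: "Lq_bound x 1 u" and D: "\<And>a b. D a b \<ge> 0" "\<And>K. (\<Sum>k<K. D (2 ^ k) (2 ^ Suc k)) \<le> 1"
        "\<And>a b. 0 < a \<Longrightarrow> a < b \<Longrightarrow> D a b \<le> 1"
    have "(\<integral>\<^sup>+z. ennreal (norm (u z) powr (1 / y)) \<partial>lborel) \<le> ennreal (C powr (1 / y))"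
      by (rule C(2)[OF cb _ _ _ D(1) D(2)]) (use um ub x in \<open>auto simp: Lq_bound_borel[OF um]\<close>)
    then show "Lq_bound y C u" using False by (simp add: Lq_bound_borel[OF um])
  qed
qed

lemma loc_int_Lq_bound:
  fixes f :: "real^'n::finite \<Rightarrow> 'b::{real_normed_field,euclidean_space}"
  assumes "Lq_bound x A f" "0 \<le> x" "x \<le> 1"
  obtains g where "loc_int g" "AE z in lborel. f z = g z" "Lq_bound x A g"
  using locally_integrable_representative[OF Lq_bound_locally_integrable[OF assms]] Lq_bound_cong[OF assms(1)] by blast

lemma gradient_embedding:
  fixes x y :: real
  assumes x: "0 < x" "x \<le> 1" and y: "0 \<le> y" "y \<le> x" "x - 1 / real CARD('n) \<le> y" "y > 0 \<or> x < 1 / real CARD('n)"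
  obtains C where "C > 0"
    "\<And>(f :: real^'n::finite \<Rightarrow> 'b::{real_normed_field,euclidean_space}) F A. A > 0 \<Longrightarrow> Lq_bound x A f \<Longrightarrow>
       (\<And>i. has_weak_deriv (unit_index i) f (F i)) \<Longrightarrow> (\<And>i. Lq_bound x A (F i)) \<Longrightarrow> Lq_bound y (C * A) f"
proof -
  obtain C where C: "C > 0"
    "\<And>(u :: real^'n \<Rightarrow> 'b) D. climbing_bound 1 (1 / x) D (\<lambda>z. norm (u z)) \<Longrightarrow> u \<in> borel_measurable borel \<Longrightarrow>
       Lq_bound x 1 u \<Longrightarrow> (\<And>a b. D a b \<ge> 0) \<Longrightarrow> (\<And>K. (\<Sum>k<K. D (2 ^ k) (2 ^ Suc k)) \<le> 1) \<Longrightarrow>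
       (\<And>a b. 0 < a \<Longrightarrow> a < b \<Longrightarrow> D a b \<le> 1) \<Longrightarrow> Lq_bound y C u"
    using climbing_embedding[where 'n = 'n and 'b = 'b, OF x y] by blast
  define \<omega> where "\<omega> = measure lborel (ball (0::real^'n) 1)"
  define n where "n = real CARD('n)"
  define p where "p = 1 / x"
  have n: "n \<ge> 1" unfolding n_def by (simp add: Suc_le_eq)
  have p: "p \<ge> 1" using x by (simp add: p_def)
  \<comment> \<open>a factor so large that the gradient of \<open>f / (c A)\<close> has energy at most one\<close>
  define c where "c = n * n * max 1 \<omega>"
  have c1: "c \<ge> 1" using n by (auto simp: c_def intro!: mult_ge1_I) 
  have w0: "\<omega> \<ge> 0" by (simp add: \<omega>_def)
  have cp: "\<omega> * (n powr p * (n * (1 / c) powr p)) \<le> 1"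
  proof -
    have "\<omega> \<le> max 1 \<omega> powr p" 
    proof -
      have "max 1 \<omega> powr 1 \<le> max 1 \<omega> powr p" using p by (intro powr_mono) auto
      then show ?thesis by simp
    qed
    moreover have "n \<le> n powr p"
    proof -
      have "n powr 1 \<le> n powr p" using p n by (intro powr_mono) auto
      then show ?thesis using n by simp
    qed
    ultimately have "\<omega> * (n powr p * n) \<le> max 1 \<omega> powr p * (n powr p * n powr p)"
      using w0 n by (intro mult_mono) auto
    also have "\<dots> = c powr p" using n by (simp add: c_def powr_mult)
    finally show ?thesis using c1 by (simp add: powr_divide field_simps)
  qed
  show ?thesis
  proof (rule that)
    show "C * c > 0" using C c1 by simp
    fix f :: "real^'n \<Rightarrow> 'b" and F A
    assume A: "A > 0" and fb: "Lq_bound x A f" and w: "\<And>i. has_weak_deriv (unit_index i) f (F i)"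
      and Fb: "\<And>i. Lq_bound x A (F i)"
    obtain g where g: "loc_int g" "AE z in lborel. f z = g z" "Lq_bound x A g"
      using loc_int_Lq_bound[OF fb] x by auto
    have "\<exists>G. loc_int G \<and> (AE z in lborel. F i z = G z) \<and> Lq_bound x A G" for i
      using loc_int_Lq_bound[OF Fb[of i]] x by (metis less_imp_le)
    then obtain G where G: "\<And>i. loc_int (G i)" "\<And>i. AE z in lborel. F i z = G i z" "\<And>i. Lq_bound x A (G i)" by metis
    have wd: "weak_dir (axis i 1) g (G i)" for i
      using has_weak_deriv_unit_iff[OF loc_int_measurable[OF g(1)] g(2) loc_int_measurable[OF G(1)[of i]] G(2)[of i], of i] w[of i] by simp
    define k where "k = 1 / (c * A)"
    have k: "k > 0" using c1 A by (simp add: k_def)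
    define u where "u = (\<lambda>z. k *\<^sub>R g z)"
    define v where "v = (\<lambda>i z. k *\<^sub>R G i z)"
    have u: "loc_int u" unfolding u_def by (rule loc_int_scaleR[OF g(1)])
    have v: "loc_int (v i)" for i unfolding v_def by (rule loc_int_scaleR[OF G(1)])
    have um[measurable]: "u \<in> borel_measurable borel" by (rule loc_int_measurable[OF u])
    have vm[measurable]: "v i \<in> borel_measurable borel" for i by (rule loc_int_measurable[OF v])
    have kA: "k * A = 1 / c" using A by (simp add: k_def)
    have ub: "Lq_bound x 1 u"
      using Lq_bound_mono[OF Lq_bound_scaleR[OF g(3) k], of 1] x A c1 unfolding kA u_def by simp
    have vb: "(\<integral>\<^sup>+z. ennreal (norm (v i z) powr p) \<partial>lborel) \<le> ennreal ((1 / c) powr p)" for i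
      using Lq_bound_scaleR[OF G(3)[of i] k] x A unfolding kA v_def[symmetric]
      using Lq_bound_borel[OF vm[of i]] by (simp add: p_def v_def)
    have wuv: "weak_dir (axis i 1) u (v i)" for i
      unfolding weak_dir_def
    proof (intro allI impI)
      fix \<phi> :: "real^'n \<Rightarrow> real" assume "test_function \<phi>"
      then have "(LINT z|lborel. dir_deriv (axis i 1) \<phi> z *\<^sub>R g z) = - (LINT z|lborel. \<phi> z *\<^sub>R G i z)"
        using wd[of i] by (simp add: weak_dir_def)
      then have "k *\<^sub>R (LINT z|lborel. dir_deriv (axis i 1) \<phi> z *\<^sub>R g z) = - (k *\<^sub>R (LINT z|lborel. \<phi> z *\<^sub>R G i z))"
        by simp
      then show "(LINT z|lborel. dir_deriv (axis i 1) \<phi> z *\<^sub>R u z) = - (LINT z|lborel. \<phi> z *\<^sub>R v i z)"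
        unfolding u_def v_def scaleR_left_commute[of _ k] integral_scaleR_right .
    qed
    have E: "ennreal \<omega> * (\<integral>\<^sup>+z. ennreal ((\<Sum>i\<in>UNIV. norm (v i z)) powr p) \<partial>lborel) \<le> 1"
    proof -
      have pw: "(\<Sum>i\<in>UNIV. norm (v i z)) powr p \<le> n powr p * (\<Sum>i\<in>UNIV. norm (v i z) powr p)" for z
      proof -
        define m where "m = Max (range (\<lambda>i. norm (v i z)))"
        have "m \<in> range (\<lambda>i. norm (v i z))" unfolding m_def by (rule Max_in) auto
        then obtain j where j: "m = norm (v j z)" by auto
        have "norm (v i z) \<le> m" for i unfolding m_def by (rule Max_ge) auto
        then have "(\<Sum>i\<in>UNIV. norm (v i z)) \<le> n * m"
          using sum_bounded_above[of UNIV "\<lambda>i. norm (v i z)" m] by (simp add: n_def)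
        then have "(\<Sum>i\<in>UNIV. norm (v i z)) powr p \<le> (n * m) powr p"
          using p by (intro powr_mono2) (auto intro: sum_nonneg)
        also have "\<dots> = n powr p * norm (v j z) powr p" using n j by (simp add: powr_mult)
        also have "norm (v j z) powr p \<le> (\<Sum>i\<in>UNIV. norm (v i z) powr p)"
          by (rule member_le_sum) auto
        finally show ?thesis using n by (simp add: mult_left_mono)
      qed
      have "(\<integral>\<^sup>+z. ennreal ((\<Sum>i\<in>UNIV. norm (v i z)) powr p) \<partial>lborel) \<le> (\<integral>\<^sup>+z. ennreal (n powr p) * (\<Sum>i\<in>UNIV. ennreal (norm (v i z) powr p)) \<partial>lborel)"
        using pw by (intro nn_integral_mono) (simp add: sum_ennreal ennreal_mult[symmetric] sum_nonneg ennreal_leI)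
      also have "\<dots> = ennreal (n powr p) * (\<Sum>i\<in>UNIV. \<integral>\<^sup>+z. ennreal (norm (v i z) powr p) \<partial>lborel)"
        by (subst nn_integral_cmult, measurable, subst nn_integral_sum) auto
      also have "\<dots> \<le> ennreal (n powr p) * (\<Sum>i\<in>(UNIV::'n set). ennreal ((1 / c) powr p))"
        by (intro mult_left_mono sum_mono vb) auto
      also have "\<dots> = ennreal (n powr p * (n * (1 / c) powr p))"
        using n by (simp add: n_def ennreal_mult ennreal_of_nat_eq_real_of_nat)
      finally have "ennreal \<omega> * (\<integral>\<^sup>+z. ennreal ((\<Sum>i\<in>UNIV. norm (v i z)) powr p) \<partial>lborel) \<le> ennreal \<omega> * ennreal (n powr p * (n * (1 / c) powr p))"
        by (rule mult_left_mono) simp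
      also have "\<dots> = ennreal (\<omega> * (n powr p * (n * (1 / c) powr p)))" using w0 by (simp add: ennreal_mult')
      also have "\<dots> \<le> ennreal 1" by (rule ennreal_leI[OF cp])
      finally show ?thesis by simp
    qed
    obtain D where D: "climbing_bound 1 p D (\<lambda>z. norm (u z))" "\<And>a b. D a b \<ge> 0"
      "\<And>K. (\<Sum>k<K. D (2 ^ k) (2 ^ Suc k)) \<le> 1" "\<And>a b. 0 < a \<Longrightarrow> a < b \<Longrightarrow> D a b \<le> 1"
      using weak_gradient_climbing_bound[OF p u v wuv E[unfolded \<omega>_def]] by blast
    have "Lq_bound y C u" by (rule C(2)[OF D(1)[unfolded p_def] um ub D(2-4)])
    then have "Lq_bound y ((1 / k) * C) (\<lambda>z. (1 / k) *\<^sub>R u z)"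
      using k y C by (intro Lq_bound_scaleR) auto
    moreover have "(1 / k) * C = C * c * A" by (simp add: k_def)
    moreover have "(\<lambda>z. (1 / k) *\<^sub>R u z) = g" using k by (simp add: u_def)
    ultimately have "Lq_bound y (C * c * A) g" by simp
    then show "Lq_bound y (C * c * A) f"
      by (rule Lq_bound_cong) (use g(2) in \<open>auto elim: eventually_mono\<close>)
  qed
qed

lemma sigma_finite_lebesgue: "sigma_finite_measure (lebesgue :: (real^'n::finite) measure)"
proof
  show "\<exists>A. countable A \<and> A \<subseteq> sets (lebesgue :: (real^'n) measure) \<and> \<Union>A = space lebesgue \<and> (\<forall>a\<in>A. emeasure lebesgue a \<noteq> \<infinity>)"
  proof (intro exI[of _ "range (\<lambda>k::nat. cball (0::real^'n) (real k))"] conjI ballI)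
    show "range (\<lambda>k::nat. cball (0::real^'n) (real k)) \<subseteq> sets lebesgue" by auto
    show "\<Union>(range (\<lambda>k::nat. cball (0::real^'n) (real k))) = space lebesgue"
      by (auto simp: real_arch_simple)
    fix a assume "a \<in> range (\<lambda>k::nat. cball (0::real^'n) (real k))"
    then show "emeasure lebesgue a \<noteq> \<infinity>" using emeasure_lborel_cball_finite by (auto simp: less_top)
  qed simp
qed

text \<open>
  Writes the seminorm as an iterated integral of a Borel representative.
\<close>

lemma slobodeckij_iterated:
  fixes f :: "real^'n::finite \<Rightarrow> 'b::{real_normed_field,euclidean_space}"
  assumes fin: "slobodeckij_finite \<theta> p f" and g: "g \<in> borel_measurable borel" "AE z in lborel. f z = g z"
    and p: "p > 0" and A: "slobodeckij_seminorm \<theta> p f \<le> A"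
  shows "(\<integral>\<^sup>+x. \<integral>\<^sup>+y. ennreal (norm (g x - g y) powr p / norm (x - y) powr (real CARD('n) + \<theta> * p)) \<partial>lborel \<partial>lborel) \<le> ennreal (A powr p)"
proof -
  interpret sigma_finite_measure "lebesgue :: (real^'n) measure" by (rule sigma_finite_lebesgue)
  let ?k = "slobodeckij_kernel \<theta> p f"
  have int: "integrable (lebesgue \<Otimes>\<^sub>M lebesgue) ?k" using fin by (simp add: slobodeckij_finite_def)
  have k0: "?k z \<ge> 0" for z by (cases z) (simp add: slobodeckij_kernel_def)
  have km[measurable]: "?k \<in> borel_measurable (lebesgue \<Otimes>\<^sub>M lebesgue)" using int by (rule borel_measurable_integrable)
  have I0: "(LINT z|(lebesgue \<Otimes>\<^sub>M lebesgue). ?k z) \<ge> 0" using k0 by (intro Bochner_Integration.integral_nonneg) auto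
  have "(\<integral>\<^sup>+x. \<integral>\<^sup>+y. ennreal (norm (g x - g y) powr p / norm (x - y) powr (real CARD('n) + \<theta> * p)) \<partial>lborel \<partial>lborel)
     = (\<integral>\<^sup>+x. \<integral>\<^sup>+y. ennreal (?k (x, y)) \<partial>lborel \<partial>lborel)"
  proof (rule nn_integral_cong_AE)
    show "AE x in lborel. (\<integral>\<^sup>+y. ennreal (norm (g x - g y) powr p / norm (x - y) powr (real CARD('n) + \<theta> * p)) \<partial>lborel) = (\<integral>\<^sup>+y. ennreal (?k (x, y)) \<partial>lborel)"
      using g(2)
    proof eventually_elim
      case (elim x)
      show ?case
        by (rule nn_integral_cong_AE) (use g(2) elim in \<open>auto simp: slobodeckij_kernel_def elim: eventually_mono\<close>)
    qed
  qed
  also have "\<dots> = (\<integral>\<^sup>+x. \<integral>\<^sup>+y. ennreal (?k (x, y)) \<partial>lebesgue \<partial>lebesgue)"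
    by (simp only: nn_integral_completion)
  also have "\<dots> = (\<integral>\<^sup>+z. ennreal (?k z) \<partial>(lebesgue \<Otimes>\<^sub>M lebesgue))"
    by (rule nn_integral_fst) measurable
  also have "\<dots> = ennreal (LINT z|(lebesgue \<Otimes>\<^sub>M lebesgue). ?k z)"
    by (rule nn_integral_eq_integral[OF int]) (simp add: k0)
  also have "(LINT z|(lebesgue \<Otimes>\<^sub>M lebesgue). ?k z) = slobodeckij_seminorm \<theta> p f powr p"
    using I0 p by (simp add: slobodeckij_seminorm_def powr_powr)
  also have "ennreal \<dots> \<le> ennreal (A powr p)"
    using A p by (intro ennreal_leI powr_mono2) (auto simp: slobodeckij_seminorm_def)
  finally show ?thesis .
qed

lemma slobodeckij_embedding:
  fixes \<theta> x y :: real
  assumes \<theta>: "\<theta> > 0" and x: "0 < x" "x \<le> 1" and y: "0 \<le> y" "y \<le> x" "x - \<theta> / real CARD('n) \<le> y" "y > 0 \<or> x < \<theta> / real CARD('n)"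
  obtains C where "C > 0"
    "\<And>(f :: real^'n::finite \<Rightarrow> 'b::{real_normed_field,euclidean_space}) A. A > 0 \<Longrightarrow> Lq_bound x A f \<Longrightarrow>
       slobodeckij_finite \<theta> (1 / x) f \<Longrightarrow> slobodeckij_seminorm \<theta> (1 / x) f \<le> A \<Longrightarrow> Lq_bound y (C * A) f"
proof -
  obtain C where C: "C > 0"
    "\<And>(u :: real^'n \<Rightarrow> 'b) D. climbing_bound \<theta> (1 / x) D (\<lambda>z. norm (u z)) \<Longrightarrow> u \<in> borel_measurable borel \<Longrightarrow>
       Lq_bound x 1 u \<Longrightarrow> (\<And>a b. D a b \<ge> 0) \<Longrightarrow> (\<And>K. (\<Sum>k<K. D (2 ^ k) (2 ^ Suc k)) \<le> 1) \<Longrightarrow>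
       (\<And>a b. 0 < a \<Longrightarrow> a < b \<Longrightarrow> D a b \<le> 1) \<Longrightarrow> Lq_bound y C u"
    using climbing_embedding[where 'n = 'n and 'b = 'b, OF x y] by blast
  define p where "p = 1 / x"
  have p: "p \<ge> 1" using x by (simp add: p_def)
  show ?thesis
  proof (rule that[OF C(1)])
    fix f :: "real^'n \<Rightarrow> 'b" and A
    assume A: "A > 0" and fb: "Lq_bound x A f"
      and sf: "slobodeckij_finite \<theta> (1 / x) f" and ss: "slobodeckij_seminorm \<theta> (1 / x) f \<le> A"
    obtain g where g: "g \<in> borel_measurable borel" "AE z in lborel. f z = g z"
      using borel_representative[OF Lq_bound_measurable[OF fb]] by blast
    have [measurable]: "g \<in> borel_measurable borel" by fact
    have gb: "Lq_bound x A g" by (rule Lq_bound_cong[OF fb g(2)])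
    define u where "u = (\<lambda>z. (1 / A) *\<^sub>R g z)"
    have um[measurable]: "u \<in> borel_measurable borel" unfolding u_def by measurable
    have ub: "Lq_bound x 1 u"
      using Lq_bound_scaleR[OF gb, of "1 / A"] x A by (simp add: u_def)
    let ?n = "real CARD('n) + \<theta> * p"
    have "(\<integral>\<^sup>+x. \<integral>\<^sup>+y. ennreal (norm (u x - u y) powr p / norm (x - y) powr ?n) \<partial>lborel \<partial>lborel)
       = ennreal (1 / A powr p) * (\<integral>\<^sup>+x. \<integral>\<^sup>+y. ennreal (norm (g x - g y) powr p / norm (x - y) powr ?n) \<partial>lborel \<partial>lborel)"
    proof -
      have "ennreal (norm (u x - u y) powr p / norm (x - y) powr ?n) = ennreal (1 / A powr p) * ennreal (norm (g x - g y) powr p / norm (x - y) powr ?n)" for x y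
      proof -
        have "norm (u x - u y) = norm (g x - g y) / A"
          using A by (simp add: u_def flip: scaleR_diff_right)
        then show ?thesis using A by (simp add: powr_divide ennreal_mult[symmetric])
      qed
      moreover have "(\<integral>\<^sup>+y. ennreal (1 / A powr p) * ennreal (norm (g x - g y) powr p / norm (x - y) powr ?n) \<partial>lborel)
         = ennreal (1 / A powr p) * (\<integral>\<^sup>+y. ennreal (norm (g x - g y) powr p / norm (x - y) powr ?n) \<partial>lborel)" for x
        by (rule nn_integral_cmult) measurable
      moreover have "(\<integral>\<^sup>+x. ennreal (1 / A powr p) * (\<integral>\<^sup>+y. ennreal (norm (g x - g y) powr p / norm (x - y) powr ?n) \<partial>lborel) \<partial>lborel)
         = ennreal (1 / A powr p) * (\<integral>\<^sup>+x. \<integral>\<^sup>+y. ennreal (norm (g x - g y) powr p / norm (x - y) powr ?n) \<partial>lborel \<partial>lborel)"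
        by (rule nn_integral_cmult) measurable
      ultimately show ?thesis by simp
    qed
    also have "\<dots> \<le> ennreal (1 / A powr p) * ennreal (A powr p)"
      using slobodeckij_iterated[OF sf g _ ss] x by (intro mult_left_mono) (auto simp: p_def)
    also have "\<dots> = 1" using A by (simp add: ennreal_mult[symmetric])
    finally have E: "(\<integral>\<^sup>+x. \<integral>\<^sup>+y. ennreal (norm (u x - u y) powr p / norm (x - y) powr ?n) \<partial>lborel \<partial>lborel) \<le> 1" .
    obtain D where D: "climbing_bound \<theta> p D (\<lambda>z. norm (u z))" "\<And>a b. D a b \<ge> 0"
      "\<And>K. (\<Sum>k<K. D (2 ^ k) (2 ^ Suc k)) \<le> 1" "\<And>a b. 0 < a \<Longrightarrow> a < b \<Longrightarrow> D a b \<le> 1"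
      using slobodeckij_climbing_bound[OF p \<theta> um E] by blast
    have "Lq_bound y C u" by (rule C(2)[OF D(1)[unfolded p_def] um ub D(2-4)])
    then have "Lq_bound y (A * C) (\<lambda>z. A *\<^sub>R u z)"
      using A y C by (intro Lq_bound_scaleR) auto
    moreover have "(\<lambda>z. A *\<^sub>R u z) = g" using A by (simp add: u_def)
    ultimately have "Lq_bound y (C * A) g" by (simp add: mult.commute)
    then show "Lq_bound y (C * A) f"
      by (rule Lq_bound_cong) (use g(2) in \<open>auto elim: eventually_mono\<close>)
  qed
qed

section \<open>Embeddings of Sobolev-Slobodeckij spaces\<close>

lemma Lp_norm_nonneg: "Lp_norm p f \<ge> 0"
  by (simp add: Lp_norm_def)

lemma slobodeckij_seminorm_nonneg: "slobodeckij_seminorm \<theta> p f \<ge> 0"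
  by (simp add: slobodeckij_seminorm_def)

lemma sobolev_int_norm_nonneg: "sobolev_int_norm k p u \<ge> 0"
  unfolding sobolev_int_norm_def by (intro sum_nonneg Lp_norm_nonneg)

lemma sobolev_imp_sobolev_int: "u \<in> sobolev t p \<Longrightarrow> u \<in> sobolev_int (nat \<lfloor>t\<rfloor>) p"
  by (auto simp: sobolev_def split: if_splits)

lemma sobolev_int_norm_le: "sobolev_int_norm (nat \<lfloor>t\<rfloor>) p u \<le> sobolev_norm t p u"
  by (auto simp: sobolev_norm_def intro!: sum_nonneg slobodeckij_seminorm_nonneg)

lemma finite_mi_order_eq: "finite {\<nu> :: 'n::finite multi_index. mi_order \<nu> = k}"
  by (rule finite_subset[OF _ finite_mi_order_le[of k]]) auto

lemma sobolev_weak_deriv: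
  fixes u :: "real^'n::finite \<Rightarrow> 'b::{real_normed_field,euclidean_space}"
  assumes "u \<in> sobolev t p" "mi_order \<alpha> \<le> nat \<lfloor>t\<rfloor>"
  shows "has_weak_deriv \<alpha> u (weak_deriv \<alpha> u)"
proof -
  have "\<exists>w. has_weak_deriv \<alpha> u w"
    using sobolev_imp_sobolev_int[OF assms(1)] assms(2) by (simp add: sobolev_int_def)
  then show ?thesis by (elim exE) (rule has_weak_deriv_weak_deriv)
qed

lemma sobolev_Lq_bound:
  fixes u :: "real^'n::finite \<Rightarrow> 'b::{real_normed_field,euclidean_space}"
  assumes u: "u \<in> sobolev t p" and A: "sobolev_norm t p u \<le> A" and \<alpha>: "mi_order \<alpha> \<le> nat \<lfloor>t\<rfloor>" and p: "p \<ge> 1"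
  shows "Lq_bound (1 / p) A (weak_deriv \<alpha> u)"
proof -
  have "Lp_norm p (weak_deriv \<alpha> u) \<le> sobolev_int_norm (nat \<lfloor>t\<rfloor>) p u"
    unfolding sobolev_int_norm_def using \<alpha>
    by (intro member_le_sum) (auto simp: Lp_norm_nonneg finite_mi_order_le)
  also have "\<dots> \<le> A" using sobolev_int_norm_le A by (rule order_trans)
  finally have le: "Lp_norm p (weak_deriv \<alpha> u) \<le> A" .
  moreover have "weak_deriv \<alpha> u \<in> Lp_space p"
    using sobolev_imp_sobolev_int[OF u] \<alpha> by (auto simp: sobolev_int_def)
  moreover have "0 \<le> A" using Lp_norm_nonneg le by (rule order_trans)
  ultimately show ?thesis using p by (subst Lq_bound_iff_Lp_norm) auto
qed

lemma sobolev_slobodeckij: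
  fixes u :: "real^'n::finite \<Rightarrow> 'b::{real_normed_field,euclidean_space}"
  assumes u: "u \<in> sobolev t p" and A: "sobolev_norm t p u \<le> A" and \<alpha>: "mi_order \<alpha> = nat \<lfloor>t\<rfloor>" and t: "t \<notin> \<nat>"
  shows "slobodeckij_finite (frac t) p (weak_deriv \<alpha> u)" "slobodeckij_seminorm (frac t) p (weak_deriv \<alpha> u) \<le> A"
proof -
  show "slobodeckij_finite (frac t) p (weak_deriv \<alpha> u)" using u \<alpha> t by (simp add: sobolev_def)
  have "slobodeckij_seminorm (frac t) p (weak_deriv \<alpha> u)
      \<le> (\<Sum>\<nu> | mi_order \<nu> = nat \<lfloor>t\<rfloor>. slobodeckij_seminorm (frac t) p (weak_deriv \<nu> u))"
    using \<alpha> by (intro member_le_sum) (auto simp: slobodeckij_seminorm_nonneg finite_mi_order_eq)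
  also have "\<dots> \<le> sobolev_norm t p u"
    using t sobolev_int_norm_nonneg[of "nat \<lfloor>t\<rfloor>" p u] by (simp add: sobolev_norm_def)
  finally show "slobodeckij_seminorm (frac t) p (weak_deriv \<alpha> u) \<le> A" using A by simp
qed

lemma weak_deriv_gradient:
  fixes u :: "real^'n::finite \<Rightarrow> 'b::{real_normed_field,euclidean_space}"
  assumes "u \<in> sobolev t p" "Suc (mi_order \<alpha>) \<le> nat \<lfloor>t\<rfloor>"
  shows "has_weak_deriv (unit_index i) (weak_deriv \<alpha> u) (weak_deriv (\<alpha>(i := Suc (\<alpha> i))) u)"
  using assms by (intro has_weak_deriv_of_weak_deriv[of \<alpha> u] sobolev_weak_deriv[of u t p]) (auto simp: mi_order_upd)

text \<open>
  Every unit of order that is left above a derivative lowers the reciprocal exponent by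
  \<open>1 / n\<close>: the top derivatives gain from their fractional order, and each step downwards
  applies the first-order embedding to a derivative and its gradient.
\<close>

lemma sobolev_embedding_ladder:
  fixes t p y :: real and m :: nat
  defines "\<theta> \<equiv> t - real (nat \<lfloor>t\<rfloor>)"
  assumes t: "t \<ge> 0" and p: "p \<ge> 1" and y: "0 \<le> y" "y \<le> 1 / p" "1 / p - (\<theta> + real m) / real CARD('n) \<le> y"
    "y > 0 \<or> 1 / p < (\<theta> + real m) / real CARD('n)"
  shows "\<exists>C>0. \<forall>(u :: real^'n::finite \<Rightarrow> 'b::{real_normed_field,euclidean_space}) A \<alpha>. A > 0 \<longrightarrow> u \<in> sobolev t p \<longrightarrow>
     sobolev_norm t p u \<le> A \<longrightarrow> mi_order \<alpha> + m \<le> nat \<lfloor>t\<rfloor> \<longrightarrow> Lq_bound y (C * A) (weak_deriv \<alpha> u)"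
  using y
proof (induction m arbitrary: y)
  case 0
  define n where "n = real CARD('n)"
  have n: "n > 0" by (simp add: n_def)
  have p1: "0 < 1 / p" "1 / p \<le> 1" using p by auto
  have th: "\<theta> = frac t" using t by (simp add: \<theta>_def frac_def)
  have th1: "0 \<le> \<theta>" "\<theta> < 1" unfolding th by (auto simp: frac_lt_1)
  show ?case
  proof (cases "\<theta> = 0")
    case True
    then have "y = 1 / p" using 0 p1 by auto
    then show ?thesis
      using p by (intro exI[of _ 1]) (auto intro: sobolev_Lq_bound)
  next
    case False
    then have th0: "\<theta> > 0" using th1 by simp
    have tN: "t \<notin> \<nat>" using th0 th by (auto simp: Nats_def)
    have y0: "0 \<le> y" "y \<le> 1 / p" using 0 by auto
    have y1: "1 / p - \<theta> / n \<le> y" "y > 0 \<or> 1 / p < \<theta> / n" using 0 by (auto simp: n_def)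
    have "\<theta> / n \<le> 1 / n" using th1 n by (simp add: divide_right_mono)
    then have y2: "1 / p - 1 / n \<le> y" "y > 0 \<or> 1 / p < 1 / n" using y1 by linarith+
    obtain C1 where C1: "C1 > 0"
      "\<And>(f :: real^'n \<Rightarrow> 'b) F A. A > 0 \<Longrightarrow> Lq_bound (1 / p) A f \<Longrightarrow>
       (\<And>i. has_weak_deriv (unit_index i) f (F i)) \<Longrightarrow> (\<And>i. Lq_bound (1 / p) A (F i)) \<Longrightarrow> Lq_bound y (C1 * A) f"
      using gradient_embedding[where 'n = 'n and 'b = 'b, OF p1 y0 y2[unfolded n_def]] by blast
    obtain C2 where C2: "C2 > 0"
      "\<And>(f :: real^'n \<Rightarrow> 'b) A. A > 0 \<Longrightarrow> Lq_bound (1 / p) A f \<Longrightarrow>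
       slobodeckij_finite \<theta> (1 / (1 / p)) f \<Longrightarrow> slobodeckij_seminorm \<theta> (1 / (1 / p)) f \<le> A \<Longrightarrow> Lq_bound y (C2 * A) f"
      using slobodeckij_embedding[where 'n = 'n and 'b = 'b, OF th0 p1 y0 y1[unfolded n_def]] by blast
    show ?thesis
    proof (intro exI[of _ "max C1 C2"] conjI allI impI)
      show "0 < max C1 C2" using C1 by simp
      fix u :: "real^'n \<Rightarrow> 'b" and A and \<alpha> :: "'n multi_index"
      assume A: "0 < A" and u: "u \<in> sobolev t p" and N: "sobolev_norm t p u \<le> A" and al: "mi_order \<alpha> + 0 \<le> nat \<lfloor>t\<rfloor>"
      show "Lq_bound y (max C1 C2 * A) (weak_deriv \<alpha> u)"
      proof (cases "mi_order \<alpha> = nat \<lfloor>t\<rfloor>")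
        case True
        have "Lq_bound y (C2 * A) (weak_deriv \<alpha> u)"
          using sobolev_slobodeckij[OF u N True tN] al
          by (intro C2(2) A sobolev_Lq_bound[OF u N _ p]) (auto simp: th)
        then show ?thesis using A C2(1) y0
          by (intro Lq_bound_mono[of y "C2 * A" _ "max C1 C2 * A"]) (auto intro: mult_right_mono)
      next
        case False
        then have "Suc (mi_order \<alpha>) \<le> nat \<lfloor>t\<rfloor>" using al by simp
        then have "Lq_bound y (C1 * A) (weak_deriv \<alpha> u)"
          by (intro C1(2)[OF A _ weak_deriv_gradient[OF u]] sobolev_Lq_bound[OF u N _ p]) (auto simp: mi_order_upd)
        then show ?thesis using A C1(1) y0
          by (intro Lq_bound_mono[of y "C1 * A" _ "max C1 C2 * A"]) (auto intro: mult_right_mono)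
      qed
    qed
  qed
next
  case (Suc m)
  define n where "n = real CARD('n)"
  define c where "c = 1 / p - (\<theta> + real m) / n"
  have n: "n > 0" by (simp add: n_def)
  have p1: "0 < 1 / p" "1 / p \<le> 1" using p by auto
  have split: "(\<theta> + real (Suc m)) / n = (\<theta> + real m) / n + 1 / n" using n by (simp add: field_simps)
  have yc: "c - 1 / n \<le> y" using Suc.prems(3) unfolding n_def[symmetric] split c_def by linarith
  have y0: "y > 0 \<or> c < 1 / n" using Suc.prems(4) unfolding n_def[symmetric] split c_def by linarith
  have "\<theta> \<ge> 0" using t by (simp add: \<theta>_def)
  then have cp: "c \<le> 1 / p" using n by (simp add: c_def)
  \<comment> \<open>an exponent for the derivatives one order higher from which one step leads to \<open>y\<close>; for \<open>y = 0\<close> it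
    has to be less than \<open>1 / n\<close>\<close>
  obtain x where x: "0 < x" "x \<le> 1 / p" "c \<le> x" "y \<le> x" "x - 1 / n \<le> y" "y > 0 \<or> x < 1 / n"
  proof (cases "y > 0")
    case True
    have "y + 1 / n > 0" using True n by (simp add: add_pos_pos)
    then show ?thesis
      by (rule_tac that[of "min (1 / p) (y + 1 / n)"])
         (use True Suc.prems(2) yc cp p1 n in \<open>auto simp: min_def\<close>)
  next
    case False
    then have y00: "y = 0" "c < 1 / n" using Suc.prems(1) y0 by auto
    show ?thesis
    proof (cases "1 / p < 1 / n")
      case True
      show ?thesis by (rule that[of "1 / p"]) (use True y00 cp p1 in auto)
    next
      case F: False
      define d where "d = max 0 c"
      have d: "0 \<le> d" "c \<le> d" "d < 1 / n" using y00 n by (auto simp: d_def)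
      show ?thesis
        by (rule that[of "(d + 1 / n) / 2"]) (use d F y00 n in auto)
    qed
  qed
  have x1: "x \<le> 1" using x(2) p1 by linarith
  have "\<exists>C>0. \<forall>(u :: real^'n \<Rightarrow> 'b) A \<alpha>. A > 0 \<longrightarrow> u \<in> sobolev t p \<longrightarrow>
     sobolev_norm t p u \<le> A \<longrightarrow> mi_order \<alpha> + m \<le> nat \<lfloor>t\<rfloor> \<longrightarrow> Lq_bound x (C * A) (weak_deriv \<alpha> u)"
    by (rule Suc.IH) (use x in \<open>auto simp: c_def n_def\<close>)
  then obtain C1 where C1: "C1 > 0" "\<And>(u :: real^'n \<Rightarrow> 'b) A \<alpha>. A > 0 \<Longrightarrow> u \<in> sobolev t p \<Longrightarrow>
     sobolev_norm t p u \<le> A \<Longrightarrow> mi_order \<alpha> + m \<le> nat \<lfloor>t\<rfloor> \<Longrightarrow> Lq_bound x (C1 * A) (weak_deriv \<alpha> u)" by blast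
  obtain C2 where C2: "C2 > 0"
      "\<And>(f :: real^'n \<Rightarrow> 'b) F A. A > 0 \<Longrightarrow> Lq_bound x A f \<Longrightarrow>
       (\<And>i. has_weak_deriv (unit_index i) f (F i)) \<Longrightarrow> (\<And>i. Lq_bound x A (F i)) \<Longrightarrow> Lq_bound y (C2 * A) f"
    using gradient_embedding[where 'n = 'n and 'b = 'b, OF x(1) x1 Suc.prems(1) x(4) x(5,6)[unfolded n_def]] by blast
  show ?case
  proof (intro exI[of _ "C2 * C1"] conjI allI impI)
    show "0 < C2 * C1" using C1 C2 by simp
    fix u :: "real^'n \<Rightarrow> 'b" and A and \<alpha> :: "'n multi_index"
    assume A: "0 < A" and u: "u \<in> sobolev t p" and N: "sobolev_norm t p u \<le> A" and al: "mi_order \<alpha> + Suc m \<le> nat \<lfloor>t\<rfloor>"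
    have "Lq_bound y (C2 * (C1 * A)) (weak_deriv \<alpha> u)"
    proof (rule C2(2))
      show "C1 * A > 0" using C1 A by simp
      show "Lq_bound x (C1 * A) (weak_deriv \<alpha> u)" by (rule C1(2)[OF A u N]) (use al in simp)
      show "has_weak_deriv (unit_index i) (weak_deriv \<alpha> u) (weak_deriv (\<alpha>(i := Suc (\<alpha> i))) u)" for i
        by (rule weak_deriv_gradient[OF u]) (use al in simp)
      show "Lq_bound x (C1 * A) (weak_deriv (\<alpha>(i := Suc (\<alpha> i))) u)" for i
        by (rule C1(2)[OF A u N]) (use al in \<open>simp add: mi_order_upd\<close>)
    qed
    then show "Lq_bound y (C2 * C1 * A) (weak_deriv \<alpha> u)" by (simp add: mult.assoc)
  qed
qed

lemma sobolev_embedding: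
  fixes t p y :: real
  assumes t: "t \<ge> 0" and p: "p \<ge> 1" and al: "mi_order (\<alpha> :: 'n multi_index) \<le> nat \<lfloor>t\<rfloor>"
    and y: "0 \<le> y" "y \<le> 1 / p" "1 / p - (t - real (mi_order \<alpha>)) / real CARD('n) \<le> y"
    "y > 0 \<or> 1 / p < (t - real (mi_order \<alpha>)) / real CARD('n)"
  obtains C where "C > 0" "\<And>(u :: real^'n::finite \<Rightarrow> 'b::{real_normed_field,euclidean_space}) A. A > 0 \<Longrightarrow> u \<in> sobolev t p \<Longrightarrow>
     sobolev_norm t p u \<le> A \<Longrightarrow> Lq_bound y (C * A) (weak_deriv \<alpha> u)"
proof -
  define m where "m = nat \<lfloor>t\<rfloor> - mi_order \<alpha>"
  have m: "t - real (nat \<lfloor>t\<rfloor>) + real m = t - real (mi_order \<alpha>)" using al by (simp add: m_def of_nat_diff)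
  have "\<exists>C>0. \<forall>(u :: real^'n \<Rightarrow> 'b) A \<alpha>. A > 0 \<longrightarrow> u \<in> sobolev t p \<longrightarrow>
     sobolev_norm t p u \<le> A \<longrightarrow> mi_order \<alpha> + m \<le> nat \<lfloor>t\<rfloor> \<longrightarrow> Lq_bound y (C * A) (weak_deriv \<alpha> u)"
    by (rule sobolev_embedding_ladder[OF t p y(1,2)]) (unfold m, rule y(3), rule y(4))
  then obtain C where "C > 0" "\<And>(u :: real^'n \<Rightarrow> 'b) A \<alpha>. A > 0 \<Longrightarrow> u \<in> sobolev t p \<Longrightarrow>
     sobolev_norm t p u \<le> A \<Longrightarrow> mi_order \<alpha> + m \<le> nat \<lfloor>t\<rfloor> \<Longrightarrow> Lq_bound y (C * A) (weak_deriv \<alpha> u)" by blast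
  moreover have "mi_order \<alpha> + m \<le> nat \<lfloor>t\<rfloor>" using al by (simp add: m_def)
  ultimately show ?thesis using that by blast
qed

section \<open>Products of derivatives\<close>

text \<open>
  The reciprocal exponents available for a derivative of \<open>u\<close> form an interval starting at
  \<open>max 0 c\<^sub>1\<close>, whose left end is attained except when \<open>c\<^sub>1 = 0\<close>. If \<open>1 / p\<close> is the sum of the two
  left ends, none of them is such an exceptional end, by the strict inequalities; otherwise
  both exponents can be taken off the ends.
\<close>

lemma Holder_exponents:
  fixes r1 r2 P c1 c2 :: real
  assumes r: "0 < r1" "0 < r2" and P: "0 < P" "P \<le> r1 + r2" and c: "c1 \<le> r1" "c2 \<le> r2"
    and cond: "(c1 \<le> P \<and> c2 \<le> P \<and> c1 + c2 < P) \<or> (c1 < P \<and> c2 < P \<and> c1 + c2 \<le> P)"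
  obtains x y where "x + y = P" "0 \<le> x" "x \<le> r1" "c1 \<le> x" "x > 0 \<or> c1 < 0" "0 \<le> y" "y \<le> r2" "c2 \<le> y" "y > 0 \<or> c2 < 0"
proof -
  define m1 where "m1 = max 0 c1"
  define m2 where "m2 = max 0 c2"
  have m: "0 \<le> m1" "c1 \<le> m1" "m1 \<le> r1" "0 \<le> m2" "c2 \<le> m2" "m2 \<le> r2" "m1 + m2 \<le> P"
    using r c cond P by (auto simp: m1_def m2_def max_def)
  show ?thesis
  proof (cases "m1 + m2 = P")
    case True
    then show ?thesis
      using m cond P by (intro that[of m1 m2]) (auto simp: m1_def m2_def max_def split: if_splits)
  next
    case False
    \<comment> \<open>the same fraction of both intervals is used; it is positive, so both exponents leave the left ends\<close>
    define l where "l = (P - m1 - m2) / (r1 + r2 - m1 - m2)"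
    have den: "r1 + r2 - m1 - m2 > 0" using False m P by linarith
    have l: "0 < l" "l \<le> 1" using False m P den by (auto simp: l_def)
    define x where "x = m1 + l * (r1 - m1)"
    define y where "y = m2 + l * (r2 - m2)"
    have "l * (r1 + r2 - m1 - m2) = P - m1 - m2" using den by (simp add: l_def)
    then have xy: "x + y = P" by (simp add: x_def y_def algebra_simps)
    have up: "l * (r1 - m1) \<le> 1 * (r1 - m1)" "l * (r2 - m2) \<le> 1 * (r2 - m2)"
      using mult_right_mono[OF l(2), of "r1 - m1"] mult_right_mono[OF l(2), of "r2 - m2"] m by auto
    have lo: "0 \<le> l * (r1 - m1)" "0 \<le> l * (r2 - m2)" using l m by auto
    have pos: "x > 0" "y > 0"
    proof -
      show "x > 0"
      proof (cases "m1 = r1")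
        case F: False
        then have "0 < l * (r1 - m1)" using l m by simp
        then show ?thesis using m by (simp add: x_def)
      qed (use r lo in \<open>simp add: x_def\<close>)
      show "y > 0"
      proof (cases "m2 = r2")
        case F: False
        then have "0 < l * (r2 - m2)" using l m by simp
        then show ?thesis using m by (simp add: y_def)
      qed (use r lo in \<open>simp add: y_def\<close>)
    qed
    show ?thesis by (rule that[of x y]) (use xy pos up lo m in \<open>auto simp: x_def y_def\<close>)
  qed
qed

definition multiplication_exponents :: "real \<Rightarrow> real \<Rightarrow> real \<Rightarrow> real \<Rightarrow> real \<Rightarrow> real \<Rightarrow> real \<Rightarrow> bool" where
  "multiplication_exponents n s1 s2 s p1 p2 p \<longleftrightarrow>
     1 \<le> p \<and> 1 \<le> p1 \<and> 1 \<le> p2 \<and> s1 \<ge> s \<and> s2 \<ge> s \<and> s \<ge> 0 \<and> s \<in> \<nat> \<and>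
     ((s1 - s \<ge> n * (1 / p1 - 1 / p) \<and> s2 - s \<ge> n * (1 / p2 - 1 / p) \<and>
       s1 + s2 - s > n * (1 / p1 + 1 / p2 - 1 / p) \<and> n * (1 / p1 + 1 / p2 - 1 / p) \<ge> 0) \<or>
      (s1 - s > n * (1 / p1 - 1 / p) \<and> s2 - s > n * (1 / p2 - 1 / p) \<and>
       s1 + s2 - s \<ge> n * (1 / p1 + 1 / p2 - 1 / p) \<and> n * (1 / p1 + 1 / p2 - 1 / p) \<ge> 0))"

lemma derivative_exponents:
  fixes n s1 s2 s p1 p2 p a b :: real
  assumes me: "multiplication_exponents n s1 s2 s p1 p2 p" and n: "n > 0" and a: "0 \<le> a" and b: "0 \<le> b" and ab: "a + b \<le> s"
  obtains x y where "x + y = 1 / p" "0 \<le> x" "x \<le> 1 / p1" "1 / p1 - (s1 - a) / n \<le> x" "x > 0 \<or> 1 / p1 < (s1 - a) / n"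
    "0 \<le> y" "y \<le> 1 / p2" "1 / p2 - (s2 - b) / n \<le> y" "y > 0 \<or> 1 / p2 < (s2 - b) / n"
proof -
  define c1 where "c1 = 1 / p1 - (s1 - a) / n"
  define c2 where "c2 = 1 / p2 - (s2 - b) / n"
  have p: "1 \<le> p" "1 \<le> p1" "1 \<le> p2" and s: "s1 \<ge> s" "s2 \<ge> s" using me by (auto simp: multiplication_exponents_def)
  have nc1: "n * c1 = n * (1 / p1) - (s1 - a)" and nc2: "n * c2 = n * (1 / p2) - (s2 - b)"
    unfolding c1_def c2_def using n by (subst right_diff_distrib, simp)+
  have le: "u \<le> v \<longleftrightarrow> n * u \<le> n * v" "u < v \<longleftrightarrow> n * u < n * v" for u v using n by auto
  have "n * (1 / p1 + 1 / p2 - 1 / p) \<ge> 0" using me by (auto simp: multiplication_exponents_def)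
  then have P: "1 / p \<le> 1 / p1 + 1 / p2" using n by (simp add: zero_le_mult_iff)
  have c: "c1 \<le> 1 / p1" "c2 \<le> 1 / p2" using n s a b ab by (auto simp: c1_def c2_def)
  have cond: "(c1 \<le> 1 / p \<and> c2 \<le> 1 / p \<and> c1 + c2 < 1 / p) \<or> (c1 < 1 / p \<and> c2 < 1 / p \<and> c1 + c2 \<le> 1 / p)"
    using me a b ab unfolding multiplication_exponents_def le(1)[of _ "1 / p"] le(2)[of _ "1 / p"] distrib_left right_diff_distrib nc1 nc2
    by linarith
  obtain x y where "x + y = 1 / p" "0 \<le> x" "x \<le> 1 / p1" "c1 \<le> x" "x > 0 \<or> c1 < 0" "0 \<le> y" "y \<le> 1 / p2" "c2 \<le> y" "y > 0 \<or> c2 < 0"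
    by (rule Holder_exponents[OF _ _ _ P c cond]) (use p in auto)
  then show ?thesis by (intro that[of x y]) (auto simp: c1_def c2_def)
qed

lemma product_derivatives_bound:
  fixes \<alpha> \<beta> :: "'n::finite multi_index"
  assumes me: "multiplication_exponents (real CARD('n)) s1 s2 s p1 p2 p"
    and ab: "mi_order \<alpha> + mi_order \<beta> \<le> nat \<lfloor>s\<rfloor>"
  shows "\<exists>C>0. \<forall>(u :: real^'n \<Rightarrow> 'b::{real_normed_field,euclidean_space}) v A B. A > 0 \<longrightarrow> B > 0 \<longrightarrow> u \<in> sobolev s1 p1 \<longrightarrow>
     sobolev_norm s1 p1 u \<le> A \<longrightarrow> v \<in> sobolev s2 p2 \<longrightarrow> sobolev_norm s2 p2 v \<le> B \<longrightarrow>
     Lq_bound (1 / p) (C * (A * B)) (\<lambda>x. weak_deriv \<alpha> u x * weak_deriv \<beta> v x)"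
proof -
  have p: "1 \<le> p" "1 \<le> p1" "1 \<le> p2" and s: "s1 \<ge> s" "s2 \<ge> s" "s \<ge> 0" "s \<in> \<nat>"
    using me by (auto simp: multiplication_exponents_def)
  have fl: "nat \<lfloor>s\<rfloor> \<le> nat \<lfloor>s1\<rfloor>" "nat \<lfloor>s\<rfloor> \<le> nat \<lfloor>s2\<rfloor>" using s by (auto intro!: nat_mono floor_mono)
  have rs: "real (mi_order \<alpha>) + real (mi_order \<beta>) \<le> s"
  proof -
    have "real (mi_order \<alpha> + mi_order \<beta>) \<le> real (nat \<lfloor>s\<rfloor>)" using ab by (rule of_nat_mono)
    then show ?thesis using s by linarith
  qed
  obtain x y where xy: "x + y = 1 / p" "0 \<le> x" "x \<le> 1 / p1" "1 / p1 - (s1 - real (mi_order \<alpha>)) / real CARD('n) \<le> x"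
    "x > 0 \<or> 1 / p1 < (s1 - real (mi_order \<alpha>)) / real CARD('n)"
    "0 \<le> y" "y \<le> 1 / p2" "1 / p2 - (s2 - real (mi_order \<beta>)) / real CARD('n) \<le> y"
    "y > 0 \<or> 1 / p2 < (s2 - real (mi_order \<beta>)) / real CARD('n)"
    by (rule derivative_exponents[OF me _ _ _ rs]) auto
  have al: "mi_order \<alpha> \<le> nat \<lfloor>s1\<rfloor>" "mi_order \<beta> \<le> nat \<lfloor>s2\<rfloor>" using ab fl by auto
  have s0: "0 \<le> s1" "0 \<le> s2" using s by auto
  obtain C1 where C1: "C1 > 0" "\<And>(u :: real^'n \<Rightarrow> 'b) A. A > 0 \<Longrightarrow> u \<in> sobolev s1 p1 \<Longrightarrow>
     sobolev_norm s1 p1 u \<le> A \<Longrightarrow> Lq_bound x (C1 * A) (weak_deriv \<alpha> u)"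
    using sobolev_embedding[where 'b = 'b, OF s0(1) p(2) al(1) xy(2-5)] by blast
  obtain C2 where C2: "C2 > 0" "\<And>(u :: real^'n \<Rightarrow> 'b) A. A > 0 \<Longrightarrow> u \<in> sobolev s2 p2 \<Longrightarrow>
     sobolev_norm s2 p2 u \<le> A \<Longrightarrow> Lq_bound y (C2 * A) (weak_deriv \<beta> u)"
    using sobolev_embedding[where 'b = 'b, OF s0(2) p(3) al(2) xy(6-9)] by blast
  show ?thesis
  proof (intro exI[of _ "C1 * C2"] conjI allI impI)
    show "0 < C1 * C2" using C1 C2 by simp
    fix u v :: "real^'n \<Rightarrow> 'b" and A B :: real
    assume A: "A > 0" and B: "B > 0" and u: "u \<in> sobolev s1 p1" "sobolev_norm s1 p1 u \<le> A"
      and v: "v \<in> sobolev s2 p2" "sobolev_norm s2 p2 v \<le> B"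
    have "Lq_bound (x + y) ((C1 * A) * (C2 * B)) (\<lambda>x. weak_deriv \<alpha> u x * weak_deriv \<beta> v x)"
      using C1(1) C2(1) A B by (intro Lq_bound_mult C1(2) C2(2) u v xy) auto
    then show "Lq_bound (1 / p) (C1 * C2 * (A * B)) (\<lambda>x. weak_deriv \<alpha> u x * weak_deriv \<beta> v x)"
      by (simp add: xy(1) mult_ac)
  qed
qed

text \<open>
  There are finitely many pairs of multi-indices.
\<close>

lemma product_derivatives_bound_uniform:
  assumes me: "multiplication_exponents (real CARD('n::finite)) s1 s2 s p1 p2 p"
  obtains C where "C > 0" "\<And>(u :: real^'n \<Rightarrow> 'b::{real_normed_field,euclidean_space}) v A B \<alpha> \<beta>. A > 0 \<Longrightarrow> B > 0 \<Longrightarrow> u \<in> sobolev s1 p1 \<Longrightarrow>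
     sobolev_norm s1 p1 u \<le> A \<Longrightarrow> v \<in> sobolev s2 p2 \<Longrightarrow> sobolev_norm s2 p2 v \<le> B \<Longrightarrow> mi_order \<alpha> + mi_order \<beta> \<le> nat \<lfloor>s\<rfloor> \<Longrightarrow>
     Lq_bound (1 / p) (C * (A * B)) (\<lambda>x. weak_deriv \<alpha> u x * weak_deriv \<beta> v x)"
proof -
  define S where "S = {(\<alpha> :: 'n multi_index, \<beta> :: 'n multi_index). mi_order \<alpha> + mi_order \<beta> \<le> nat \<lfloor>s\<rfloor>}"
  have fin: "finite S"
    by (rule finite_subset[OF _ finite_cartesian_product[OF finite_mi_order_le[of "nat \<lfloor>s\<rfloor>"] finite_mi_order_le[of "nat \<lfloor>s\<rfloor>"]]])
       (auto simp: S_def)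
  have p: "1 \<le> p" using me by (auto simp: multiplication_exponents_def)
  define Q where "Q = (\<lambda>z C. \<forall>(u :: real^'n \<Rightarrow> 'b) v A B. A > 0 \<longrightarrow> B > 0 \<longrightarrow> u \<in> sobolev s1 p1 \<longrightarrow>
     sobolev_norm s1 p1 u \<le> A \<longrightarrow> v \<in> sobolev s2 p2 \<longrightarrow> sobolev_norm s2 p2 v \<le> B \<longrightarrow>
     Lq_bound (1 / p) (C * (A * B)) (\<lambda>x. weak_deriv (fst z) u x * weak_deriv (snd z) v x))"
  have "\<exists>C. C > 0 \<and> Q z C" if "z \<in> S" for z
    unfolding Q_def by (rule product_derivatives_bound[OF me]) (use that in \<open>auto simp: S_def\<close>)
  then obtain C where C': "\<And>z. z \<in> S \<Longrightarrow> C z > 0 \<and> Q z (C z)" by metis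
  then have C: "\<And>z. z \<in> S \<Longrightarrow> C z > 0" by blast
  define M where "M = 1 + (\<Sum>z\<in>S. C z)"
  show ?thesis
  proof (rule that[of M])
    show "M > 0" unfolding M_def by (intro add_pos_nonneg sum_nonneg) (auto simp: C less_imp_le)
    fix u v :: "real^'n \<Rightarrow> 'b" and A B :: real and \<alpha> \<beta> :: "'n multi_index"
    assume A: "A > 0" and B: "B > 0" and u: "u \<in> sobolev s1 p1" "sobolev_norm s1 p1 u \<le> A"
      and v: "v \<in> sobolev s2 p2" "sobolev_norm s2 p2 v \<le> B" and ab: "mi_order \<alpha> + mi_order \<beta> \<le> nat \<lfloor>s\<rfloor>"
    have z: "(\<alpha>, \<beta>) \<in> S" using ab by (simp add: S_def)
    have "C (\<alpha>, \<beta>) \<le> (\<Sum>z\<in>S. C z)"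
      by (rule member_le_sum[OF z _ fin]) (simp add: C less_imp_le)
    then have "C (\<alpha>, \<beta>) * (A * B) \<le> M * (A * B)"
      using A B by (intro mult_right_mono) (auto simp: M_def)
    then show "Lq_bound (1 / p) (M * (A * B)) (\<lambda>x. weak_deriv \<alpha> u x * weak_deriv \<beta> v x)"
    proof (rule Lq_bound_mono[of "1 / p" "C (\<alpha>, \<beta>) * (A * B)", rotated])
      show "Lq_bound (1 / p) (C (\<alpha>, \<beta>) * (A * B)) (\<lambda>x. weak_deriv \<alpha> u x * weak_deriv \<beta> v x)"
        using C'[OF z] A B u v unfolding Q_def by simp
    qed (use C[OF z] A B p in auto)
  qed
qed

text \<open>
  The Leibniz rule without binomial coefficients: a derivative of a product is obtained one
  coordinate at a time, and every step doubles the number of terms.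
\<close>

lemma product_weak_deriv:
  fixes u v :: "real^'n::finite \<Rightarrow> 'b::{real_normed_field,euclidean_space}"
  assumes u: "\<And>\<alpha>. mi_order \<alpha> \<le> k \<Longrightarrow> has_weak_deriv \<alpha> u (weak_deriv \<alpha> u)"
    and v: "\<And>\<alpha>. mi_order \<alpha> \<le> k \<Longrightarrow> has_weak_deriv \<alpha> v (weak_deriv \<alpha> v)"
    and b: "\<And>\<alpha> \<beta>. mi_order \<alpha> + mi_order \<beta> \<le> k \<Longrightarrow> Lq_bound (1 / p) M (\<lambda>x. weak_deriv \<alpha> u x * weak_deriv \<beta> v x)"
    and M: "M > 0" and p: "p \<ge> 1"
  shows "mi_order \<nu> = m \<Longrightarrow> mi_order \<alpha> + mi_order \<beta> + m \<le> k \<Longrightarrow>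
     \<exists>W. has_weak_deriv \<nu> (\<lambda>x. weak_deriv \<alpha> u x * weak_deriv \<beta> v x) W \<and> Lq_bound (1 / p) (2 ^ m * M) W"
proof (induction m arbitrary: \<nu> \<alpha> \<beta>)
  case 0
  have "\<nu> = (\<lambda>_. 0)" using 0 by (intro mi_order_eq_0)
  moreover have l: "Lq_bound (1 / p) M (\<lambda>x. weak_deriv \<alpha> u x * weak_deriv \<beta> v x)" using 0 by (intro b) simp
  moreover have "locally_integrable (\<lambda>x. weak_deriv \<alpha> u x * weak_deriv \<beta> v x)"
    by (rule Lq_bound_locally_integrable[OF l]) (use p in auto)
  ultimately show ?case using has_weak_deriv_order_zero by auto
next
  case (Suc m)
  obtain \<mu> i where \<mu>: "\<nu> = \<mu>(i := Suc (\<mu> i))" "mi_order \<mu> = m" using mi_order_Suc_obtain[OF Suc.prems(1)] .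
  define \<alpha>' where "\<alpha>' = \<alpha>(i := Suc (\<alpha> i))"
  define \<beta>' where "\<beta>' = \<beta>(i := Suc (\<beta> i))"
  have o: "mi_order \<alpha>' = Suc (mi_order \<alpha>)" "mi_order \<beta>' = Suc (mi_order \<beta>)"
    by (auto simp: \<alpha>'_def \<beta>'_def mi_order_upd)
  have li: "locally_integrable (\<lambda>x. weak_deriv \<alpha> u x * weak_deriv \<beta> v x)" if "mi_order \<alpha> + mi_order \<beta> \<le> k" for \<alpha> \<beta>
    by (rule Lq_bound_locally_integrable[OF b[OF that]]) (use p in auto)
  have fu: "has_weak_deriv (unit_index i) (weak_deriv \<alpha> u) (weak_deriv \<alpha>' u)"
    using Suc.prems(2) o unfolding \<alpha>'_def by (intro has_weak_deriv_of_weak_deriv[of \<alpha> u] u) auto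
  have fv: "has_weak_deriv (unit_index i) (weak_deriv \<beta> v) (weak_deriv \<beta>' v)"
    using Suc.prems(2) o unfolding \<beta>'_def by (intro has_weak_deriv_of_weak_deriv[of \<beta> v] v) auto
  have d1: "has_weak_deriv (unit_index i) (\<lambda>x. weak_deriv \<alpha> u x * weak_deriv \<beta> v x)
      (\<lambda>x. weak_deriv \<alpha>' u x * weak_deriv \<beta> v x + weak_deriv \<alpha> u x * weak_deriv \<beta>' v x)"
    using Suc.prems(2) o by (intro has_weak_deriv_product fu fv li) auto
  obtain W1 where W1: "has_weak_deriv \<mu> (\<lambda>x. weak_deriv \<alpha>' u x * weak_deriv \<beta> v x) W1" "Lq_bound (1 / p) (2 ^ m * M) W1"
    using Suc.IH[OF \<mu>(2), of \<alpha>' \<beta>] Suc.prems(2) o by auto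
  obtain W2 where W2: "has_weak_deriv \<mu> (\<lambda>x. weak_deriv \<alpha> u x * weak_deriv \<beta>' v x) W2" "Lq_bound (1 / p) (2 ^ m * M) W2"
    using Suc.IH[OF \<mu>(2), of \<alpha> \<beta>'] Suc.prems(2) o by auto
  have "has_weak_deriv \<nu> (\<lambda>x. weak_deriv \<alpha> u x * weak_deriv \<beta> v x) (\<lambda>x. W1 x + W2 x)"
    unfolding \<mu>(1) by (rule has_weak_deriv_compose[OF d1 has_weak_deriv_add[OF W1(1) W2(1)]])
  moreover have "Lq_bound (1 / p) (2 ^ m * M + 2 ^ m * M) (\<lambda>x. W1 x + W2 x)"
    using p M by (intro Lq_bound_add W1 W2) auto
  moreover have "2 ^ m * M + 2 ^ m * M = 2 ^ Suc m * M" by simp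
  ultimately show ?case by metis
qed

lemma sobolev_product_bound:
  assumes me: "multiplication_exponents (real CARD('n::finite)) s1 s2 s p1 p2 p"
  obtains C where "C > 0" "\<And>(u :: real^'n \<Rightarrow> 'b::{real_normed_field,euclidean_space}) v A B. A > 0 \<Longrightarrow> B > 0 \<Longrightarrow> u \<in> sobolev s1 p1 \<Longrightarrow>
     sobolev_norm s1 p1 u \<le> A \<Longrightarrow> v \<in> sobolev s2 p2 \<Longrightarrow> sobolev_norm s2 p2 v \<le> B \<Longrightarrow>
     (\<lambda>x. u x * v x) \<in> sobolev s p \<and> sobolev_norm s p (\<lambda>x. u x * v x) \<le> C * (A * B)"
proof -
  have p: "1 \<le> p" "1 \<le> p1" "1 \<le> p2" and s: "s1 \<ge> s" "s2 \<ge> s" "s \<ge> 0" "s \<in> \<nat>"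
    using me by (auto simp: multiplication_exponents_def)
  define k where "k = nat \<lfloor>s\<rfloor>"
  have fl: "k \<le> nat \<lfloor>s1\<rfloor>" "k \<le> nat \<lfloor>s2\<rfloor>" unfolding k_def using s by (auto intro!: nat_mono floor_mono)
  obtain C where C: "C > 0" "\<And>(u :: real^'n \<Rightarrow> 'b) v A B \<alpha> \<beta>. A > 0 \<Longrightarrow> B > 0 \<Longrightarrow> u \<in> sobolev s1 p1 \<Longrightarrow>
     sobolev_norm s1 p1 u \<le> A \<Longrightarrow> v \<in> sobolev s2 p2 \<Longrightarrow> sobolev_norm s2 p2 v \<le> B \<Longrightarrow> mi_order \<alpha> + mi_order \<beta> \<le> k \<Longrightarrow>
     Lq_bound (1 / p) (C * (A * B)) (\<lambda>x. weak_deriv \<alpha> u x * weak_deriv \<beta> v x)"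
    using product_derivatives_bound_uniform[where 'b = 'b, OF me] unfolding k_def by blast
  define N where "N = real (card {\<nu> :: 'n multi_index. mi_order \<nu> \<le> k})"
  have "(\<lambda>_. 0) \<in> {\<nu> :: 'n multi_index. mi_order \<nu> \<le> k}" by (simp add: mi_order_zero)
  then have "{\<nu> :: 'n multi_index. mi_order \<nu> \<le> k} \<noteq> {}" by blast
  then have N: "N > 0" unfolding N_def using finite_mi_order_le[of k] by (simp add: card_gt_0_iff)
  show ?thesis
  proof (rule that[of "N * (2 ^ k * C)"])
    show "0 < N * (2 ^ k * C)" using N C by simp
    fix u v :: "real^'n \<Rightarrow> 'b" and A B :: real
    assume A: "A > 0" and B: "B > 0" and u: "u \<in> sobolev s1 p1" "sobolev_norm s1 p1 u \<le> A"
      and v: "v \<in> sobolev s2 p2" "sobolev_norm s2 p2 v \<le> B"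
    define M where "M = C * (A * B)"
    have M: "M > 0" using C A B by (simp add: M_def)
    let ?z = "\<lambda>_. 0 :: nat"
    have wu: "has_weak_deriv \<alpha> u (weak_deriv \<alpha> u)" if "mi_order \<alpha> \<le> k" for \<alpha>
      using that fl by (intro sobolev_weak_deriv[OF u(1)]) simp
    have wv: "has_weak_deriv \<alpha> v (weak_deriv \<alpha> v)" if "mi_order \<alpha> \<le> k" for \<alpha>
      using that fl by (intro sobolev_weak_deriv[OF v(1)]) simp
    have "locally_integrable u" "locally_integrable v"
      using wu[of ?z] wv[of ?z] by (auto simp: mi_order_zero has_weak_deriv_def)
    then have "AE x in lborel. weak_deriv ?z u x = u x" "AE x in lborel. weak_deriv ?z v x = v x"
      by (auto intro!: weak_deriv_AE has_weak_deriv_order_zero)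
    then have ae: "AE x in lborel. weak_deriv ?z u x * weak_deriv ?z v x = u x * v x"
      by eventually_elim simp
    have W: "has_weak_deriv \<nu> (\<lambda>x. u x * v x) (weak_deriv \<nu> (\<lambda>x. u x * v x)) \<and>
        Lq_bound (1 / p) (2 ^ k * M) (weak_deriv \<nu> (\<lambda>x. u x * v x))" if o: "mi_order \<nu> \<le> k" for \<nu>
    proof -
      have "\<exists>W. has_weak_deriv \<nu> (\<lambda>x. weak_deriv ?z u x * weak_deriv ?z v x) W \<and> Lq_bound (1 / p) (2 ^ mi_order \<nu> * M) W"
        by (rule product_weak_deriv[OF wu wv _ M p(1) refl])
           (use C(2)[OF A B u v] o in \<open>auto simp: M_def mi_order_zero\<close>)
      then obtain W where W: "has_weak_deriv \<nu> (\<lambda>x. weak_deriv ?z u x * weak_deriv ?z v x) W" "Lq_bound (1 / p) (2 ^ mi_order \<nu> * M) W"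
        by blast
      have h: "has_weak_deriv \<nu> (\<lambda>x. u x * v x) W"
        by (rule has_weak_deriv_cong[OF W(1) ae]) simp
      have "Lq_bound (1 / p) (2 ^ k * M) W"
        using W(2) o M p by (rule_tac Lq_bound_mono) (auto intro!: mult_right_mono power_increasing)
      then have "Lq_bound (1 / p) (2 ^ k * M) (weak_deriv \<nu> (\<lambda>x. u x * v x))"
        by (rule Lq_bound_cong) (use weak_deriv_AE[OF h] in \<open>auto elim: eventually_mono\<close>)
      then show ?thesis using has_weak_deriv_weak_deriv[OF h] by blast
    qed
    have M2: "2 ^ k * M \<ge> 0" using M by simp
    have Lp: "weak_deriv \<nu> (\<lambda>x. u x * v x) \<in> Lp_space p" "Lp_norm p (weak_deriv \<nu> (\<lambda>x. u x * v x)) \<le> 2 ^ k * M"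
      if "mi_order \<nu> \<le> k" for \<nu>
      using W[OF that] Lq_bound_iff_Lp_norm[of p "2 ^ k * M"] p M2 by auto
    have "Lq_bound (1 / p) M (\<lambda>x. u x * v x)"
      by (rule Lq_bound_cong[OF C(2)[OF A B u v, of ?z ?z, folded M_def] ae]) (simp add: mi_order_zero)
    then have "(\<lambda>x. u x * v x) \<in> Lp_space p" using p M by (simp add: Lq_bound_iff_Lp_norm)
    then have "(\<lambda>x. u x * v x) \<in> sobolev_int k p"
      using W Lp(1) by (auto simp: sobolev_int_def)
    moreover have "sobolev_int_norm k p (\<lambda>x. u x * v x) \<le> N * (2 ^ k * M)"
      unfolding sobolev_int_norm_def N_def by (rule sum_bounded_above) (use Lp(2) in auto)
    ultimately show "(\<lambda>x. u x * v x) \<in> sobolev s p \<and> sobolev_norm s p (\<lambda>x. u x * v x) \<le> N * (2 ^ k * C) * (A * B)"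
      using s by (simp add: sobolev_def sobolev_norm_def k_def M_def mult_ac)
  qed
qed

section \<open>The triangle inequality for Sobolev-Slobodeckij norms\<close>

lemma Lp_norm_cong:
  fixes f g :: "real^'n::finite \<Rightarrow> 'b::{real_normed_field,euclidean_space}"
  assumes "f \<in> Lp_space p" "AE x in lborel. f x = g x"
  shows "g \<in> Lp_space p" "Lp_norm p g = Lp_norm p f"
proof -
  have f: "f \<in> borel_measurable lebesgue" "integrable lebesgue (\<lambda>x. norm (f x) powr p)"
    using assms(1) by (auto simp: Lp_space_def)
  have g: "g \<in> borel_measurable lebesgue" by (rule measurable_lebesgue_AE[OF f(1) assms(2)])
  have m: "(\<lambda>x. norm (f x) powr p) \<in> borel_measurable lebesgue" "(\<lambda>x. norm (g x) powr p) \<in> borel_measurable lebesgue"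
    using f(1) g by measurable
  have ae: "AE x in lebesgue. norm (f x) powr p = norm (g x) powr p"
    using AE_completion[OF assms(2)] by eventually_elim simp
  show "g \<in> Lp_space p" using g f(2) integrable_cong_AE[OF m ae] by (simp add: Lp_space_def)
  show "Lp_norm p g = Lp_norm p f" unfolding Lp_norm_def using integral_cong_AE[OF m ae] by simp
qed

lemma Lp_norm_triangle:
  fixes f g :: "real^'n::finite \<Rightarrow> 'b::{real_normed_field,euclidean_space}"
  assumes f: "f \<in> Lp_space p" and g: "g \<in> Lp_space p" and p: "p \<ge> 1" and c: "\<bar>c\<bar> = 1"
  shows "(\<lambda>x. f x + c *\<^sub>R g x) \<in> Lp_space p" "Lp_norm p (\<lambda>x. f x + c *\<^sub>R g x) \<le> Lp_norm p f + Lp_norm p g"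
proof -
  have [measurable]: "f \<in> borel_measurable lebesgue" "g \<in> borel_measurable lebesgue"
    and i: "integrable lebesgue (\<lambda>x. norm (f x) powr p)" "integrable lebesgue (\<lambda>x. norm (g x) powr p)"
    using f g by (auto simp: Lp_space_def)
  have M: "integrable lebesgue (\<lambda>x. (norm (f x) + norm (g x)) powr p)"
    "(LINT x|lebesgue. (norm (f x) + norm (g x)) powr p) powr (1 / p) \<le> Lp_norm p f + Lp_norm p g"
    unfolding Lp_norm_def by (rule Minkowski_integral[OF p _ _ _ _ i]; simp)+
  have le: "norm (f x + c *\<^sub>R g x) powr p \<le> (norm (f x) + norm (g x)) powr p" for x
    using norm_triangle_ineq[of "f x" "c *\<^sub>R g x"] c p by (intro powr_mono2) auto
  have int: "integrable lebesgue (\<lambda>x. norm (f x + c *\<^sub>R g x) powr p)"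
    by (rule Bochner_Integration.integrable_bound[OF M(1)]) (use le in auto)
  then show "(\<lambda>x. f x + c *\<^sub>R g x) \<in> Lp_space p" by (simp add: Lp_space_def)
  have "(LINT x|lebesgue. norm (f x + c *\<^sub>R g x) powr p) \<le> (LINT x|lebesgue. (norm (f x) + norm (g x)) powr p)"
    by (rule integral_mono[OF int M(1) le])
  then have "Lp_norm p (\<lambda>x. f x + c *\<^sub>R g x) \<le> (LINT x|lebesgue. (norm (f x) + norm (g x)) powr p) powr (1 / p)"
    unfolding Lp_norm_def using p by (intro powr_mono2) (auto intro!: Bochner_Integration.integral_nonneg)
  then show "Lp_norm p (\<lambda>x. f x + c *\<^sub>R g x) \<le> Lp_norm p f + Lp_norm p g" using M(2) by simp
qed

text \<open>
  Turns equality almost everywhere into equality of Slobodeckij kernels almost everywhere.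
\<close>

lemma AE_lebesgue_pair:
  fixes f g :: "real^'n::finite \<Rightarrow> 'b::euclidean_space"
  assumes [measurable]: "f \<in> borel_measurable lebesgue" "g \<in> borel_measurable lebesgue" and ae: "AE x in lborel. f x = g x"
  shows "AE z in (lebesgue \<Otimes>\<^sub>M lebesgue). f (fst z) = g (fst z) \<and> f (snd z) = g (snd z)"
proof -
  interpret L: sigma_finite_measure "lebesgue :: (real^'n) measure" by (rule sigma_finite_lebesgue)
  interpret pair_sigma_finite "lebesgue :: (real^'n) measure" "lebesgue :: (real^'n) measure" ..
  have ae': "AE x in lebesgue. f x = g x" by (rule AE_completion[OF ae])
  show ?thesis
  proof (rule AE_pair_measure)
    show "{z \<in> space (lebesgue \<Otimes>\<^sub>M lebesgue). f (fst z) = g (fst z) \<and> f (snd z) = g (snd z)} \<in> sets (lebesgue \<Otimes>\<^sub>M lebesgue)"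
      by measurable
    show "AE x in lebesgue. AE y in lebesgue. f (fst (x, y)) = g (fst (x, y)) \<and> f (snd (x, y)) = g (snd (x, y))"
      using ae'
    proof eventually_elim
      case (elim x)
      show ?case using ae' by eventually_elim (use elim in simp)
    qed
  qed
qed

lemma slobodeckij_kernel_measurable:
  fixes f :: "real^'n::finite \<Rightarrow> 'b::{real_normed_field,euclidean_space}"
  assumes [measurable]: "f \<in> borel_measurable lebesgue"
  shows "slobodeckij_kernel \<theta> p f \<in> borel_measurable (lebesgue \<Otimes>\<^sub>M lebesgue)"
proof -
  have id: "(\<lambda>x. x) \<in> borel_measurable (lebesgue :: (real^'n) measure)"
    by (rule measurable_borel_lebesgue) simp
  have [measurable]: "(\<lambda>z. fst z - snd z) \<in> borel_measurable ((lebesgue :: (real^'n) measure) \<Otimes>\<^sub>M lebesgue)"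
  proof (rule borel_measurable_diff)
    show "fst \<in> borel_measurable ((lebesgue :: (real^'n) measure) \<Otimes>\<^sub>M lebesgue)"
      by (rule measurable_compose[OF measurable_fst id])
    show "snd \<in> borel_measurable ((lebesgue :: (real^'n) measure) \<Otimes>\<^sub>M (lebesgue :: (real^'n) measure))"
      by (rule measurable_compose[OF measurable_snd id])
  qed
  have "(\<lambda>z. norm (f (fst z) - f (snd z)) powr p / norm (fst z - snd z) powr (real CARD('n) + \<theta> * p)) \<in> borel_measurable (lebesgue \<Otimes>\<^sub>M lebesgue)"
    by measurable
  then show ?thesis by (simp add: slobodeckij_kernel_def case_prod_beta)
qed

lemma slobodeckij_cong:
  fixes f g :: "real^'n::finite \<Rightarrow> 'b::{real_normed_field,euclidean_space}"
  assumes f: "f \<in> borel_measurable lebesgue" and ae: "AE x in lborel. f x = g x"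
  shows "slobodeckij_finite \<theta> p f \<longleftrightarrow> slobodeckij_finite \<theta> p g" "slobodeckij_seminorm \<theta> p f = slobodeckij_seminorm \<theta> p g"
proof -
  have g: "g \<in> borel_measurable lebesgue" by (rule measurable_lebesgue_AE[OF f ae])
  have k: "AE z in (lebesgue \<Otimes>\<^sub>M lebesgue). slobodeckij_kernel \<theta> p f z = slobodeckij_kernel \<theta> p g z"
    using AE_lebesgue_pair[OF f g ae] by eventually_elim (auto simp: slobodeckij_kernel_def case_prod_beta)
  note m = slobodeckij_kernel_measurable[OF f] slobodeckij_kernel_measurable[OF g]
  show "slobodeckij_finite \<theta> p f \<longleftrightarrow> slobodeckij_finite \<theta> p g"
    unfolding slobodeckij_finite_def by (rule integrable_cong_AE[OF m k])
  show "slobodeckij_seminorm \<theta> p f = slobodeckij_seminorm \<theta> p g"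
    unfolding slobodeckij_seminorm_def by (simp only: integral_cong_AE[OF m k])
qed

text \<open>
  Minkowski's inequality for the \<open>p\<close>-th roots of the kernels, on the product space.
\<close>

lemma slobodeckij_triangle:
  fixes f g :: "real^'n::finite \<Rightarrow> 'b::{real_normed_field,euclidean_space}"
  assumes fm: "f \<in> borel_measurable lebesgue" and gm: "g \<in> borel_measurable lebesgue"
    and f: "slobodeckij_finite \<theta> p f" and g: "slobodeckij_finite \<theta> p g" and p: "p \<ge> 1" and c: "\<bar>c\<bar> = 1"
  shows "slobodeckij_finite \<theta> p (\<lambda>x. f x + c *\<^sub>R g x)"
    "slobodeckij_seminorm \<theta> p (\<lambda>x. f x + c *\<^sub>R g x) \<le> slobodeckij_seminorm \<theta> p f + slobodeckij_seminorm \<theta> p g"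
proof -
  let ?M = "(lebesgue :: (real^'n) measure) \<Otimes>\<^sub>M (lebesgue :: (real^'n) measure)"
  let ?h = "\<lambda>x. f x + c *\<^sub>R g x"
  let ?k = "\<lambda>u. slobodeckij_kernel \<theta> p (u :: real^'n \<Rightarrow> 'b)"
  have k0: "?k u z \<ge> 0" for u z by (simp add: slobodeckij_kernel_def case_prod_beta)
  define F where "F = (\<lambda>z. ?k f z powr (1 / p))"
  define G where "G = (\<lambda>z. ?k g z powr (1 / p))"
  have FG: "F z powr p = ?k f z" "G z powr p = ?k g z" for z
    using p k0 by (auto simp: F_def G_def powr_powr)
  have int: "integrable ?M (?k f)" "integrable ?M (?k g)" using f g by (auto simp: slobodeckij_finite_def)
  have [measurable]: "F \<in> borel_measurable ?M" "G \<in> borel_measurable ?M"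
    using borel_measurable_integrable[OF int(1)] borel_measurable_integrable[OF int(2)] unfolding F_def G_def by measurable
  have M: "integrable ?M (\<lambda>z. (F z + G z) powr p)"
    "(LINT z|?M. (F z + G z) powr p) powr (1 / p) \<le> (LINT z|?M. F z powr p) powr (1 / p) + (LINT z|?M. G z powr p) powr (1 / p)"
    by (rule Minkowski_integral[OF p]; (simp add: FG int)?; simp add: F_def G_def)+
  have hm: "?h \<in> borel_measurable lebesgue" using fm gm by measurable
  have root: "?k u z powr (1 / p) = norm (u (fst z) - u (snd z)) / norm (fst z - snd z) powr ((real CARD('n) + \<theta> * p) / p)" for u z
    using p by (simp add: slobodeckij_kernel_def case_prod_beta powr_divide powr_powr)
  have le: "?k ?h z \<le> (F z + G z) powr p" for z
  proof -
    have "norm (?h (fst z) - ?h (snd z)) \<le> norm (f (fst z) - f (snd z)) + norm (g (fst z) - g (snd z))"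
    proof -
      have "?h (fst z) - ?h (snd z) = (f (fst z) - f (snd z)) + c *\<^sub>R (g (fst z) - g (snd z))"
        by (simp add: algebra_simps)
      then have "norm (?h (fst z) - ?h (snd z)) = norm ((f (fst z) - f (snd z)) + c *\<^sub>R (g (fst z) - g (snd z)))"
        by (rule arg_cong)
      also have "\<dots> \<le> norm (f (fst z) - f (snd z)) + norm (c *\<^sub>R (g (fst z) - g (snd z)))"
        by (rule norm_triangle_ineq)
      finally show ?thesis using c by simp
    qed
    then have "?k ?h z powr (1 / p) \<le> F z + G z"
      unfolding F_def G_def root by (simp add: divide_right_mono flip: add_divide_distrib)
    then have "(?k ?h z powr (1 / p)) powr p \<le> (F z + G z) powr p" using p by (intro powr_mono2) auto
    then show ?thesis using p k0[of ?h z] by (simp add: powr_powr)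
  qed
  have inth: "integrable ?M (?k ?h)"
  proof (rule Bochner_Integration.integrable_bound[OF M(1) slobodeckij_kernel_measurable[OF hm]])
    show "AE z in ?M. norm (?k ?h z) \<le> norm ((F z + G z) powr p)"
    proof (rule AE_I2)
      fix z
      have "norm (?k ?h z) = ?k ?h z" by (simp only: real_norm_def abs_of_nonneg[OF k0])
      also have "\<dots> \<le> (F z + G z) powr p" by (rule le)
      also have "\<dots> = norm ((F z + G z) powr p)" by simp
      finally show "norm (?k ?h z) \<le> norm ((F z + G z) powr p)" .
    qed
  qed
  then show "slobodeckij_finite \<theta> p ?h" by (simp add: slobodeckij_finite_def)
  have "(LINT z|?M. ?k ?h z) \<le> (LINT z|?M. (F z + G z) powr p)"
    by (rule integral_mono[OF inth M(1) le])
  then have "slobodeckij_seminorm \<theta> p ?h \<le> (LINT z|?M. (F z + G z) powr p) powr (1 / p)"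
    unfolding slobodeckij_seminorm_def using p k0 by (intro powr_mono2 Bochner_Integration.integral_nonneg) auto
  then show "slobodeckij_seminorm \<theta> p ?h \<le> slobodeckij_seminorm \<theta> p f + slobodeckij_seminorm \<theta> p g"
    using M(2) unfolding FG slobodeckij_seminorm_def by linarith
qed

lemma sobolev_triangle:
  fixes u v :: "real^'n::finite \<Rightarrow> 'b::{real_normed_field,euclidean_space}"
  assumes u: "u \<in> sobolev t p" and v: "v \<in> sobolev t p" and p: "p \<ge> 1" and c: "\<bar>c\<bar> = 1"
  shows "(\<lambda>x. u x + c *\<^sub>R v x) \<in> sobolev t p" "sobolev_norm t p (\<lambda>x. u x + c *\<^sub>R v x) \<le> sobolev_norm t p u + sobolev_norm t p v"
proof -
  define k where "k = nat \<lfloor>t\<rfloor>"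
  let ?h = "\<lambda>x. u x + c *\<^sub>R v x"
  let ?w = "\<lambda>\<nu> x. weak_deriv \<nu> u x + c *\<^sub>R weak_deriv \<nu> v x"
  have ui: "u \<in> sobolev_int k p" "v \<in> sobolev_int k p" using sobolev_imp_sobolev_int u v by (auto simp: k_def)
  then have Lp: "u \<in> Lp_space p" "v \<in> Lp_space p" by (auto simp: sobolev_int_def)
  have wd: "has_weak_deriv \<nu> ?h (?w \<nu>)" if "mi_order \<nu> \<le> k" for \<nu>
    using that by (intro has_weak_deriv_lincomb sobolev_weak_deriv[OF u] sobolev_weak_deriv[OF v]) (auto simp: k_def)
  have ae: "AE x in lborel. ?w \<nu> x = weak_deriv \<nu> ?h x" if "mi_order \<nu> \<le> k" for \<nu>
    using weak_deriv_AE[OF wd[OF that]] by eventually_elim simp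
  have wLp: "weak_deriv \<nu> u \<in> Lp_space p" "weak_deriv \<nu> v \<in> Lp_space p" if "mi_order \<nu> \<le> k" for \<nu>
    using ui that by (auto simp: sobolev_int_def)
  note tri = Lp_norm_triangle[OF wLp p c]
  have hLp: "weak_deriv \<nu> ?h \<in> Lp_space p" "Lp_norm p (weak_deriv \<nu> ?h) \<le> Lp_norm p (weak_deriv \<nu> u) + Lp_norm p (weak_deriv \<nu> v)"
    if "mi_order \<nu> \<le> k" for \<nu>
    using Lp_norm_cong[OF tri(1)[OF that that] ae[OF that]] tri(2)[OF that that] by auto
  have "?h \<in> Lp_space p" by (rule Lp_norm_triangle[OF Lp p c])
  then have hi: "?h \<in> sobolev_int k p" using wd hLp by (auto simp: sobolev_int_def)
  have ni: "sobolev_int_norm k p ?h \<le> sobolev_int_norm k p u + sobolev_int_norm k p v"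
    unfolding sobolev_int_norm_def sum.distrib[symmetric] using hLp(2) by (intro sum_mono) auto
  have m: "weak_deriv \<nu> u \<in> borel_measurable lebesgue" "weak_deriv \<nu> v \<in> borel_measurable lebesgue" "?w \<nu> \<in> borel_measurable lebesgue"
    if "mi_order \<nu> \<le> k" for \<nu>
    using wLp[OF that] tri(1)[OF that that] by (auto simp: Lp_space_def)
  have sl: "slobodeckij_finite (frac t) p (weak_deriv \<nu> ?h) \<and> slobodeckij_seminorm (frac t) p (weak_deriv \<nu> ?h)
      \<le> slobodeckij_seminorm (frac t) p (weak_deriv \<nu> u) + slobodeckij_seminorm (frac t) p (weak_deriv \<nu> v)"
    if o: "mi_order \<nu> = k" and t: "t \<notin> \<nat>" for \<nu>
  proof -
    have o': "mi_order \<nu> \<le> k" using o by simp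
    have "slobodeckij_finite (frac t) p (weak_deriv \<nu> u)" "slobodeckij_finite (frac t) p (weak_deriv \<nu> v)"
      using u v o t by (auto simp: sobolev_def k_def)
    from slobodeckij_triangle[OF m(1,2)[OF o'] this p c] show ?thesis
      using slobodeckij_cong[OF m(3)[OF o'] ae[OF o'], of "frac t" p] by simp
  qed
  show "?h \<in> sobolev t p" using hi sl by (auto simp: sobolev_def k_def)
  show "sobolev_norm t p ?h \<le> sobolev_norm t p u + sobolev_norm t p v"
  proof (cases "t \<in> \<nat>")
    case True
    then show ?thesis using ni by (simp add: sobolev_norm_def k_def)
  next
    case False
    have "(\<Sum>\<nu> | mi_order \<nu> = k. slobodeckij_seminorm (frac t) p (weak_deriv \<nu> ?h))
      \<le> (\<Sum>\<nu> | mi_order \<nu> = k. slobodeckij_seminorm (frac t) p (weak_deriv \<nu> u)) + (\<Sum>\<nu> | mi_order \<nu> = k. slobodeckij_seminorm (frac t) p (weak_deriv \<nu> v))"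
      unfolding sum.distrib[symmetric] using sl False by (intro sum_mono) auto
    then show ?thesis using ni False by (simp add: sobolev_norm_def k_def)
  qed
qed

lemma sobolev_add:
  fixes u v :: "real^'n::finite \<Rightarrow> 'b::{real_normed_field,euclidean_space}"
  assumes "u \<in> sobolev t p" "v \<in> sobolev t p" "p \<ge> 1"
  shows "(\<lambda>x. u x + v x) \<in> sobolev t p" "sobolev_norm t p (\<lambda>x. u x + v x) \<le> sobolev_norm t p u + sobolev_norm t p v"
  using sobolev_triangle[OF assms, of 1] by auto

lemma sobolev_diff:
  fixes u v :: "real^'n::finite \<Rightarrow> 'b::{real_normed_field,euclidean_space}"
  assumes "u \<in> sobolev t p" "v \<in> sobolev t p" "p \<ge> 1"
  shows "(\<lambda>x. u x - v x) \<in> sobolev t p"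
  using sobolev_triangle(1)[OF assms, of "-1"] by auto

lemma sobolev_norm_triangle_diff:
  fixes u v w :: "real^'n::finite \<Rightarrow> 'b::{real_normed_field,euclidean_space}"
  assumes "u \<in> sobolev t p" "v \<in> sobolev t p" "w \<in> sobolev t p" "p \<ge> 1"
  shows "sobolev_norm t p (\<lambda>x. u x - w x) \<le> sobolev_norm t p (\<lambda>x. u x - v x) + sobolev_norm t p (\<lambda>x. v x - w x)"
  using sobolev_add(2)[OF sobolev_diff[OF assms(1,2,4)] sobolev_diff[OF assms(2,3,4)] assms(4)] by simp

lemma has_weak_deriv_zero_function:
  "has_weak_deriv \<nu> (\<lambda>_ :: real^'n::finite. 0 :: 'b::{real_normed_field,euclidean_space}) (\<lambda>_. 0)"
  by (simp add: has_weak_deriv_def locally_integrable_def set_integrable_def)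

lemma sobolev_norm_zero:
  assumes p: "p \<ge> 1"
  shows "sobolev_norm t p (\<lambda>_ :: real^'n::finite. 0 :: 'b::{real_normed_field,euclidean_space}) = 0"
proof -
  let ?z = "\<lambda>_ :: real^'n. 0 :: 'b"
  have ae: "AE x in lborel. ?z x = weak_deriv \<nu> ?z x" for \<nu>
    using weak_deriv_AE[OF has_weak_deriv_zero_function, of \<nu>] by eventually_elim simp
  have zLp: "?z \<in> Lp_space p" by (simp add: Lp_space_def)
  have "Lp_norm p (weak_deriv \<nu> ?z) = 0" for \<nu>
    using Lp_norm_cong(2)[OF zLp ae] by (simp add: Lp_norm_def)
  moreover have "slobodeckij_seminorm \<theta> p (weak_deriv \<nu> ?z) = 0" for \<nu> \<theta>
  proof -
    have "slobodeckij_seminorm \<theta> p ?z = slobodeckij_seminorm \<theta> p (weak_deriv \<nu> ?z)"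
      by (rule slobodeckij_cong(2)[OF _ ae]) simp
    then show ?thesis by (simp add: slobodeckij_seminorm_def slobodeckij_kernel_def case_prod_beta)
  qed
  ultimately show ?thesis by (simp add: sobolev_norm_def sobolev_int_norm_def)
qed

section \<open>Continuity of the multiplication\<close>

lemma openin_norm_ball:
  assumes tri: "\<And>u v w. u \<in> V \<Longrightarrow> v \<in> V \<Longrightarrow> w \<in> V \<Longrightarrow>
      N (\<lambda>x. u x - w x) \<le> N (\<lambda>x. u x - v x) + N (\<lambda>x. v x - w x)" and u: "u \<in> V"
  shows "openin (norm_topology V N) {v \<in> V. N (\<lambda>x. v x - u x) < (d::real)}"
  unfolding openin_norm_topology
proof (intro conjI ballI)
  fix v assume v: "v \<in> {v \<in> V. N (\<lambda>x. v x - u x) < d}"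
  show "\<exists>\<epsilon>>0. \<forall>w\<in>V. N (\<lambda>x. w x - v x) < \<epsilon> \<longrightarrow> w \<in> {v \<in> V. N (\<lambda>x. v x - u x) < d}"
  proof (intro exI[of _ "d - N (\<lambda>x. v x - u x)"] conjI ballI impI)
    show "0 < d - N (\<lambda>x. v x - u x)" using v by simp
    fix w assume w: "w \<in> V" "N (\<lambda>x. w x - v x) < d - N (\<lambda>x. v x - u x)"
    then show "w \<in> {v \<in> V. N (\<lambda>x. v x - u x) < d}" using tri[of w v u] v u by auto
  qed
qed auto

lemma topspace_norm_topology: "topspace (norm_topology V N) = V"
proof
  show "topspace (norm_topology V N) \<subseteq> V"
    using openin_topspace[of "norm_topology V N"] unfolding openin_norm_topology by blast
  have "openin (norm_topology V N) V" unfolding openin_norm_topology by (auto intro: exI[of _ 1])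
  then show "V \<subseteq> topspace (norm_topology V N)" by (rule openin_subset)
qed

text \<open>
  Because \<open>u v - u\<^sub>0 v\<^sub>0 = (u - u\<^sub>0) v + u\<^sub>0 (v - v\<^sub>0)\<close>.
\<close>

lemma continuous_map_multiplication:
  fixes V1 V2 V :: "('a \<Rightarrow> 'b::field) set" and N1 N2 N :: "('a \<Rightarrow> 'b) \<Rightarrow> real"
  assumes tri1: "\<And>u v w. u \<in> V1 \<Longrightarrow> v \<in> V1 \<Longrightarrow> w \<in> V1 \<Longrightarrow> N1 (\<lambda>x. u x - w x) \<le> N1 (\<lambda>x. u x - v x) + N1 (\<lambda>x. v x - w x)"
    and tri2: "\<And>u v w. u \<in> V2 \<Longrightarrow> v \<in> V2 \<Longrightarrow> w \<in> V2 \<Longrightarrow> N2 (\<lambda>x. u x - w x) \<le> N2 (\<lambda>x. u x - v x) + N2 (\<lambda>x. v x - w x)"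
    and add: "\<And>u v. u \<in> V \<Longrightarrow> v \<in> V \<Longrightarrow> N (\<lambda>x. u x + v x) \<le> N u + N v"
    and add2: "\<And>u v. u \<in> V2 \<Longrightarrow> v \<in> V2 \<Longrightarrow> N2 (\<lambda>x. u x + v x) \<le> N2 u + N2 v"
    and diff: "\<And>u v. u \<in> V1 \<Longrightarrow> v \<in> V1 \<Longrightarrow> (\<lambda>x. u x - v x) \<in> V1" "\<And>u v. u \<in> V2 \<Longrightarrow> v \<in> V2 \<Longrightarrow> (\<lambda>x. u x - v x) \<in> V2"
    and zero: "N1 (\<lambda>_. 0) = 0" "N2 (\<lambda>_. 0) = 0"
    and nonneg: "\<And>u. N1 u \<ge> 0" "\<And>u. N2 u \<ge> 0"
    and C: "C > 0" "\<And>u v A B. A > 0 \<Longrightarrow> B > 0 \<Longrightarrow> u \<in> V1 \<Longrightarrow> N1 u \<le> A \<Longrightarrow> v \<in> V2 \<Longrightarrow> N2 v \<le> B \<Longrightarrow>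
      (\<lambda>x. u x * v x) \<in> V \<and> N (\<lambda>x. u x * v x) \<le> C * (A * B)"
  shows "continuous_map (prod_topology (norm_topology V1 N1) (norm_topology V2 N2)) (norm_topology V N)
     (\<lambda>(u, v) x. u x * v x)"
  unfolding continuous_map_def topspace_prod_topology topspace_norm_topology
proof (intro conjI allI impI)
  have mem: "(\<lambda>x. u x * v x) \<in> V" if "u \<in> V1" "v \<in> V2" for u v
    by (rule conjunct1[OF C(2)[of "N1 u + 1" "N2 v + 1" u v]])
       (use that nonneg(1)[of u] nonneg(2)[of v] in simp_all)
  show "(\<lambda>(u, v) x. u x * v x) \<in> V1 \<times> V2 \<rightarrow> V"
  proof (rule funcsetI)
    fix z assume "z \<in> V1 \<times> V2"
    then show "(case z of (u, v) \<Rightarrow> \<lambda>x. u x * v x) \<in> V" by (cases z) (simp add: mem)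
  qed
  fix U assume U: "openin (norm_topology V N) U"
  let ?P = "{z \<in> V1 \<times> V2. (case z of (u, v) \<Rightarrow> \<lambda>x. u x * v x) \<in> U}"
  show "openin (prod_topology (norm_topology V1 N1) (norm_topology V2 N2)) ?P"
    unfolding openin_prod_topology_alt
  proof (intro allI impI)
    fix u0 v0 assume "(u0, v0) \<in> ?P"
    then have uv: "u0 \<in> V1" "v0 \<in> V2" "(\<lambda>x. u0 x * v0 x) \<in> U" by auto
    obtain e where e: "e > 0" "\<And>w. w \<in> V \<Longrightarrow> N (\<lambda>x. w x - u0 x * v0 x) < e \<Longrightarrow> w \<in> U"
      using bspec[OF conjunct2[OF U[unfolded openin_norm_topology]] uv(3)] by auto
    define R where "R = C * (N1 u0 + N2 v0 + 2)"
    have R: "R > 0" using C(1) nonneg(1)[of u0] nonneg(2)[of v0] by (simp add: R_def add_nonneg_pos)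
    \<comment> \<open>for \<open>d \<le> 1\<close> the norm of \<open>v\<close> exceeds that of \<open>v0\<close> by at most one\<close>
    define d where "d = min 1 (e / (2 * R))"
    have d: "d > 0" "d \<le> 1" "d * R < e"
    proof -
      show "d > 0" "d \<le> 1" using e R by (auto simp: d_def)
      have "d * R \<le> e / (2 * R) * R" using R by (intro mult_right_mono) (auto simp: d_def)
      also have "\<dots> < e" using e R by simp
      finally show "d * R < e" .
    qed
    define U1 where "U1 = {u \<in> V1. N1 (\<lambda>x. u x - u0 x) < d}"
    define U2 where "U2 = {v \<in> V2. N2 (\<lambda>x. v x - v0 x) < d}"
    have o: "openin (norm_topology V1 N1) U1" "openin (norm_topology V2 N2) U2"
      unfolding U1_def U2_def using tri1 tri2 uv by (auto intro!: openin_norm_ball)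
    have c: "u0 \<in> U1" "v0 \<in> U2" using uv zero d by (auto simp: U1_def U2_def)
    have sub: "U1 \<times> U2 \<subseteq> ?P"
    proof
      fix z assume "z \<in> U1 \<times> U2"
      then obtain u v where z: "z = (u, v)" and u: "u \<in> U1" and v: "v \<in> U2" by auto
      then have uV: "u \<in> V1" "v \<in> V2" "N1 (\<lambda>x. u x - u0 x) < d" "N2 (\<lambda>x. v x - v0 x) < d"
        by (auto simp: U1_def U2_def)
      have vb: "N2 v \<le> N2 v0 + 1"
        using add2[OF diff(2)[OF uV(2) uv(2)] uv(2)] uV(4) d by simp
      have 1: "(\<lambda>x. (u x - u0 x) * v x) \<in> V \<and> N (\<lambda>x. (u x - u0 x) * v x) \<le> C * (d * (N2 v0 + 1))"
        by (rule C(2)) (use d uV vb nonneg(2)[of v0] diff(1)[OF uV(1) uv(1)] in \<open>auto simp: add_nonneg_pos\<close>)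
      have 2: "(\<lambda>x. u0 x * (v x - v0 x)) \<in> V \<and> N (\<lambda>x. u0 x * (v x - v0 x)) \<le> C * ((N1 u0 + 1) * d)"
        by (rule C(2)) (use d uV uv nonneg(1)[of u0] diff(2)[OF uV(2) uv(2)] in \<open>auto simp: add_nonneg_pos\<close>)
      have "N (\<lambda>x. u x * v x - u0 x * v0 x) = N (\<lambda>x. (u x - u0 x) * v x + u0 x * (v x - v0 x))"
        by (rule arg_cong[where f = N]) (auto simp: algebra_simps)
      also have "\<dots> \<le> C * (d * (N2 v0 + 1)) + C * ((N1 u0 + 1) * d)"
        using add[of "\<lambda>x. (u x - u0 x) * v x" "\<lambda>x. u0 x * (v x - v0 x)"] 1 2 by simp
      also have "\<dots> = d * R" by (simp add: R_def algebra_simps)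
      also have "\<dots> < e" by (rule d(3))
      finally have "(\<lambda>x. u x * v x) \<in> U" by (intro e(2) mem uV)
      then show "z \<in> ?P" using uV z by simp
    qed
    show "\<exists>Ua Ub. openin (norm_topology V1 N1) Ua \<and> openin (norm_topology V2 N2) Ub \<and> u0 \<in> Ua \<and> v0 \<in> Ub \<and> Ua \<times> Ub \<subseteq> ?P"
      using o c sub by blast
  qed
qed

lemma sobolev_norm_nonneg: "sobolev_norm t p u \<ge> 0"
  using sobolev_int_norm_le sobolev_int_norm_nonneg by (rule order_trans[rotated])

theorem theorem6p1:
  fixes s1 s2 s p1 p2 p :: real
  assumes "1 \<le> p" "1 \<le> p1" "1 \<le> p2"
    and "s1 \<ge> s" "s2 \<ge> s" "s \<ge> 0"
    and "s \<in> \<nat>"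
    and "(s1 - s \<ge> real CARD('n::finite) * (1 / p1 - 1 / p) \<and>
          s2 - s \<ge> real CARD('n) * (1 / p2 - 1 / p) \<and>
          s1 + s2 - s > real CARD('n) * (1 / p1 + 1 / p2 - 1 / p) \<and>
          real CARD('n) * (1 / p1 + 1 / p2 - 1 / p) \<ge> 0) \<or>
         (s1 - s > real CARD('n) * (1 / p1 - 1 / p) \<and>
          s2 - s > real CARD('n) * (1 / p2 - 1 / p) \<and>
          s1 + s2 - s \<ge> real CARD('n) * (1 / p1 + 1 / p2 - 1 / p) \<and>
          real CARD('n) * (1 / p1 + 1 / p2 - 1 / p) \<ge> 0)"
  shows "(\<forall>u \<in> sobolev s1 p1. \<forall>v \<in> sobolev s2 p2.
            (\<lambda>x :: real^'n. u x * v x :: 'b::{real_normed_field,euclidean_space}) \<in> sobolev s p) \<and>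
         continuous_bilinear_on
           (sobolev s1 p1) (sobolev_norm s1 p1)
           (sobolev s2 p2) (sobolev_norm s2 p2)
           (sobolev s p) (sobolev_norm s p)
           (\<lambda>(u :: real^'n \<Rightarrow> 'b) v x. u x * v x)"
proof -
  have me: "multiplication_exponents (real CARD('n)) s1 s2 s p1 p2 p"
    unfolding multiplication_exponents_def using assms by blast
  obtain C where C: "C > 0" "\<And>(u :: real^'n \<Rightarrow> 'b) v A B. A > 0 \<Longrightarrow> B > 0 \<Longrightarrow> u \<in> sobolev s1 p1 \<Longrightarrow>
     sobolev_norm s1 p1 u \<le> A \<Longrightarrow> v \<in> sobolev s2 p2 \<Longrightarrow> sobolev_norm s2 p2 v \<le> B \<Longrightarrow>
     (\<lambda>x. u x * v x) \<in> sobolev s p \<and> sobolev_norm s p (\<lambda>x. u x * v x) \<le> C * (A * B)"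
    using sobolev_product_bound[where 'b = 'b, OF me] by blast
  have mem: "(\<lambda>x. u x * v x) \<in> sobolev s p" if "u \<in> sobolev s1 p1" "v \<in> sobolev s2 p2" for u v :: "real^'n \<Rightarrow> 'b"
    using C(2)[of "sobolev_norm s1 p1 u + 1" "sobolev_norm s2 p2 v + 1" u v] that
      sobolev_norm_nonneg[of s1 p1 u] sobolev_norm_nonneg[of s2 p2 v] by auto
  have "continuous_map (prod_topology (norm_topology (sobolev s1 p1) (sobolev_norm s1 p1)) (norm_topology (sobolev s2 p2) (sobolev_norm s2 p2)))
      (norm_topology (sobolev s p) (sobolev_norm s p)) (\<lambda>(u :: real^'n \<Rightarrow> 'b, v) x. u x * v x)"
    by (rule continuous_map_multiplication[OF _ _ _ _ _ _ _ _ _ _ C])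
       (simp_all add: assms sobolev_norm_triangle_diff sobolev_add sobolev_diff sobolev_norm_zero sobolev_norm_nonneg)
  then show ?thesis
    unfolding continuous_bilinear_on_def using mem by (auto simp: algebra_simps)
qed

end
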